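(* Let $\mathcal{K}$ be the Koopman operator of a measure-preserving dynamical system on $L^2(\Omega,\omega)$, with spectral measure $\mathcal{E}$, and for each $N$ let $V_N$ be the span of a dictionary of $N$ functions, with mpEDMD matrices $\mathbb{K}=\mathbb{K}_{N,M}$ computed from $M$ snapshots and associated measures $\mathcal{E}_{N,M}$ (see context). Suppose that $\lim_{N\rightarrow\infty}\mathrm{dist}(h,V_{N})=0$ for all $h\in L^2(\Omega,\omega)$; that, for each fixed $N$, the quadrature converges, i.e. $\lim_{M\to\infty}G_{jk}=\langle\psi_k,\psi_j\rangle$ and $\lim_{M\to\infty}A_{jk}=\langle\mathcal{K}\psi_k,\psi_j\rangle$ for $1\le j,k\le N$; that $\mathcal{K}$ is unitary; and that $\phi:\mathbb{T}\rightarrow\mathbb{R}$ is Lipschitz continuous. Then for any $g\in L^2(\Omega,\omega)$ and $\pmb{g}_N\in\mathbb{C}^N$ with $\lim_{N\rightarrow\infty}\|g-\Psi \pmb{g}_N\|=0$, $$ \lim_{N\rightarrow\infty}\limsup_{M\rightarrow\infty}\left\|\int_{\mathbb{T}} \phi(\lambda)\,d\mathcal{E}(\lambda)g-\Psi \int_{\mathbb{T}}\phi(\lambda)\, d\mathcal{E}_{N,M}(\lambda)\, \pmb{g}_N\right\|=0. $$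
   Context: Setting. $\Omega\subseteq\mathbb{R}^d$, $\omega$ is a positive measure on $\Omega$, and $F:\Omega\to\Omega$ is measurable and preserves $\omega$. The Koopman operator $\mathcal{K}g=g\circ F$ is an isometry on $L^2(\Omega,\omega)$, whose inner product (linear in the first argument) and norm are $\langle\cdot,\cdot\rangle$ and $\|\cdot\|$. $\mathbb{T}$ is the unit circle in $\mathbb{C}$. When $\mathcal{K}$ is unitary, $\mathcal{E}$ is its projection-valued spectral measure on $\mathbb{T}$, given by the spectral theorem. mpEDMD. For each $N$ there is a dictionary $\psi_1,\dots,\psi_N\in L^2(\Omega,\omega)$ (possibly depending on $N$), linearly independent, with span $V_N$. Write $\Psi(\pmb{x})=[\psi_1(\pmb{x})\ \cdots\ \psi_N(\pmb{x})]$, and for $\pmb{c}\in\mathbb{C}^N$, $\Psi\pmb{c}=\sum_j c_j\psi_j\in V_N$. For each $M$ the data are points $\pmb{x}^{(m)}\in\Omega$, $\pmb{y}^{(m)}=F(\pmb{x}^{(m)})$, $m=1,\dots,M$, with quadrature weights $w_m\ge 0$ (points and weights may depend on $M$); $W=\mathrm{diag}(w_1,\dots,w_M)$. $\Psi_X,\Psi_Y\in\mathbb{C}^{M\times N}$ are the matrices whose $m$th rows are $\Psi(\pmb{x}^{(m)})$ and $\Psi(\pmb{y}^{(m)})$. Put $G=\Psi_X^*W\Psi_X$ and $A=\Psi_X^*W\Psi_Y$ (both depend on $N,M$); $G$ is assumed invertible. Take any singular value decomposition $G^{-1/2}A^*G^{-1/2}=U_1\Sigma U_2^*$ with $U_1,U_2$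 unitary, and set $\mathbb{K}=G^{-1/2}U_2U_1^*G^{1/2}\in\mathbb{C}^{N\times N}$. Take an eigendecomposition $U_2U_1^*=\hat V\Lambda\hat V^*$ with $\hat V$ unitary and $\Lambda=\mathrm{diag}(\lambda_1,\dots,\lambda_N)$, and let $v_j$ be the $j$th column of $V=G^{-1/2}\hat V$, so that $\mathbb{K}v_j=\lambda_jv_j$. The measure $\mathcal{E}_{N,M}$ is the $\mathbb{C}^{N\times N}$-valued measure $\mathcal{E}_{N,M}=\sum_{j=1}^N v_jv_j^*G\,\delta_{\lambda_j}$ ($\delta_\lambda$ the Dirac measure at $\lambda$), so $\int_{\mathbb{T}}\phi\,d\mathcal{E}_{N,M}\,\pmb{g}=\sum_j\phi(\lambda_j)v_jv_j^*G\pmb{g}$. $\mathrm{dist}(h,V_N)=\inf_{f\in V_N}\|h-f\|$. *)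

theory Defs
  imports
    "HOL-Analysis.Analysis"
    "HOL-Probability.Giry_Monad"
    "Jordan_Normal_Form.Schur_Decomposition"
begin

text \<open>
  Elements of \<open>L\<^sup>2\<close> are represented by square integrable functions, so that point evaluations of
  the dictionary at the data make sense; identities in \<open>L\<^sup>2\<close> are almost everywhere identities.
  Dimension-dependent vectors and matrices are those of \<^theory>\<open>Jordan_Normal_Form.Matrix\<close>, and all
  finite families are indexed from \<open>0\<close>.
\<close>

section \<open>The space \<open>L\<^sup>2\<close>\<close>

definition L2 :: "'a measure \<Rightarrow> ('a \<Rightarrow> complex) set" where
  "L2 \<omega> = {f \<in> borel_measurable \<omega>. integrable \<omega> (\<lambda>x. (cmod (f x))\<^sup>2)}"

definition L2_inner :: "'a measure \<Rightarrow> ('a \<Rightarrow> complex) \<Rightarrow> ('a \<Rightarrow> complex) \<Rightarrow> complex" where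
  "L2_inner \<omega> f g = (\<integral>x. f x * cnj (g x) \<partial>\<omega>)"

definition L2_norm :: "'a measure \<Rightarrow> ('a \<Rightarrow> complex) \<Rightarrow> real" where
  "L2_norm \<omega> f = sqrt (\<integral>x. (cmod (f x))\<^sup>2 \<partial>\<omega>)"

definition L2_dist :: "'a measure \<Rightarrow> ('a \<Rightarrow> complex) \<Rightarrow> ('a \<Rightarrow> complex) set \<Rightarrow> real" where
  "L2_dist \<omega> h V = (INF f\<in>V. L2_norm \<omega> (\<lambda>x. h x - f x))"

section \<open>Operators on \<open>L\<^sup>2\<close>\<close>

text \<open>A linear operator on the space of almost everywhere classes.\<close>

definition L2_linear :: "'a measure \<Rightarrow> (('a \<Rightarrow> complex) \<Rightarrow> ('a \<Rightarrow> complex)) \<Rightarrow> bool" where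
  "L2_linear \<omega> T \<longleftrightarrow>
     (\<forall>f\<in>L2 \<omega>. T f \<in> L2 \<omega>) \<and>
     (\<forall>f\<in>L2 \<omega>. \<forall>g\<in>L2 \<omega>. (AE x in \<omega>. f x = g x) \<longrightarrow> (AE x in \<omega>. T f x = T g x)) \<and>
     (\<forall>f\<in>L2 \<omega>. \<forall>g\<in>L2 \<omega>. \<forall>a b. AE x in \<omega>. T (\<lambda>y. a * f y + b * g y) x = a * T f x + b * T g x)"

definition L2_unitary :: "'a measure \<Rightarrow> (('a \<Rightarrow> complex) \<Rightarrow> ('a \<Rightarrow> complex)) \<Rightarrow> bool" where
  "L2_unitary \<omega> T \<longleftrightarrow> L2_linear \<omega> T \<and>
     (\<forall>f\<in>L2 \<omega>. \<forall>g\<in>L2 \<omega>. L2_inner \<omega> (T f) (T g) = L2_inner \<omega> f g) \<and>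
     (\<forall>h\<in>L2 \<omega>. \<exists>f\<in>L2 \<omega>. AE x in \<omega>. T f x = h x)"

definition L2_orthogonal_projection :: "'a measure \<Rightarrow> (('a \<Rightarrow> complex) \<Rightarrow> ('a \<Rightarrow> complex)) \<Rightarrow> bool" where
  "L2_orthogonal_projection \<omega> P \<longleftrightarrow> L2_linear \<omega> P \<and>
     (\<forall>f\<in>L2 \<omega>. AE x in \<omega>. P (P f) x = P f x) \<and>
     (\<forall>f\<in>L2 \<omega>. \<forall>g\<in>L2 \<omega>. L2_inner \<omega> (P f) g = L2_inner \<omega> f (P g))"

definition koopman :: "('a \<Rightarrow> 'a) \<Rightarrow> ('a \<Rightarrow> complex) \<Rightarrow> ('a \<Rightarrow> complex)" where
  "koopman F g = g \<circ> F"

section \<open>Projection-valued measures on the unit circle\<close>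

abbreviation unit_circle :: "complex set" where
  "unit_circle \<equiv> sphere 0 1"

abbreviation circle_borel :: "complex measure" where
  "circle_borel \<equiv> restrict_space borel unit_circle"

definition projection_valued_measure ::
  "'a measure \<Rightarrow> (complex set \<Rightarrow> ('a \<Rightarrow> complex) \<Rightarrow> ('a \<Rightarrow> complex)) \<Rightarrow> bool" where
  "projection_valued_measure \<omega> E \<longleftrightarrow>
     (\<forall>S\<in>sets circle_borel. L2_orthogonal_projection \<omega> (E S)) \<and>
     (\<forall>f\<in>L2 \<omega>. AE x in \<omega>. E {} f x = 0) \<and>
     (\<forall>f\<in>L2 \<omega>. AE x in \<omega>. E unit_circle f x = f x) \<and>
     (\<forall>S\<in>sets circle_borel. \<forall>S'\<in>sets circle_borel. \<forall>f\<in>L2 \<omega>.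
        AE x in \<omega>. E (S \<inter> S') f x = E S (E S' f) x) \<and>
     (\<forall>B. range B \<subseteq> sets circle_borel \<longrightarrow> disjoint_family B \<longrightarrow>
        (\<forall>f\<in>L2 \<omega>. (\<lambda>n. L2_norm \<omega> (\<lambda>x. E (\<Union>i. B i) f x - (\<Sum>i<n. E (B i) f x)))
           \<longlonglongrightarrow> 0))"

text \<open>
  The integral of a simple function \<open>s\<close>, applied to \<open>g\<close>, and its extension to bounded Borel
  functions \<open>\<phi>\<close>: \<open>h\<close> represents \<open>(\<integral> \<phi> dE) g\<close> if the integrals of some sequence of simple functions
  that converges uniformly to \<open>\<phi>\<close> converge to \<open>h\<close> in \<open>L\<^sup>2\<close>.  The limit does not depend on the
  sequence, so \<open>h\<close> is determined up to almost everywhere equality.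
\<close>

definition pvm_simple_integral ::
  "(complex set \<Rightarrow> ('a \<Rightarrow> complex) \<Rightarrow> ('a \<Rightarrow> complex)) \<Rightarrow> (complex \<Rightarrow> complex)
     \<Rightarrow> ('a \<Rightarrow> complex) \<Rightarrow> ('a \<Rightarrow> complex)" where
  "pvm_simple_integral E s g = (\<lambda>x. \<Sum>c\<in>s ` unit_circle. c * E {z\<in>unit_circle. s z = c} g x)"

definition has_pvm_integral ::
  "'a measure \<Rightarrow> (complex set \<Rightarrow> ('a \<Rightarrow> complex) \<Rightarrow> ('a \<Rightarrow> complex)) \<Rightarrow> (complex \<Rightarrow> complex)
     \<Rightarrow> ('a \<Rightarrow> complex) \<Rightarrow> ('a \<Rightarrow> complex) \<Rightarrow> bool" where
  "has_pvm_integral \<omega> E \<phi> g h \<longleftrightarrow> h \<in> L2 \<omega> \<and>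
     (\<exists>s. (\<forall>n. simple_function circle_borel (s n)) \<and>
          uniform_limit unit_circle s \<phi> sequentially \<and>
          (\<lambda>n. L2_norm \<omega> (\<lambda>x. h x - pvm_simple_integral E (s n) g x)) \<longlonglongrightarrow> 0)"

definition pvm_integral ::
  "'a measure \<Rightarrow> (complex set \<Rightarrow> ('a \<Rightarrow> complex) \<Rightarrow> ('a \<Rightarrow> complex)) \<Rightarrow> (complex \<Rightarrow> complex)
     \<Rightarrow> ('a \<Rightarrow> complex) \<Rightarrow> ('a \<Rightarrow> complex)" where
  "pvm_integral \<omega> E \<phi> g = (SOME h. has_pvm_integral \<omega> E \<phi> g h)"

text \<open>\<open>E\<close> is the projection-valued measure that the spectral theorem attaches to the unitary \<open>T\<close>,
  i.e. \<open>T = \<integral> \<lambda> dE(\<lambda>)\<close>.\<close>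

definition spectral_measure_of ::
  "'a measure \<Rightarrow> (('a \<Rightarrow> complex) \<Rightarrow> ('a \<Rightarrow> complex))
     \<Rightarrow> (complex set \<Rightarrow> ('a \<Rightarrow> complex) \<Rightarrow> ('a \<Rightarrow> complex)) \<Rightarrow> bool" where
  "spectral_measure_of \<omega> T E \<longleftrightarrow> projection_valued_measure \<omega> E \<and>
     (\<forall>g\<in>L2 \<omega>. has_pvm_integral \<omega> E (\<lambda>z. z) g (T g))"

section \<open>Dictionaries\<close>

definition dict_comb :: "(nat \<Rightarrow> 'a \<Rightarrow> complex) \<Rightarrow> complex Matrix.vec \<Rightarrow> 'a \<Rightarrow> complex" where
  "dict_comb \<psi> c = (\<lambda>x. \<Sum>j<dim_vec c. vec_index c j * \<psi> j x)"

definition dict_span :: "nat \<Rightarrow> (nat \<Rightarrow> 'a \<Rightarrow> complex) \<Rightarrow> ('a \<Rightarrow> complex) set" where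
  "dict_span N \<psi> = dict_comb \<psi> ` carrier_vec N"

definition dict_independent :: "'a measure \<Rightarrow> nat \<Rightarrow> (nat \<Rightarrow> 'a \<Rightarrow> complex) \<Rightarrow> bool" where
  "dict_independent \<omega> N \<psi> \<longleftrightarrow>
     (\<forall>c\<in>carrier_vec N. (AE x in \<omega>. dict_comb \<psi> c x = 0) \<longrightarrow> c = 0\<^sub>v N)"

section \<open>Matrices\<close>

definition unitary_matrix :: "nat \<Rightarrow> complex Matrix.mat \<Rightarrow> bool" where
  "unitary_matrix n U \<longleftrightarrow> U \<in> carrier_mat n n \<and>
     mat_adjoint U * U = 1\<^sub>m n \<and> U * mat_adjoint U = 1\<^sub>m n"

text \<open>The conditions on \<open>R\<close> say that \<open>R = G\<^sup>1\<^sup>/\<^sup>2\<close>, the unique positive semidefinite square root;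
  the inner product of \<open>R v\<close> with \<open>v\<close> is required to be real and nonnegative.\<close>

definition is_matrix_sqrt :: "nat \<Rightarrow> complex Matrix.mat \<Rightarrow> complex Matrix.mat \<Rightarrow> bool" where
  "is_matrix_sqrt n G R \<longleftrightarrow> R \<in> carrier_mat n n \<and> mat_adjoint R = R \<and>
     (\<forall>v\<in>carrier_vec n. \<exists>r\<ge>0. (R *\<^sub>v v) \<bullet>c v = complex_of_real r) \<and> R * R = G"

definition is_matrix_inverse :: "nat \<Rightarrow> complex Matrix.mat \<Rightarrow> complex Matrix.mat \<Rightarrow> bool" where
  "is_matrix_inverse n B C \<longleftrightarrow> C \<in> carrier_mat n n \<and> B * C = 1\<^sub>m n \<and> C * B = 1\<^sub>m n"

text \<open>\<open>B = U\<^sub>1 S U\<^sub>2\<^sup>*\<close>; no ordering of the singular values is imposed.\<close>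

definition is_svd :: "nat \<Rightarrow> complex Matrix.mat \<Rightarrow> complex Matrix.mat \<Rightarrow> complex Matrix.mat
    \<Rightarrow> complex Matrix.mat \<Rightarrow> bool" where
  "is_svd n B U1 S U2 \<longleftrightarrow> unitary_matrix n U1 \<and> unitary_matrix n U2 \<and>
     (\<exists>s. (\<forall>i<n. 0 \<le> s i) \<and> S = mat_diag n (\<lambda>i. complex_of_real (s i))) \<and>
     B = U1 * S * mat_adjoint U2"

definition outer_product :: "complex Matrix.vec \<Rightarrow> complex Matrix.mat" where
  "outer_product v =
     Matrix.mat (dim_vec v) (dim_vec v) (\<lambda>(i, k). vec_index v i * cnj (vec_index v k))"

section \<open>mpEDMD\<close>

definition data_matrix :: "nat \<Rightarrow> nat \<Rightarrow> (nat \<Rightarrow> 'a \<Rightarrow> complex) \<Rightarrow> (nat \<Rightarrow> 'a) \<Rightarrow> complex Matrix.mat" where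
  "data_matrix N M \<psi> p = Matrix.mat M N (\<lambda>(m, j). \<psi> j (p m))"

definition mpedmd_G :: "nat \<Rightarrow> nat \<Rightarrow> (nat \<Rightarrow> 'a \<Rightarrow> complex) \<Rightarrow> (nat \<Rightarrow> 'a) \<Rightarrow> (nat \<Rightarrow> real)
    \<Rightarrow> complex Matrix.mat" where
  "mpedmd_G N M \<psi> x w =
     mat_adjoint (data_matrix N M \<psi> x) * mat_diag M (\<lambda>m. complex_of_real (w m)) * data_matrix N M \<psi> x"

definition mpedmd_A :: "nat \<Rightarrow> nat \<Rightarrow> (nat \<Rightarrow> 'a \<Rightarrow> complex) \<Rightarrow> ('a \<Rightarrow> 'a) \<Rightarrow> (nat \<Rightarrow> 'a)
    \<Rightarrow> (nat \<Rightarrow> real) \<Rightarrow> complex Matrix.mat" where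
  "mpedmd_A N M \<psi> F x w =
     mat_adjoint (data_matrix N M \<psi> x) * mat_diag M (\<lambda>m. complex_of_real (w m))
       * data_matrix N M \<psi> (\<lambda>m. F (x m))"

text \<open>The choices made by the algorithm: \<open>R = G\<^sup>1\<^sup>/\<^sup>2\<close>, \<open>Q = G\<^sup>-\<^sup>1\<^sup>/\<^sup>2\<close>, an SVD
  \<open>Q A\<^sup>* Q = U\<^sub>1 S U\<^sub>2\<^sup>*\<close>, and an eigendecomposition of \<open>U\<^sub>2 U\<^sub>1\<^sup>*\<close> with unitary eigenvector matrix \<open>H\<close>
  and eigenvalues \<open>\<lambda>\<close>.\<close>

definition mpedmd_factors :: "nat \<Rightarrow> complex Matrix.mat \<Rightarrow> complex Matrix.mat
    \<Rightarrow> complex Matrix.mat \<Rightarrow> complex Matrix.mat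
    \<Rightarrow> complex Matrix.mat \<Rightarrow> complex Matrix.mat \<Rightarrow> complex Matrix.mat
    \<Rightarrow> complex Matrix.mat \<Rightarrow> (nat \<Rightarrow> complex) \<Rightarrow> bool" where
  "mpedmd_factors N G A R Q U1 S U2 H lam \<longleftrightarrow>
     is_matrix_sqrt N G R \<and> is_matrix_inverse N R Q \<and>
     is_svd N (Q * mat_adjoint A * Q) U1 S U2 \<and>
     unitary_matrix N H \<and> U2 * mat_adjoint U1 = H * mat_diag N lam * mat_adjoint H"

definition mpedmd_K :: "complex Matrix.mat \<Rightarrow> complex Matrix.mat \<Rightarrow> complex Matrix.mat
    \<Rightarrow> complex Matrix.mat \<Rightarrow> complex Matrix.mat" where
  "mpedmd_K R Q U1 U2 = Q * U2 * mat_adjoint U1 * R"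

definition mpedmd_V :: "complex Matrix.mat \<Rightarrow> complex Matrix.mat \<Rightarrow> complex Matrix.mat" where
  "mpedmd_V Q H = Q * H"

text \<open>The integral of \<open>\<phi>\<close> against the matrix-valued measure \<open>\<Sum>j<N. v\<^sub>j v\<^sub>j\<^sup>* G \<delta>(\<lambda>\<^sub>j)\<close>, where \<open>v\<^sub>j\<close> is
  the \<open>j\<close>th column of \<open>V\<close> and \<^term>\<open>return circle_borel\<close> yields the Dirac measures.\<close>

definition mpedmd_integral :: "nat \<Rightarrow> complex Matrix.mat \<Rightarrow> complex Matrix.mat \<Rightarrow> (nat \<Rightarrow> complex)
    \<Rightarrow> (complex \<Rightarrow> complex) \<Rightarrow> complex Matrix.mat" where
  "mpedmd_integral N G V lam \<phi> = Matrix.mat N N (\<lambda>ik. \<Sum>j<N.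
     (\<integral>z. \<phi> z \<partial>return circle_borel (lam j)) * ((outer_product (col V j) * G) $$ ik))"

lemma mat_adjoint_carrier: "B \<in> carrier_mat m n \<Longrightarrow> mat_adjoint B \<in> carrier_mat n m"
  unfolding mat_adjoint_def by (auto simp: mat_of_rows_def)

text \<open>The columns of \<open>V\<close> are eigenvectors of the mpEDMD matrix, with eigenvalues \<open>\<lambda>\<^sub>j\<close>.\<close>

lemma mpedmd_K_eigenvector:
  assumes f: "mpedmd_factors N G A R Q U1 S U2 H lam" and j: "j < N"
  shows "mpedmd_K R Q U1 U2 *\<^sub>v col (mpedmd_V Q H) j = lam j \<cdot>\<^sub>v col (mpedmd_V Q H) j"
proof -
  have R: "R \<in> carrier_mat N N" and Q: "Q \<in> carrier_mat N N" and RQ: "R * Q = 1\<^sub>m N"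
    and U1: "U1 \<in> carrier_mat N N" and U2: "U2 \<in> carrier_mat N N"
    and H: "H \<in> carrier_mat N N" and HH: "mat_adjoint H * H = 1\<^sub>m N"
    and eig: "U2 * mat_adjoint U1 = H * mat_diag N lam * mat_adjoint H"
    using f by (auto simp: mpedmd_factors_def is_matrix_sqrt_def is_matrix_inverse_def
        is_svd_def unitary_matrix_def)
  note [simp] = R Q U1 U2 H mat_adjoint_carrier[OF U1] mat_adjoint_carrier[OF H]
  have D[simp]: "mat_diag N lam \<in> carrier_mat N N" by (simp add: mat_diag_def)
  have M[simp]: "B * C \<in> carrier_mat N N" if "B \<in> carrier_mat N N" "C \<in> carrier_mat N N" for B C :: "complex Matrix.mat"
    using that by (rule mult_carrier_mat)
  note assoc = assoc_mult_mat[where ?n\<^sub>1=N and ?n\<^sub>2=N and ?n\<^sub>3=N and ?n\<^sub>4=N]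
  have "mpedmd_K R Q U1 U2 * (Q * H) = Q * (U2 * mat_adjoint U1) * (R * Q) * H"
    unfolding mpedmd_K_def by (simp add: assoc)
  also have "\<dots> = Q * H * mat_diag N lam * (mat_adjoint H * H)"
    unfolding RQ eig
    by (simp add: assoc left_mult_one_mat[OF H])
  also have "\<dots> = Q * H * mat_diag N lam"
    unfolding HH by (simp add: right_mult_one_mat[where nr=N and nc=N])
  finally have eq: "mpedmd_K R Q U1 U2 * (Q * H) = Q * H * mat_diag N lam" .
  have K: "mpedmd_K R Q U1 U2 \<in> carrier_mat N N" unfolding mpedmd_K_def by simp
  have QH: "Q * H \<in> carrier_mat N N" by simp
  have "mpedmd_K R Q U1 U2 *\<^sub>v col (Q * H) j = col (Q * H * mat_diag N lam) j"
    using col_mult2[OF K QH j] eq by simp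
  also have "\<dots> = lam j \<cdot>\<^sub>v col (Q * H) j"
    unfolding mat_diag_mult_right[OF QH] using carrier_matD[OF QH] carrier_matD[OF Q] carrier_matD[OF H] j
    by (intro eq_vecI) (auto simp: mult.commute simp del: index_mult_mat(1))
  finally show ?thesis unfolding mpedmd_V_def .
qed

end

theory Submission
  imports Defs
begin

text \<open>
  Let \<open>T\<close> be the Koopman operator and \<open>T\<^sub>N\<^sub>,\<^sub>M\<close> the mpEDMD operator, which is unitary for the inner product of
  \<open>G\<close> on the coefficients.  As \<open>M \<rightarrow> \<infinity>\<close> the form of \<open>G\<close> tends to that of \<open>L\<^sup>2\<close> and the form of \<open>A\<close> to
  \<open>\<langle>T \<cdot>, \<cdot>\<rangle>\<close>, and \<open>T\<^sub>N\<^sub>,\<^sub>M\<close> is the unitary polar factor of the compression of \<open>T\<close> given by \<open>A\<close>.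
  If \<open>\<Psi>c\<close> approximates \<open>h\<close>, the compression nearly preserves the norm of \<open>c\<close>, since \<open>T h\<close> is close to the
  span of the dictionary; its positive factor, which is almost a contraction, then nearly fixes \<open>c\<close>,
  whence \<open>\<Psi> T\<^sub>N\<^sub>,\<^sub>M c\<close> approximates \<open>T h\<close>.  So strong convergence holds for \<open>\<phi>(z) = z\<close>, and, by unitarity,
  for its conjugate.  The functions \<open>\<phi>\<close> with strong convergence form an algebra closed under uniform
  limits, so by Stone-Weierstrass they include all real continuous functions on the circle.
\<close>

section \<open>The space \<open>L\<^sup>2\<close>\<close>

text \<open>The compression of a unitary operator to a finite-dimensional space can be singular, and
  the unitary polar factor is neither unique nor continuous at a singular matrix. So the mpEDMD
  operators need not converge as \<open>M\<close> grows with \<open>N\<close> fixed, and no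
  intermediate limit operator is available. Continuity is replaced by the quadratic inequality
  \<open>polar_bound\<close>, which holds for every choice of singular vectors. Tested on an
  approximation of \<open>T h\<close>, it forces the mpEDMD image to pair with \<open>T h\<close> to
  almost the squared norm of \<open>h\<close>; expanding the squared distance then leaves nothing in
  the limit. Quadrature converges for each \<open>N\<close> separately at an unknown speed, so every
  estimate is read along a filter in which \<open>M\<close> tends to infinity before
  \<open>N\<close>. The integral against \<open>E\<close> is a choice among the functions satisfying
  a relation; for continuous integrands its existence is obtained together with the convergence,
  starting from constants, the identity and its conjugate, and using completeness of L2.\<close>

lemma borel_measurable_cnj [measurable (raw)]:
  "f \<in> borel_measurable M \<Longrightarrow> (\<lambda>x. cnj (f x)) \<in> borel_measurable M"
  by (rule measurable_compose[OF _ borel_measurable_continuous_onI]) (auto intro: continuous_intros)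

lemma L2_integrable: "f \<in> L2 \<omega> \<Longrightarrow> integrable \<omega> (\<lambda>x. (cmod (f x))\<^sup>2)"
  by (simp add: L2_def)

lemma L2_zero [simp, intro]: "(\<lambda>x. 0) \<in> L2 \<omega>"
  by (simp add: L2_def)

lemma L2_scale [intro]: "f \<in> L2 \<omega> \<Longrightarrow> (\<lambda>x. a * f x) \<in> L2 \<omega>"
  by (auto simp: L2_def norm_mult power_mult_distrib)

lemma L2_add [intro]:
  assumes "f \<in> L2 \<omega>" "g \<in> L2 \<omega>"
  shows "(\<lambda>x. f x + g x) \<in> L2 \<omega>"
proof -
  have "integrable \<omega> (\<lambda>x. (cmod (f x + g x))\<^sup>2)"
  proof (rule Bochner_Integration.integrable_bound)
    show "integrable \<omega> (\<lambda>x. 2 * (cmod (f x))\<^sup>2 + 2 * (cmod (g x))\<^sup>2)"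
      using assms by (auto simp: L2_def)
    show "(\<lambda>x. (cmod (f x + g x))\<^sup>2) \<in> borel_measurable \<omega>"
      using assms by (auto simp: L2_def)
    have "(cmod (u + v))\<^sup>2 \<le> 2 * (cmod u)\<^sup>2 + 2 * (cmod v)\<^sup>2" for u v :: complex
    proof -
      have "(cmod (u + v))\<^sup>2 \<le> (cmod u + cmod v)\<^sup>2"
        by (intro power_mono norm_triangle_ineq) auto
      then show ?thesis using sum_squares_bound[of "cmod u" "cmod v"]
        by (simp add: power2_sum)
    qed
    then show "AE x in \<omega>. norm ((cmod (f x + g x))\<^sup>2) \<le> norm (2 * (cmod (f x))\<^sup>2 + 2 * (cmod (g x))\<^sup>2)"
      by auto
  qed
  then show ?thesis using assms by (auto simp: L2_def)
qed

lemma L2_diff [intro]: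
  assumes "f \<in> L2 \<omega>" "g \<in> L2 \<omega>"
  shows "(\<lambda>x. f x - g x) \<in> L2 \<omega>"
  using L2_add[OF assms(1) L2_scale[OF assms(2), of "-1"]] by simp

lemma L2_sum [intro]: "(\<And>i. i \<in> I \<Longrightarrow> f i \<in> L2 \<omega>) \<Longrightarrow> (\<lambda>x. \<Sum>i\<in>I. f i x) \<in> L2 \<omega>"
  by (induction I rule: infinite_finite_induct) (auto intro: L2_add)

lemma L2_inner_integrable:
  assumes "f \<in> L2 \<omega>" "g \<in> L2 \<omega>"
  shows "integrable \<omega> (\<lambda>x. f x * cnj (g x))"
proof (rule Bochner_Integration.integrable_bound)
  show "integrable \<omega> (\<lambda>x. (cmod (f x))\<^sup>2 + (cmod (g x))\<^sup>2)"
    using assms by (auto simp: L2_def)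
  show "(\<lambda>x. f x * cnj (g x)) \<in> borel_measurable \<omega>"
    using assms by (auto intro!: borel_measurable_times borel_measurable_cnj simp: L2_def)
  have "cmod u * cmod v \<le> (cmod u)\<^sup>2 + (cmod v)\<^sup>2" for u v
    using sum_squares_bound[of "cmod u" "cmod v"] mult_nonneg_nonneg[of "cmod u" "cmod v"] by (simp del: mult_nonneg_nonneg)
  then show "AE x in \<omega>. norm (f x * cnj (g x)) \<le> norm ((cmod (f x))\<^sup>2 + (cmod (g x))\<^sup>2)"
    by (auto simp: norm_mult)
qed

lemma L2_inner_scale_left: "L2_inner \<omega> (\<lambda>x. a * f x) h = a * L2_inner \<omega> f h"
  unfolding L2_inner_def by (simp add: mult.assoc)

lemma L2_inner_commute: "L2_inner \<omega> g f = cnj (L2_inner \<omega> f g)"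
  unfolding L2_inner_def by (subst Bochner_Integration.integral_cnj[symmetric]) (simp add: mult.commute)

lemma L2_inner_scale_right: "L2_inner \<omega> h (\<lambda>x. a * f x) = cnj a * L2_inner \<omega> h f"
  unfolding L2_inner_def by (simp add: mult.left_commute)

lemma L2_inner_diff_left:
  "f \<in> L2 \<omega> \<Longrightarrow> g \<in> L2 \<omega> \<Longrightarrow> h \<in> L2 \<omega> \<Longrightarrow>
    L2_inner \<omega> (\<lambda>x. f x - g x) h = L2_inner \<omega> f h - L2_inner \<omega> g h"
  unfolding L2_inner_def by (simp add: L2_inner_integrable ring_distribs)

lemma L2_inner_diff_right:
  "f \<in> L2 \<omega> \<Longrightarrow> g \<in> L2 \<omega> \<Longrightarrow> h \<in> L2 \<omega> \<Longrightarrow>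
    L2_inner \<omega> h (\<lambda>x. f x - g x) = L2_inner \<omega> h f - L2_inner \<omega> h g"
  unfolding L2_inner_def by (simp add: L2_inner_integrable ring_distribs)

lemma L2_inner_sum_left:
  "(\<And>i. i \<in> I \<Longrightarrow> f i \<in> L2 \<omega>) \<Longrightarrow> h \<in> L2 \<omega> \<Longrightarrow>
    L2_inner \<omega> (\<lambda>x. \<Sum>i\<in>I. a i * f i x) h = (\<Sum>i\<in>I. a i * L2_inner \<omega> (f i) h)"
  unfolding L2_inner_def by (simp add: sum_distrib_right mult.assoc L2_inner_integrable)

lemma L2_inner_sum_right:
  assumes "\<And>i. i \<in> I \<Longrightarrow> f i \<in> L2 \<omega>" "h \<in> L2 \<omega>"
  shows "L2_inner \<omega> h (\<lambda>x. \<Sum>i\<in>I. a i * f i x) = (\<Sum>i\<in>I. cnj (a i) * L2_inner \<omega> h (f i))"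
  using arg_cong[OF L2_inner_sum_left[OF assms], where f = cnj]
  by (simp add: L2_inner_commute[of _ h])

lemma L2_inner_cong_AE:
  assumes "f \<in> L2 \<omega>" "f' \<in> L2 \<omega>" "g \<in> L2 \<omega>" "g' \<in> L2 \<omega>"
    and "AE x in \<omega>. f x = f' x" "AE x in \<omega>. g x = g' x"
  shows "L2_inner \<omega> f g = L2_inner \<omega> f' g'"
  unfolding L2_inner_def using assms
  by (intro integral_cong_AE) (auto intro!: borel_measurable_times borel_measurable_cnj simp: L2_def)

lemma L2_norm_nonneg [simp]: "0 \<le> L2_norm \<omega> f"
  by (simp add: L2_norm_def)

lemma L2_norm_cong_AE:
  assumes "f \<in> L2 \<omega>" "f' \<in> L2 \<omega>" "AE x in \<omega>. f x = f' x"
  shows "L2_norm \<omega> f = L2_norm \<omega> f'"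
  unfolding L2_norm_def using assms
  by (intro arg_cong[where f = sqrt] integral_cong_AE) (auto simp: L2_def)

lemma L2_inner_self: "L2_inner \<omega> f f = complex_of_real ((L2_norm \<omega> f)\<^sup>2)"
proof -
  have "L2_inner \<omega> f f = (\<integral>x. complex_of_real ((cmod (f x))\<^sup>2) \<partial>\<omega>)"
    unfolding L2_inner_def complex_norm_square ..
  then show ?thesis by (simp add: L2_norm_def del: of_real_power)
qed

lemma L2_norm_eq_0:
  assumes "f \<in> L2 \<omega>"
  shows "L2_norm \<omega> f = 0 \<longleftrightarrow> (AE x in \<omega>. f x = 0)"
  unfolding L2_norm_def using integral_nonneg_eq_0_iff_AE[OF L2_integrable[OF assms]] by simp

lemma L2_norm_scale: "L2_norm \<omega> (\<lambda>x. a * f x) = cmod a * L2_norm \<omega> f"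
  by (simp add: L2_norm_def norm_mult power_mult_distrib real_sqrt_mult)

lemma L2_norm_minus_commute: "L2_norm \<omega> (\<lambda>x. f x - g x) = L2_norm \<omega> (\<lambda>x. g x - f x)"
  by (simp add: L2_norm_def norm_minus_commute)

lemma L2_Cauchy_Schwarz:
  assumes f: "f \<in> L2 \<omega>" and g: "g \<in> L2 \<omega>"
  shows "cmod (L2_inner \<omega> f g) \<le> L2_norm \<omega> f * L2_norm \<omega> g"
proof (cases "L2_norm \<omega> g = 0")
  case True
  then have "AE x in \<omega>. g x = 0" using L2_norm_eq_0[OF g] by simp
  then have "L2_inner \<omega> f g = L2_inner \<omega> f (\<lambda>x. 0)"
    using f g by (intro L2_inner_cong_AE) auto
  then show ?thesis using True by (simp add: L2_inner_def)
next
  case False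
  define c where "c = L2_inner \<omega> f g"
  define b where "b = (L2_norm \<omega> g)\<^sup>2"
  \<comment> \<open>\<open>k\<close> is the component of \<open>f\<close> orthogonal to
    \<open>g\<close>; nonnegativity of its squared norm is the inequality.\<close>
  define k where "k = (\<lambda>x. f x - (c / b) * g x)"
  have b: "b > 0" using False by (simp add: b_def)
  have kL: "k \<in> L2 \<omega>" unfolding k_def by (intro L2_diff L2_scale f g)
  have gL: "(\<lambda>x. (c / b) * g x) \<in> L2 \<omega>" using g by (rule L2_scale)
  have kg: "L2_inner \<omega> k g = 0" unfolding k_def L2_inner_diff_left[OF f gL g] L2_inner_scale_left
    using b by (simp add: L2_inner_self c_def b_def)
  have "L2_inner \<omega> k k = L2_inner \<omega> k f - L2_inner \<omega> k (\<lambda>x. (c / b) * g x)"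
    unfolding k_def by (intro L2_inner_diff_right L2_diff L2_scale f g)
  also have "L2_inner \<omega> k (\<lambda>x. (c / b) * g x) = 0"
    using kg by (simp add: L2_inner_scale_right del: times_divide_eq_left)
  also have "L2_inner \<omega> k f = L2_inner \<omega> f f - (c / b) * cnj c"
    unfolding k_def L2_inner_diff_left[OF f gL f] L2_inner_scale_left
    by (simp add: c_def L2_inner_commute[of \<omega> g f])
  finally have "complex_of_real ((L2_norm \<omega> k)\<^sup>2) = complex_of_real ((L2_norm \<omega> f)\<^sup>2 - (cmod c)\<^sup>2 / b)"
    unfolding L2_inner_self of_real_diff of_real_divide complex_norm_square by simp
  then have "(L2_norm \<omega> k)\<^sup>2 = (L2_norm \<omega> f)\<^sup>2 - (cmod c)\<^sup>2 / b"
    using of_real_eq_iff by blast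
  then have "(cmod c)\<^sup>2 / b \<le> (L2_norm \<omega> f)\<^sup>2" by (metis diff_ge_0_iff_ge zero_le_power2)
  then have "(cmod c)\<^sup>2 \<le> (L2_norm \<omega> f * L2_norm \<omega> g)\<^sup>2"
    using b by (simp add: field_simps b_def)
  then show ?thesis unfolding c_def by (rule power2_le_imp_le) simp
qed

text \<open>Turns lower bounds on real parts of inner products into upper bounds on distances; this
  is how a family with the right norms is shown to converge to \<open>T h\<close>.\<close>

lemma L2_norm_diff_squared:
  assumes f: "f \<in> L2 \<omega>" and g: "g \<in> L2 \<omega>"
  shows "(L2_norm \<omega> (\<lambda>x. f x - g x))\<^sup>2 = (L2_norm \<omega> f)\<^sup>2 + (L2_norm \<omega> g)\<^sup>2 - 2 * Re (L2_inner \<omega> f g)"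
proof -
  have d: "(\<lambda>x. f x - g x) \<in> L2 \<omega>" using f g by blast
  have "L2_inner \<omega> (\<lambda>x. f x - g x) (\<lambda>x. f x - g x)
      = L2_inner \<omega> f f - L2_inner \<omega> f g - (cnj (L2_inner \<omega> f g) - L2_inner \<omega> g g)"
    by (simp add: L2_inner_diff_left[OF f g d] L2_inner_diff_right[OF f g f] L2_inner_diff_right[OF f g g]
        L2_inner_commute[of \<omega> g f])
  from arg_cong[OF this, where f = Re] show ?thesis by (simp add: L2_inner_self del: of_real_power)
qed

lemma L2_norm_triangle_sub:
  assumes f: "f \<in> L2 \<omega>" and g: "g \<in> L2 \<omega>"
  shows "L2_norm \<omega> (\<lambda>x. f x - g x) \<le> L2_norm \<omega> f + L2_norm \<omega> g"
proof (rule power2_le_imp_le)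
  have "- Re (L2_inner \<omega> f g) \<le> L2_norm \<omega> f * L2_norm \<omega> g"
    using L2_Cauchy_Schwarz[OF assms] abs_Re_le_cmod[of "L2_inner \<omega> f g"] by linarith
  then show "(L2_norm \<omega> (\<lambda>x. f x - g x))\<^sup>2 \<le> (L2_norm \<omega> f + L2_norm \<omega> g)\<^sup>2"
    unfolding L2_norm_diff_squared[OF assms] by (simp add: power2_sum)
qed simp

lemma L2_norm_triangle:
  assumes f: "f \<in> L2 \<omega>" and g: "g \<in> L2 \<omega>"
  shows "L2_norm \<omega> (\<lambda>x. f x + g x) \<le> L2_norm \<omega> f + L2_norm \<omega> g"
  using L2_norm_triangle_sub[OF f L2_scale[OF g, of "-1"]] L2_norm_scale[of \<omega> "-1" g] by simp

lemma L2_norm_diff_triangle: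
  assumes "f \<in> L2 \<omega>" "g \<in> L2 \<omega>" "h \<in> L2 \<omega>"
  shows "L2_norm \<omega> (\<lambda>x. f x - h x) \<le> L2_norm \<omega> (\<lambda>x. f x - g x) + L2_norm \<omega> (\<lambda>x. g x - h x)"
  using L2_norm_triangle[OF L2_diff[OF assms(1,2)] L2_diff[OF assms(2,3)]] by simp

lemma L2_norm_abs_diff:
  assumes "f \<in> L2 \<omega>" "g \<in> L2 \<omega>"
  shows "\<bar>L2_norm \<omega> f - L2_norm \<omega> g\<bar> \<le> L2_norm \<omega> (\<lambda>x. f x - g x)"
  using L2_norm_diff_triangle[OF assms(1,2) L2_zero] L2_norm_diff_triangle[OF assms(2,1) L2_zero]
    L2_norm_minus_commute[of \<omega> f g] by simp

section \<open>Completeness of L2\<close>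

lemma nn_integral_L2:
  "f \<in> L2 \<omega> \<Longrightarrow> (\<integral>\<^sup>+x. ennreal ((cmod (f x))\<^sup>2) \<partial>\<omega>) = ennreal ((L2_norm \<omega> f)\<^sup>2)"
  by (simp add: nn_integral_eq_integral L2_integrable L2_norm_def)

text \<open>The bound is on the nonnegative integral because Fatou's lemma delivers it before the
  limit is known to be square integrable.\<close>

lemma L2_norm_leI:
  assumes f: "f \<in> borel_measurable \<omega>" and "e \<ge> 0"
    and le: "(\<integral>\<^sup>+x. ennreal ((cmod (f x))\<^sup>2) \<partial>\<omega>) \<le> ennreal (e\<^sup>2)"
  shows "f \<in> L2 \<omega>" "L2_norm \<omega> f \<le> e"
proof -
  have "integrable \<omega> (\<lambda>x. (cmod (f x))\<^sup>2)"
    using f le by (intro integrableI_bounded) (auto intro: le_less_trans)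
  then show L: "f \<in> L2 \<omega>" using f by (simp add: L2_def)
  show "L2_norm \<omega> f \<le> e"
    using le unfolding nn_integral_L2[OF L]
    by (intro power2_le_imp_le[OF _ \<open>e \<ge> 0\<close>]) (simp add: ennreal_le_iff)
qed

text \<open>The inequality of arithmetic and geometric means gives
  \<open>2 |d k| \<le> (1/4)^k + 4^k |d k|^2\<close>. The weights convert control of squares into
  absolute summability without an inclusion of L2 in L1, which fails for general infinite
  measures.\<close>

lemma summable_if_weighted_squares:
  fixes d :: "nat \<Rightarrow> complex"
  assumes "summable (\<lambda>k. 4 ^ k * (cmod (d k))\<^sup>2)"
  shows "summable d"
proof (rule summable_comparison_test)
  show "summable (\<lambda>k. (1 / 4) ^ k + 4 ^ k * (cmod (d k))\<^sup>2)"
    by (intro summable_add assms summable_geometric) simp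
  have "cmod (d k) \<le> (1 / 4) ^ k + 4 ^ k * (cmod (d k))\<^sup>2" for k
  proof -
    have "2 * cmod (d k) = 2 * ((1 / 2) ^ k) * (2 ^ k * cmod (d k))"
      by (simp add: field_simps)
    also have "\<dots> \<le> ((1 / 2) ^ k)\<^sup>2 + (2 ^ k * cmod (d k))\<^sup>2"
      by (rule sum_squares_bound)
    also have "\<dots> = (1 / 4) ^ k + 4 ^ k * (cmod (d k))\<^sup>2"
      by (simp add: power_mult_distrib power_divide flip: power_mult power_even_eq)
        (simp add: power_mult mult.commute[of k])
    finally show ?thesis using norm_ge_zero[of "d k"] by linarith
  qed
  then show "\<exists>N. \<forall>k\<ge>N. norm (d k) \<le> (1 / 4) ^ k + 4 ^ k * (cmod (d k))\<^sup>2" by auto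
qed

text \<open>Riesz-Fischer: a rapidly Cauchy subsequence converges almost everywhere, and Fatou's
  lemma carries the Cauchy estimates to its limit. It supplies the integrals of uniform
  limits.\<close>

theorem L2_complete:
  assumes L: "\<And>n. f n \<in> L2 \<omega>"
    and Cauchy: "\<And>e. e > 0 \<Longrightarrow> \<exists>N. \<forall>m\<ge>N. \<forall>n\<ge>N. L2_norm \<omega> (\<lambda>x. f m x - f n x) < e"
  shows "\<exists>h\<in>L2 \<omega>. (\<lambda>n. L2_norm \<omega> (\<lambda>x. h x - f n x)) \<longlonglongrightarrow> 0"
proof -
  have [measurable]: "f n \<in> borel_measurable \<omega>" for n using L by (simp add: L2_def)
  have DL: "(\<lambda>x. f m x - f n x) \<in> L2 \<omega>" for m n by (intro L2_diff L)
  \<comment> \<open>With the rate \<open>(1/4)^k\<close>, the product of \<open>4^k\<close> and the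
    squared rate is still summable, as the weighted criterion asks.\<close>
  have "\<exists>r. strict_mono r \<and> (\<forall>k. \<forall>m\<ge>r k. L2_norm \<omega> (\<lambda>x. f m x - f (r k) x) < (1/4)^k)"
  proof -
    have "\<forall>k. \<exists>N. \<forall>m\<ge>N. \<forall>n\<ge>N. L2_norm \<omega> (\<lambda>x. f m x - f n x) < (1/4)^k"
      using Cauchy by simp
    then obtain N where N: "\<And>k m n. m \<ge> N k \<Longrightarrow> n \<ge> N k \<Longrightarrow> L2_norm \<omega> (\<lambda>x. f m x - f n x) < (1/4)^k"
      by metis
    \<comment> \<open>The summand \<open>k\<close> makes \<open>r\<close> strictly increasing, the
      sum makes it dominate \<open>N k\<close>.\<close>
    define r where "r k = k + (\<Sum>j\<le>k. N j)" for k
    have "strict_mono r" by (rule strict_monoI_Suc) (simp add: r_def)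
    moreover have "N k \<le> r k" for k
      unfolding r_def by (rule trans_le_add2, rule member_le_sum) auto
    ultimately show ?thesis using N by (meson order_trans order_refl)
  qed
  then obtain r where r: "strict_mono r"
    and rk: "\<And>k m. m \<ge> r k \<Longrightarrow> L2_norm \<omega> (\<lambda>x. f m x - f (r k) x) < (1/4)^k" by blast
  define d where "d k x = f (r (Suc k)) x - f (r k) x" for k x
  have dL: "d k \<in> L2 \<omega>" for k unfolding d_def by (rule DL)
  have [measurable]: "d k \<in> borel_measurable \<omega>" for k using dL by (simp add: L2_def)
  have dk: "4 ^ k * (L2_norm \<omega> (d k))\<^sup>2 \<le> (1/4)^k" for k
  proof -
    have "L2_norm \<omega> (d k) \<le> (1/4)^k"
      unfolding d_def using rk[of k "r (Suc k)"] strict_mono_less_eq[OF r, of k "Suc k"] by simp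
    then have "(L2_norm \<omega> (d k))\<^sup>2 \<le> ((1/4)^k)\<^sup>2" by (intro power_mono) auto
    then show ?thesis by (simp add: field_simps power2_eq_square)
  qed
  have "(\<integral>\<^sup>+x. (\<Sum>k. ennreal (4 ^ k * (cmod (d k x))\<^sup>2)) \<partial>\<omega>)
      = (\<Sum>k. \<integral>\<^sup>+x. ennreal (4 ^ k) * ennreal ((cmod (d k x))\<^sup>2) \<partial>\<omega>)"
    by (subst nn_integral_suminf) (auto simp: ennreal_mult)
  also have "\<dots> = (\<Sum>k. ennreal (4 ^ k * (L2_norm \<omega> (d k))\<^sup>2))"
    by (subst nn_integral_cmult) (auto simp: nn_integral_L2[OF dL] ennreal_mult)
  also have "\<dots> \<le> (\<Sum>k. ennreal ((1/4)^k))"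
    by (intro suminf_le) (auto intro!: ennreal_leI dk)
  also have "\<dots> < \<infinity>"
    by (subst suminf_ennreal2) (auto intro: summable_geometric)
  finally have "AE x in \<omega>. (\<Sum>k. ennreal (4 ^ k * (cmod (d k x))\<^sup>2)) \<noteq> \<infinity>"
    by (intro nn_integral_PInf_AE) auto
  then have "AE x in \<omega>. convergent (\<lambda>n. f (r n) x)"
  proof eventually_elim
    case (elim x)
    have "summable (\<lambda>k. 4 ^ k * (cmod (d k x))\<^sup>2)"
      by (rule summable_suminf_not_top) (use elim in auto)
    then have "summable (\<lambda>k. d k x)" by (rule summable_if_weighted_squares)
    then have "(\<lambda>n. f (r 0) x + (\<Sum>k<n. d k x)) \<longlonglongrightarrow> f (r 0) x + (\<Sum>k. d k x)"
      by (intro tendsto_intros summable_LIMSEQ)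
    moreover have "f (r 0) x + (\<Sum>k<n. d k x) = f (r n) x" for n
      unfolding d_def by (subst sum_lessThan_telescope) simp
    ultimately show ?case unfolding convergent_def by auto
  qed
  then have conv: "AE x in \<omega>. (\<lambda>n. f (r n) x) \<longlonglongrightarrow> lim (\<lambda>n. f (r n) x)"
    by (simp add: convergent_LIMSEQ_iff)
  \<comment> \<open>\<open>lim\<close> has some value also where the subsequence diverges, so
    \<open>h\<close> is defined and measurable everywhere; the exceptional set is null.\<close>
  define h where "h x = lim (\<lambda>n. f (r n) x)" for x
  have [measurable]: "h \<in> borel_measurable \<omega>"
    unfolding h_def by (rule borel_measurable_lim_metric) measurable
  have bound: "\<exists>N. \<forall>n\<ge>N. (\<lambda>x. h x - f n x) \<in> L2 \<omega> \<and> L2_norm \<omega> (\<lambda>x. h x - f n x) \<le> e" if e: "e > 0" for e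
  proof -
    obtain N where N: "\<And>m n. m \<ge> N \<Longrightarrow> n \<ge> N \<Longrightarrow> L2_norm \<omega> (\<lambda>x. f m x - f n x) < e"
      using Cauchy[OF e] by blast
    have "(\<lambda>x. h x - f n x) \<in> L2 \<omega> \<and> L2_norm \<omega> (\<lambda>x. h x - f n x) \<le> e" if n: "n \<ge> N" for n
    proof -
      have "(\<integral>\<^sup>+x. ennreal ((cmod (h x - f n x))\<^sup>2) \<partial>\<omega>)
          = (\<integral>\<^sup>+x. liminf (\<lambda>k. ennreal ((cmod (f (r k) x - f n x))\<^sup>2)) \<partial>\<omega>)"
      proof (rule nn_integral_cong_AE)
        show "AE x in \<omega>. ennreal ((cmod (h x - f n x))\<^sup>2) = liminf (\<lambda>k. ennreal ((cmod (f (r k) x - f n x))\<^sup>2))"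
          using conv
        proof eventually_elim
          case (elim x)
          then have "(\<lambda>k. ennreal ((cmod (f (r k) x - f n x))\<^sup>2)) \<longlonglongrightarrow> ennreal ((cmod (h x - f n x))\<^sup>2)"
            unfolding h_def by (intro tendsto_intros)
          then show ?case by (metis lim_imp_Liminf trivial_limit_sequentially)
        qed
      qed
      also have "\<dots> \<le> liminf (\<lambda>k. \<integral>\<^sup>+x. ennreal ((cmod (f (r k) x - f n x))\<^sup>2) \<partial>\<omega>)"
        by (rule nn_integral_liminf) measurable
      also have "\<dots> = liminf (\<lambda>k. ennreal ((L2_norm \<omega> (\<lambda>x. f (r k) x - f n x))\<^sup>2))"
        by (simp add: nn_integral_L2[OF DL])
      also have "\<dots> \<le> limsup (\<lambda>k. ennreal ((L2_norm \<omega> (\<lambda>x. f (r k) x - f n x))\<^sup>2))"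
        by (rule Liminf_le_Limsup) simp
      also have "\<dots> \<le> ennreal (e\<^sup>2)"
      proof (rule Limsup_bounded)
        have "\<forall>\<^sub>F k in sequentially. k \<ge> N" by (rule eventually_ge_at_top)
        then show "\<forall>\<^sub>F k in sequentially. ennreal ((L2_norm \<omega> (\<lambda>x. f (r k) x - f n x))\<^sup>2) \<le> ennreal (e\<^sup>2)"
        proof eventually_elim
          case (elim k)
          then have "r k \<ge> N" using strict_mono_imp_increasing[OF r, of k] by linarith
          from N[OF this n] show ?case by (intro ennreal_leI power_mono) auto
        qed
      qed
      finally show ?thesis using e L2_norm_leI[of "\<lambda>x. h x - f n x" \<omega> e] by simp
    qed
    then show ?thesis by blast
  qed
  \<comment> \<open>The estimate places \<open>h - f n\<close> in L2 for large \<open>n\<close>;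
    adding \<open>f n\<close> back shows that \<open>h\<close> itself is square integrable.\<close>
  obtain n where "(\<lambda>x. h x - f n x) \<in> L2 \<omega>" using bound[of 1] by auto
  from L2_add[OF this L[of n]] have hL: "h \<in> L2 \<omega>" by simp
  moreover have "(\<lambda>n. L2_norm \<omega> (\<lambda>x. h x - f n x)) \<longlonglongrightarrow> 0"
  proof (rule LIMSEQ_I)
    fix e :: real assume e: "e > 0"
    then obtain N where N: "\<forall>n\<ge>N. L2_norm \<omega> (\<lambda>x. h x - f n x) \<le> e / 2"
      using bound[of "e / 2"] by auto
    then show "\<exists>N. \<forall>n\<ge>N. norm (L2_norm \<omega> (\<lambda>x. h x - f n x) - 0) < e"
      using e by (intro exI[of _ N]) force
  qed
  ultimately show ?thesis by blast
qed

section \<open>Integration against projection-valued measures\<close>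

lemma L2_linear_closed: "L2_linear \<omega> T \<Longrightarrow> f \<in> L2 \<omega> \<Longrightarrow> T f \<in> L2 \<omega>"
  by (simp add: L2_linear_def)

lemma L2_linear_comb:
  "L2_linear \<omega> T \<Longrightarrow> f \<in> L2 \<omega> \<Longrightarrow> g \<in> L2 \<omega> \<Longrightarrow>
    AE x in \<omega>. T (\<lambda>y. a * f y + b * g y) x = a * T f x + b * T g x"
  by (simp add: L2_linear_def)

lemma L2_linear_diff:
  "L2_linear \<omega> T \<Longrightarrow> f \<in> L2 \<omega> \<Longrightarrow> g \<in> L2 \<omega> \<Longrightarrow>
    AE x in \<omega>. T (\<lambda>y. f y - g y) x = T f x - T g x"
  using L2_linear_comb[of \<omega> T f g 1 "-1"] by simp

text \<open>Linearity holds off a null set that depends on the coefficients and the arguments;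
  induction merges the finitely many null sets of a finite sum.\<close>

lemma L2_linear_sum:
  assumes T: "L2_linear \<omega> T" and "finite I" and L: "\<And>i. i \<in> I \<Longrightarrow> f i \<in> L2 \<omega>"
  shows "AE x in \<omega>. T (\<lambda>y. \<Sum>i\<in>I. a i * f i y) x = (\<Sum>i\<in>I. a i * T (f i) x)"
  using \<open>finite I\<close> L
proof (induction I)
  case empty
  show ?case using L2_linear_comb[OF T L2_zero L2_zero, of 0 0] by simp
next
  case (insert i I)
  have sL: "(\<lambda>y. \<Sum>j\<in>I. a j * f j y) \<in> L2 \<omega>"
    using insert.prems by (intro L2_sum L2_scale) auto
  have fL: "f i \<in> L2 \<omega>" using insert.prems by auto
  have "AE x in \<omega>. T (\<lambda>y. \<Sum>j\<in>I. a j * f j y) x = (\<Sum>j\<in>I. a j * T (f j) x)"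
    using insert by auto
  moreover have "AE x in \<omega>. T (\<lambda>y. a i * f i y + 1 * (\<Sum>j\<in>I. a j * f j y)) x
      = a i * T (f i) x + 1 * T (\<lambda>y. \<Sum>j\<in>I. a j * f j y) x"
    by (rule L2_linear_comb[OF T fL sL])
  ultimately show ?case
    by eventually_elim (use insert.hyps in simp)
qed

lemma space_circle_borel [simp]: "space circle_borel = unit_circle"
  by (simp add: space_restrict_space)

lemma simple_function_circle_level:
  "simple_function circle_borel u \<Longrightarrow> {z\<in>unit_circle. u z = c} \<in> sets circle_borel"
  using simple_functionD(2)[of circle_borel u "{c}"]
  by (simp add: vimage_def Int_def conj_commute)

lemma simple_function_circle_finite:
  "simple_function circle_borel u \<Longrightarrow> finite (u ` unit_circle)"
  using simple_functionD(1)[of circle_borel u] by simp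

lemma tendsto_L2_norm:
  assumes "h \<in> L2 \<omega>" "\<And>n. f n \<in> L2 \<omega>" "(\<lambda>n. L2_norm \<omega> (\<lambda>x. h x - f n x)) \<longlonglongrightarrow> 0"
  shows "(\<lambda>n. L2_norm \<omega> (f n)) \<longlonglongrightarrow> L2_norm \<omega> h"
proof (rule LIM_zero_cancel, rule Lim_null_comparison[OF _ assms(3)])
  show "\<forall>\<^sub>F n in sequentially. norm (L2_norm \<omega> (f n) - L2_norm \<omega> h) \<le> L2_norm \<omega> (\<lambda>x. h x - f n x)"
    using L2_norm_abs_diff[OF assms(1,2)] by (simp add: abs_minus_commute)
qed

lemma uniform_limit_bounded_eventually:
  assumes "uniform_limit S s (\<phi> :: _ \<Rightarrow> complex) sequentially" "\<forall>z\<in>S. cmod (\<phi> z) \<le> B"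
  shows "\<forall>\<^sub>F n in sequentially. \<forall>z\<in>S. cmod (s n z) \<le> B + 1"
  using uniform_limitD[OF assms(1), of 1, simplified]
proof eventually_elim
  case (elim n)
  show ?case
  proof
    fix z assume z: "z \<in> S"
    with elim have "cmod (s n z - \<phi> z) < 1" by (simp add: dist_norm)
    with bspec[OF assms(2) z] norm_triangle_sub[of "s n z" "\<phi> z"] show "cmod (s n z) \<le> B + 1" by linarith
  qed
qed

section \<open>Integrals of simple functions against a projection-valued measure\<close>

locale pvm =
  fixes \<omega> :: "'a measure" and E
  assumes pvm: "projection_valued_measure \<omega> E"
begin

lemma linear: "S \<in> sets circle_borel \<Longrightarrow> L2_linear \<omega> (E S)"
  using pvm by (auto simp: projection_valued_measure_def L2_orthogonal_projection_def)

lemma closed: "S \<in> sets circle_borel \<Longrightarrow> f \<in> L2 \<omega> \<Longrightarrow> E S f \<in> L2 \<omega>"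
  by (rule L2_linear_closed[OF linear])

lemma self_adjoint:
  "S \<in> sets circle_borel \<Longrightarrow> f \<in> L2 \<omega> \<Longrightarrow> g \<in> L2 \<omega> \<Longrightarrow> L2_inner \<omega> (E S f) g = L2_inner \<omega> f (E S g)"
  using pvm by (auto simp: projection_valued_measure_def L2_orthogonal_projection_def)

lemma empty_AE: "f \<in> L2 \<omega> \<Longrightarrow> AE x in \<omega>. E {} f x = 0"
  using pvm by (auto simp: projection_valued_measure_def)

lemma circle_AE: "f \<in> L2 \<omega> \<Longrightarrow> AE x in \<omega>. E unit_circle f x = f x"
  using pvm by (auto simp: projection_valued_measure_def)

lemma Int_AE:
  "S \<in> sets circle_borel \<Longrightarrow> S' \<in> sets circle_borel \<Longrightarrow> f \<in> L2 \<omega> \<Longrightarrow>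
    AE x in \<omega>. E (S \<inter> S') f x = E S (E S' f) x"
  using pvm by (auto simp: projection_valued_measure_def)

lemma countably_additive:
  "range B \<subseteq> sets circle_borel \<Longrightarrow> disjoint_family B \<Longrightarrow> f \<in> L2 \<omega> \<Longrightarrow>
    (\<lambda>n. L2_norm \<omega> (\<lambda>x. E (\<Union>i. B i) f x - (\<Sum>i<n. E (B i) f x))) \<longlonglongrightarrow> 0"
  using pvm by (auto simp: projection_valued_measure_def)

text \<open>Additivity is given for sequences of sets. Along \<open>A\<close>, \<open>B\<close>,
  \<open>{}\<close>, \<open>{}\<close>, ... the partial sums stop changing after two terms, so the
  norm of the error is constant from there on and equals its limit 0.\<close>

lemma Un_AE:
  assumes A: "A \<in> sets circle_borel" and B: "B \<in> sets circle_borel" and "A \<inter> B = {}" and f: "f \<in> L2 \<omega>"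
  shows "AE x in \<omega>. E (A \<union> B) f x = E A f x + E B f x"
proof -
  let ?B = "binaryset A B"
  have range: "range ?B \<subseteq> sets circle_borel" using A B by (auto simp: range_binaryset_eq)
  have AB: "A \<union> B \<in> sets circle_borel" using A B by auto
  have dL: "(\<lambda>x. E (A \<union> B) f x - (\<Sum>i<n. E (?B i) f x)) \<in> L2 \<omega>" for n
    using range by (intro L2_diff L2_sum closed f AB) auto
  have L: "(\<lambda>x. E (A \<union> B) f x - (E A f x + E B f x)) \<in> L2 \<omega>"
    by (intro L2_diff L2_add closed A B f AB)
  have "(\<lambda>n. L2_norm \<omega> (\<lambda>x. E (A \<union> B) f x - (\<Sum>i<n. E (?B i) f x))) \<longlonglongrightarrow> 0"
    using countably_additive[OF range _ f] \<open>A \<inter> B = {}\<close>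
    by (simp add: UN_binaryset_eq disjoint_family_on_def binaryset_def Int_commute)
  moreover have "L2_norm \<omega> (\<lambda>x. E (A \<union> B) f x - (\<Sum>i<n + 2. E (?B i) f x))
      = L2_norm \<omega> (\<lambda>x. E (A \<union> B) f x - (E A f x + E B f x))" for n
  proof (rule L2_norm_cong_AE[OF dL L])
    show "AE x in \<omega>. E (A \<union> B) f x - (\<Sum>i<n + 2. E (?B i) f x) = E (A \<union> B) f x - (E A f x + E B f x)"
      using empty_AE[OF f]
    proof eventually_elim
      case (elim x)
      have "(\<Sum>i<n + 2. E (?B i) f x) = (\<Sum>i<2. E (?B i) f x)"
        using elim by (intro sum.mono_neutral_right) (auto simp: binaryset_def numeral_2_eq_2)
      then show ?case by (simp add: binaryset_def numeral_2_eq_2)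
    qed
  qed
  ultimately have "(\<lambda>n::nat. L2_norm \<omega> (\<lambda>x. E (A \<union> B) f x - (E A f x + E B f x))) \<longlonglongrightarrow> 0"
    using LIMSEQ_ignore_initial_segment[of _ 0 2] by fastforce
  then have "L2_norm \<omega> (\<lambda>x. E (A \<union> B) f x - (E A f x + E B f x)) = 0"
    by (simp add: LIMSEQ_const_iff)
  then show ?thesis unfolding L2_norm_eq_0[OF L] by simp
qed

lemma UN_AE:
  assumes "finite I" "\<And>i. i \<in> I \<Longrightarrow> A i \<in> sets circle_borel" "disjoint_family_on A I" and f: "f \<in> L2 \<omega>"
  shows "AE x in \<omega>. E (\<Union>i\<in>I. A i) f x = (\<Sum>i\<in>I. E (A i) f x)"
  using assms(1-3)
proof (induction I)
  case empty
  then show ?case using empty_AE[OF f] by simp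
next
  case (insert i I)
  have "AE x in \<omega>. E (A i \<union> (\<Union>i\<in>I. A i)) f x = E (A i) f x + E (\<Union>i\<in>I. A i) f x"
    using insert.prems insert.hyps
    by (intro Un_AE f sets.finite_UN) (auto simp: disjoint_family_on_insert)
  moreover have "AE x in \<omega>. E (\<Union>i\<in>I. A i) f x = (\<Sum>i\<in>I. E (A i) f x)"
    using insert by (auto simp: disjoint_family_on_def)
  ultimately show ?case
    by eventually_elim (use insert.hyps in simp)
qed

lemma simple_integral_L2:
  "simple_function circle_borel s \<Longrightarrow> g \<in> L2 \<omega> \<Longrightarrow> pvm_simple_integral E s g \<in> L2 \<omega>"
  unfolding pvm_simple_integral_def
  by (intro L2_sum L2_scale closed simple_function_circle_level)

text \<open>Each level set of the composition is a disjoint union of level sets of \<open>u\<close>,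
  so the integral may be computed on a finer partition. Taking for \<open>u\<close> a pair of simple
  functions puts both on a common partition, where sums and products are compared term by
  term.\<close>

lemma simple_integral_compose:
  assumes u: "simple_function circle_borel u" and g: "g \<in> L2 \<omega>"
  shows "AE x in \<omega>. pvm_simple_integral E (\<lambda>z. f (u z)) g x
    = (\<Sum>v\<in>u ` unit_circle. f v * E {z\<in>unit_circle. u z = v} g x)"
proof -
  let ?V = "u ` unit_circle"
  have fin: "finite ?V" by (rule simple_function_circle_finite[OF u])
  have "AE x in \<omega>. \<forall>c\<in>f ` ?V. E {z\<in>unit_circle. f (u z) = c} g x
      = (\<Sum>v\<in>{v\<in>?V. f v = c}. E {z\<in>unit_circle. u z = v} g x)"
  proof (rule AE_finite_allI[OF finite_imageI[OF fin]])
    fix c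
    have "{z\<in>unit_circle. f (u z) = c} = (\<Union>v\<in>{v\<in>?V. f v = c}. {z\<in>unit_circle. u z = v})"
      by auto
    then show "AE x in \<omega>. E {z\<in>unit_circle. f (u z) = c} g x
      = (\<Sum>v\<in>{v\<in>?V. f v = c}. E {z\<in>unit_circle. u z = v} g x)"
      using fin by (simp only:, intro UN_AE g simple_function_circle_level u)
        (auto simp: disjoint_family_on_def)
  qed
  then show ?thesis
  proof eventually_elim
    case (elim x)
    have "pvm_simple_integral E (\<lambda>z. f (u z)) g x
        = (\<Sum>c\<in>f ` ?V. \<Sum>v\<in>{v\<in>?V. f v = c}. f v * E {z\<in>unit_circle. u z = v} g x)"
      unfolding pvm_simple_integral_def image_image[symmetric]
      using elim by (intro sum.cong refl) (auto simp: image_image sum_distrib_left)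
    also have "\<dots> = (\<Sum>v\<in>?V. f v * E {z\<in>unit_circle. u z = v} g x)"
      by (rule sum.image_gen[OF fin, symmetric])
    finally show ?case .
  qed
qed

lemma simple_integral_comb_fun:
  assumes s: "simple_function circle_borel s" and t: "simple_function circle_borel t" and g: "g \<in> L2 \<omega>"
  shows "AE x in \<omega>. pvm_simple_integral E (\<lambda>z. a * s z + b * t z) g x
    = a * pvm_simple_integral E s g x + b * pvm_simple_integral E t g x"
proof -
  have u: "simple_function circle_borel (\<lambda>z. (s z, t z))"
    by (rule simple_function_Pair[OF s t])
  from simple_integral_compose[OF u g, of "\<lambda>p. a * fst p + b * snd p"]
    simple_integral_compose[OF u g, of fst] simple_integral_compose[OF u g, of snd]
  show ?thesis
    by eventually_elim (simp add: sum.distrib sum_distrib_left ring_distribs mult.assoc)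
qed

lemma simple_integral_comb_arg:
  assumes s: "simple_function circle_borel s" and g: "g \<in> L2 \<omega>" and h: "h \<in> L2 \<omega>"
  shows "AE x in \<omega>. pvm_simple_integral E s (\<lambda>y. a * g y + b * h y) x
    = a * pvm_simple_integral E s g x + b * pvm_simple_integral E s h x"
proof -
  have "AE x in \<omega>. \<forall>c\<in>s ` unit_circle. E {z\<in>unit_circle. s z = c} (\<lambda>y. a * g y + b * h y) x
      = a * E {z\<in>unit_circle. s z = c} g x + b * E {z\<in>unit_circle. s z = c} h x"
    by (intro AE_finite_allI simple_function_circle_finite s L2_linear_comb linear
        simple_function_circle_level g h)
  then show ?thesis
  proof eventually_elim
    case (elim x)
    have "pvm_simple_integral E s (\<lambda>y. a * g y + b * h y) x = (\<Sum>c\<in>s ` unit_circle.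
        c * (a * E {z\<in>unit_circle. s z = c} g x + b * E {z\<in>unit_circle. s z = c} h x))"
      unfolding pvm_simple_integral_def using elim by (intro sum.cong refl) auto
    then show ?case
      by (simp add: pvm_simple_integral_def sum.distrib sum_distrib_left ring_distribs mult.left_commute)
  qed
qed

lemma simple_integral_diff_arg:
  assumes "simple_function circle_borel s" "g \<in> L2 \<omega>" "h \<in> L2 \<omega>"
  shows "AE x in \<omega>. pvm_simple_integral E s (\<lambda>y. g y - h y) x
    = pvm_simple_integral E s g x - pvm_simple_integral E s h x"
  using simple_integral_comb_arg[OF assms, of 1 "-1"] by simp

text \<open>Multiplicativity comes from \<open>E (A \<inter> B) = E A (E B)\<close> on the level
  sets of the two factors.\<close>

lemma simple_integral_mult:
  assumes s: "simple_function circle_borel s" and t: "simple_function circle_borel t" and g: "g \<in> L2 \<omega>"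
  shows "AE x in \<omega>. pvm_simple_integral E (\<lambda>z. s z * t z) g x
    = pvm_simple_integral E s (pvm_simple_integral E t g) x"
proof -
  let ?A = "\<lambda>c. {z\<in>unit_circle. s z = c}" and ?B = "\<lambda>c. {z\<in>unit_circle. t z = c}"
  let ?S = "s ` unit_circle" and ?T = "t ` unit_circle"
  let ?u = "\<lambda>z. (s z, t z)"
  have u: "simple_function circle_borel ?u"
    by (rule simple_function_Pair[OF s t])
  note fin = simple_function_circle_finite[OF s] simple_function_circle_finite[OF t]
  note A = simple_function_circle_level[OF s] and B = simple_function_circle_level[OF t]
  have "AE x in \<omega>. \<forall>p\<in>?S \<times> ?T. E (?A (fst p) \<inter> ?B (snd p)) g x = E (?A (fst p)) (E (?B (snd p)) g) x"
    by (intro AE_finite_allI finite_cartesian_product fin Int_AE A B g)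
  moreover have "AE x in \<omega>. \<forall>c\<in>?S. E (?A c) (\<lambda>y. \<Sum>d\<in>?T. d * E (?B d) g y) x
      = (\<Sum>d\<in>?T. d * E (?A c) (E (?B d) g) x)"
    by (intro AE_finite_allI fin L2_linear_sum linear A closed B g)
  moreover have "AE x in \<omega>. pvm_simple_integral E (\<lambda>z. s z * t z) g x
      = (\<Sum>p\<in>?u ` unit_circle. fst p * snd p * E {z\<in>unit_circle. ?u z = p} g x)"
    using simple_integral_compose[OF u g, of "\<lambda>p. fst p * snd p"] by simp
  ultimately show ?thesis
    using empty_AE[OF g]
  proof eventually_elim
    case (elim x)
    have eq: "{z\<in>unit_circle. ?u z = p} = ?A (fst p) \<inter> ?B (snd p)" for p
      by auto
    have "(\<Sum>p\<in>?u ` unit_circle. fst p * snd p * E {z\<in>unit_circle. ?u z = p} g x)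
        = (\<Sum>p\<in>?S \<times> ?T. fst p * snd p * E (?A (fst p) \<inter> ?B (snd p)) g x)"
      unfolding eq
    proof (rule sum.mono_neutral_left)
      \<comment> \<open>A pair of values never taken jointly has disjoint level sets, and
        \<open>E {} g\<close> vanishes almost everywhere; so the sum may run over the full
        product.\<close>
      show "\<forall>p\<in>?S \<times> ?T - ?u ` unit_circle. fst p * snd p * E (?A (fst p) \<inter> ?B (snd p)) g x = 0"
      proof
        fix p assume "p \<in> ?S \<times> ?T - ?u ` unit_circle"
        then have "?u z \<noteq> p" if "z \<in> unit_circle" for z using that by blast
        then have "?A (fst p) \<inter> ?B (snd p) = {}" unfolding prod_eq_iff by auto
        then show "fst p * snd p * E (?A (fst p) \<inter> ?B (snd p)) g x = 0"
          using elim(4) by simp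
      qed
    qed (use fin in auto)
    also have "\<dots> = (\<Sum>p\<in>?S \<times> ?T. fst p * snd p * E (?A (fst p)) (E (?B (snd p)) g) x)"
      using elim(1) by (intro sum.cong) auto
    also have "\<dots> = (\<Sum>c\<in>?S. c * (\<Sum>d\<in>?T. d * E (?A c) (E (?B d) g) x))"
      by (simp add: sum.cartesian_product' sum_distrib_left mult.assoc)
    also have "\<dots> = (\<Sum>c\<in>?S. c * E (?A c) (\<lambda>y. \<Sum>d\<in>?T. d * E (?B d) g y) x)"
      using elim(2) by (intro sum.cong) auto
    finally show ?case using elim(3) unfolding pvm_simple_integral_def by simp
  qed
qed

lemma orthogonal:
  assumes A: "A \<in> sets circle_borel" and B: "B \<in> sets circle_borel" and "A \<inter> B = {}" and g: "g \<in> L2 \<omega>"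
  shows "L2_inner \<omega> (E A g) (E B g) = 0"
proof -
  have "L2_inner \<omega> (E A g) (E B g) = L2_inner \<omega> g (E A (E B g))"
    by (intro self_adjoint A g closed B)
  also have "\<dots> = L2_inner \<omega> g (\<lambda>x. 0)"
    using Int_AE[OF A B g] empty_AE[OF g] \<open>A \<inter> B = {}\<close>
    by (intro L2_inner_cong_AE g closed A B L2_zero) (auto elim: AE_mp)
  finally show ?thesis by (simp add: L2_inner_def)
qed

text \<open>Pythagoras for the pairwise orthogonal components of \<open>g\<close> on the level sets.
  The coefficients are free because two choices are compared later: all equal to 1, which returns
  \<open>g\<close>, and \<open>a c = c\<close>, which returns the integral.\<close>

lemma norm_orthogonal_sum:
  assumes s: "simple_function circle_borel s" and g: "g \<in> L2 \<omega>"
  defines "V \<equiv> s ` unit_circle" and "P \<equiv> \<lambda>c. E {z\<in>unit_circle. s z = c} g"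
  shows "(L2_norm \<omega> (\<lambda>x. \<Sum>c\<in>V. a c * P c x))\<^sup>2 = (\<Sum>c\<in>V. (cmod (a c))\<^sup>2 * (L2_norm \<omega> (P c))\<^sup>2)"
proof -
  have fin: "finite V" unfolding V_def by (rule simple_function_circle_finite[OF s])
  have P: "P c \<in> L2 \<omega>" for c unfolding P_def by (intro closed simple_function_circle_level s g)
  have SP: "(\<lambda>x. \<Sum>c\<in>V. a c * P c x) \<in> L2 \<omega>" by (intro L2_sum L2_scale P)
  have orth: "L2_inner \<omega> (P c) (P d) = (if d = c then complex_of_real ((L2_norm \<omega> (P c))\<^sup>2) else 0)" for c d
    unfolding L2_inner_self[symmetric]
    using orthogonal[OF simple_function_circle_level[OF s] simple_function_circle_level[OF s] _ g, of c d]
    by (auto simp: P_def)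
  have "L2_inner \<omega> (\<lambda>x. \<Sum>c\<in>V. a c * P c x) (\<lambda>x. \<Sum>c\<in>V. a c * P c x)
      = (\<Sum>c\<in>V. a c * (\<Sum>d\<in>V. cnj (a d) * L2_inner \<omega> (P c) (P d)))"
    by (simp add: L2_inner_sum_left[OF P SP] L2_inner_sum_right[OF P P])
  also have "\<dots> = (\<Sum>c\<in>V. complex_of_real ((cmod (a c))\<^sup>2 * (L2_norm \<omega> (P c))\<^sup>2))"
    using fin by (intro sum.cong refl)
      (simp add: orth if_distrib complex_norm_square sum.delta' mult.assoc del: of_real_power cong: if_cong)
  finally show ?thesis
    unfolding L2_inner_self of_real_sum[symmetric] by (simp only: of_real_eq_iff)
qed

lemma simple_integral_norm_le:
  assumes s: "simple_function circle_borel s" and g: "g \<in> L2 \<omega>"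
    and B: "\<And>z. z \<in> unit_circle \<Longrightarrow> cmod (s z) \<le> B"
  shows "L2_norm \<omega> (pvm_simple_integral E s g) \<le> B * L2_norm \<omega> g"
proof (rule power2_le_imp_le)
  let ?V = "s ` unit_circle" and ?P = "\<lambda>c. E {z\<in>unit_circle. s z = c} g"
  \<comment> \<open>1 lies on the circle, so \<open>B\<close> bounds a norm there.\<close>
  have B0: "B \<ge> 0" using B[of 1] norm_ge_zero[of "s 1"] by (simp del: norm_ge_zero)
  then show "0 \<le> B * L2_norm \<omega> g" by simp
  have "(\<Union>c\<in>?V. {z\<in>unit_circle. s z = c}) = unit_circle" by auto
  moreover have "AE x in \<omega>. E (\<Union>c\<in>?V. {z\<in>unit_circle. s z = c}) g x = (\<Sum>c\<in>?V. ?P c x)"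
    by (intro UN_AE simple_function_circle_finite simple_function_circle_level s g)
      (auto simp: disjoint_family_on_def)
  ultimately have "AE x in \<omega>. g x = (\<Sum>c\<in>?V. 1 * ?P c x)"
    using circle_AE[OF g] by (auto elim: AE_mp)
  then have "L2_norm \<omega> g = L2_norm \<omega> (\<lambda>x. \<Sum>c\<in>?V. 1 * ?P c x)"
    by (intro L2_norm_cong_AE g L2_sum L2_scale closed simple_function_circle_level s)
  then have norm_g: "(L2_norm \<omega> g)\<^sup>2 = (\<Sum>c\<in>?V. (L2_norm \<omega> (?P c))\<^sup>2)"
    using norm_orthogonal_sum[OF s g, of "\<lambda>_. 1"] by simp
  have "(L2_norm \<omega> (pvm_simple_integral E s g))\<^sup>2 = (\<Sum>c\<in>?V. (cmod c)\<^sup>2 * (L2_norm \<omega> (?P c))\<^sup>2)"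
    unfolding pvm_simple_integral_def by (rule norm_orthogonal_sum[OF s g])
  also have "\<dots> \<le> (\<Sum>c\<in>?V. B\<^sup>2 * (L2_norm \<omega> (?P c))\<^sup>2)"
    using B by (intro sum_mono mult_right_mono power_mono) auto
  also have "\<dots> = (B * L2_norm \<omega> g)\<^sup>2"
    by (simp add: norm_g power_mult_distrib sum_distrib_left)
  finally show "(L2_norm \<omega> (pvm_simple_integral E s g))\<^sup>2 \<le> (B * L2_norm \<omega> g)\<^sup>2" .
qed


section \<open>Integrals of uniform limits of simple functions\<close>

lemma has_integral_L2: "has_pvm_integral \<omega> E \<phi> g h \<Longrightarrow> h \<in> L2 \<omega>"
  by (simp add: has_pvm_integral_def)

lemma has_integralE:
  assumes "has_pvm_integral \<omega> E \<phi> g h"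
  obtains s where "\<And>n. simple_function circle_borel (s n)"
    "uniform_limit unit_circle s \<phi> sequentially"
    "(\<lambda>n. L2_norm \<omega> (\<lambda>x. h x - pvm_simple_integral E (s n) g x)) \<longlonglongrightarrow> 0"
  using assms unfolding has_pvm_integral_def by blast

text \<open>The calculus is contractive for the supremum norm over the circle. Applied to
  differences, this gives uniqueness of the integral and the Cauchy estimates for uniform
  limits.\<close>

lemma has_integral_norm_le:
  assumes J: "has_pvm_integral \<omega> E \<phi> g h" and g: "g \<in> L2 \<omega>"
    and B: "\<And>z. z \<in> unit_circle \<Longrightarrow> cmod (\<phi> z) \<le> B"
  shows "L2_norm \<omega> h \<le> B * L2_norm \<omega> g"
proof -
  obtain s where s: "\<And>n. simple_function circle_borel (s n)"
    and u: "uniform_limit unit_circle s \<phi> sequentially"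
    and l: "(\<lambda>n. L2_norm \<omega> (\<lambda>x. h x - pvm_simple_integral E (s n) g x)) \<longlonglongrightarrow> 0"
    using has_integralE[OF J] by blast
  have lim: "(\<lambda>n. L2_norm \<omega> (pvm_simple_integral E (s n) g)) \<longlonglongrightarrow> L2_norm \<omega> h"
    by (intro tendsto_L2_norm has_integral_L2[OF J] simple_integral_L2 s g l)
  \<comment> \<open>\<open>s n\<close> is eventually within \<open>e\<close> of
    \<open>\<phi>\<close>, hence bounded by \<open>B + e\<close>; the slack is removed after the
    limit in \<open>n\<close>.\<close>
  have "L2_norm \<omega> h \<le> (B + e) * L2_norm \<omega> g" if "e > 0" for e
  proof (rule tendsto_upperbound[OF lim])
    show "\<forall>\<^sub>F n in sequentially. L2_norm \<omega> (pvm_simple_integral E (s n) g) \<le> (B + e) * L2_norm \<omega> g"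
      using uniform_limitD[OF u \<open>e > 0\<close>]
    proof eventually_elim
      case (elim n)
      show ?case
      proof (rule simple_integral_norm_le[OF s g])
        fix z assume "z \<in> unit_circle"
        with elim have "cmod (s n z - \<phi> z) < e" by (simp add: dist_norm)
        with B[OF \<open>z \<in> unit_circle\<close>] norm_triangle_sub[of "s n z" "\<phi> z"]
        show "cmod (s n z) \<le> B + e" by linarith
      qed
    qed
  qed simp
  then have "L2_norm \<omega> h \<le> B * L2_norm \<omega> g + e" if "e > 0" for e
  proof (cases "L2_norm \<omega> g = 0")
    case False
    then have "L2_norm \<omega> g > 0" using L2_norm_nonneg[of \<omega> g] by linarith
    with \<open>\<And>e. e > 0 \<Longrightarrow> L2_norm \<omega> h \<le> (B + e) * L2_norm \<omega> g\<close>[of "e / L2_norm \<omega> g"] that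
    show ?thesis by (simp add: ring_distribs)
  qed (use that in force)
  then show ?thesis by (rule field_le_epsilon)
qed

lemma has_integral_comb:
  assumes J: "has_pvm_integral \<omega> E \<phi> g h" and J': "has_pvm_integral \<omega> E \<phi>' g h'" and g: "g \<in> L2 \<omega>"
  shows "has_pvm_integral \<omega> E (\<lambda>z. a * \<phi> z + b * \<phi>' z) g (\<lambda>x. a * h x + b * h' x)"
proof -
  obtain s where s: "\<And>n. simple_function circle_borel (s n)"
    and u: "uniform_limit unit_circle s \<phi> sequentially"
    and l: "(\<lambda>n. L2_norm \<omega> (\<lambda>x. h x - pvm_simple_integral E (s n) g x)) \<longlonglongrightarrow> 0"
    using has_integralE[OF J] by blast
  obtain s' where s': "\<And>n. simple_function circle_borel (s' n)"
    and u': "uniform_limit unit_circle s' \<phi>' sequentially"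
    and l': "(\<lambda>n. L2_norm \<omega> (\<lambda>x. h' x - pvm_simple_integral E (s' n) g x)) \<longlonglongrightarrow> 0"
    using has_integralE[OF J'] by blast
  note hL = has_integral_L2[OF J] has_integral_L2[OF J']
  let ?I = "\<lambda>s. pvm_simple_integral E s g"
  let ?t = "\<lambda>n z. a * s n z + b * s' n z"
  have t: "simple_function circle_borel (?t n)" for n
    by (intro simple_function_add simple_function_mult simple_function_const s s')
  have "L2_norm \<omega> (\<lambda>x. (a * h x + b * h' x) - ?I (?t n) x)
    \<le> cmod a * L2_norm \<omega> (\<lambda>x. h x - ?I (s n) x) + cmod b * L2_norm \<omega> (\<lambda>x. h' x - ?I (s' n) x)" for n
  proof -
    have L: "(\<lambda>x. h x - ?I (s n) x) \<in> L2 \<omega>" "(\<lambda>x. h' x - ?I (s' n) x) \<in> L2 \<omega>"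
      by (intro L2_diff hL simple_integral_L2 s s' g)+
    have "L2_norm \<omega> (\<lambda>x. (a * h x + b * h' x) - ?I (?t n) x)
      = L2_norm \<omega> (\<lambda>x. a * (h x - ?I (s n) x) + b * (h' x - ?I (s' n) x))"
    proof (rule L2_norm_cong_AE)
      show "AE x in \<omega>. (a * h x + b * h' x) - ?I (?t n) x = a * (h x - ?I (s n) x) + b * (h' x - ?I (s' n) x)"
        using simple_integral_comb_fun[OF s[of n] s'[of n] g, where a = a and b = b]
        by eventually_elim (simp add: algebra_simps)
    qed (intro L2_diff L2_add L2_scale hL simple_integral_L2 s s' t g)+
    also have "\<dots> \<le> cmod a * L2_norm \<omega> (\<lambda>x. h x - ?I (s n) x) + cmod b * L2_norm \<omega> (\<lambda>x. h' x - ?I (s' n) x)"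
      using L2_norm_triangle[OF L2_scale[OF L(1), of a] L2_scale[OF L(2), of b]] by (simp add: L2_norm_scale)
    finally show ?thesis .
  qed
  moreover have "(\<lambda>n. cmod a * L2_norm \<omega> (\<lambda>x. h x - ?I (s n) x) + cmod b * L2_norm \<omega> (\<lambda>x. h' x - ?I (s' n) x))
    \<longlonglongrightarrow> cmod a * 0 + cmod b * 0"
    by (intro tendsto_intros l l')
  ultimately have "(\<lambda>n. L2_norm \<omega> (\<lambda>x. (a * h x + b * h' x) - ?I (?t n) x)) \<longlonglongrightarrow> 0"
    by - (rule Lim_null_comparison[where g = "\<lambda>n. cmod a * L2_norm \<omega> (\<lambda>x. h x - ?I (s n) x)
      + cmod b * L2_norm \<omega> (\<lambda>x. h' x - ?I (s' n) x)"], auto)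
  moreover have "uniform_limit unit_circle ?t (\<lambda>z. a * \<phi> z + b * \<phi>' z) sequentially"
    by (intro uniform_limit_add bounded_linear.uniform_limit[OF bounded_linear_mult_right] u u')
  ultimately show ?thesis
    unfolding has_pvm_integral_def using t hL by (intro conjI exI[of _ ?t]) (auto intro!: L2_add L2_scale)
qed

text \<open>The difference of the two values is an integral of the zero function, to which the
  supremum bound 0 applies.\<close>

lemma has_integral_unique:
  assumes J: "has_pvm_integral \<omega> E \<phi> g h" and J': "has_pvm_integral \<omega> E \<phi> g h'" and g: "g \<in> L2 \<omega>"
  shows "L2_norm \<omega> (\<lambda>x. h x - h' x) = 0"
  using has_integral_norm_le[OF has_integral_comb[OF assms, of 1 "-1"] g, of 0]
  by (simp add: order_antisym)

text \<open>A uniform limit of simple functions is bounded.\<close>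

lemma has_integral_bounded:
  assumes "has_pvm_integral \<omega> E \<phi> g h"
  obtains B where "B \<ge> 0" "\<And>z. z \<in> unit_circle \<Longrightarrow> cmod (\<phi> z) \<le> B"
proof -
  obtain s where s: "\<And>n. simple_function circle_borel (s n)"
    and u: "uniform_limit unit_circle s \<phi> sequentially"
    using has_integralE[OF assms] by blast
  obtain n where n: "\<forall>z\<in>unit_circle. dist (s n z) (\<phi> z) < 1"
    using eventually_happens[OF uniform_limitD[OF u, of 1]] by auto
  have "bounded (s n ` unit_circle)" by (intro finite_imp_bounded simple_function_circle_finite s)
  then obtain B where B: "\<And>z. z \<in> unit_circle \<Longrightarrow> cmod (s n z) \<le> B"
    unfolding bounded_iff by blast
  have "cmod (\<phi> z) \<le> B + 1" if "z \<in> unit_circle" for z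
  proof -
    have "cmod (\<phi> z - s n z) < 1" using that n by (simp add: dist_norm norm_minus_commute)
    with B[OF that] norm_triangle_sub[of "\<phi> z" "s n z"] show ?thesis by linarith
  qed
  then show ?thesis using that[of "max 0 (B + 1)"] by (simp add: le_max_iff_disj)
qed

lemma simple_integral_norm_diff_le:
  assumes s: "simple_function circle_borel s" and g: "g \<in> L2 \<omega>" and h: "h \<in> L2 \<omega>"
    and B: "\<And>z. z \<in> unit_circle \<Longrightarrow> cmod (s z) \<le> B"
  shows "L2_norm \<omega> (\<lambda>x. pvm_simple_integral E s g x - pvm_simple_integral E s h x)
    \<le> B * L2_norm \<omega> (\<lambda>x. g x - h x)"
proof -
  have "L2_norm \<omega> (\<lambda>x. pvm_simple_integral E s g x - pvm_simple_integral E s h x)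
      = L2_norm \<omega> (pvm_simple_integral E s (\<lambda>x. g x - h x))"
  proof (rule L2_norm_cong_AE)
    show "AE x in \<omega>. pvm_simple_integral E s g x - pvm_simple_integral E s h x = pvm_simple_integral E s (\<lambda>x. g x - h x) x"
      using simple_integral_diff_arg[OF s g h] by eventually_elim simp
  qed (intro L2_diff simple_integral_L2 s g h)+
  also have "\<dots> \<le> B * L2_norm \<omega> (\<lambda>x. g x - h x)"
    by (intro simple_integral_norm_le s L2_diff g h B)
  finally show ?thesis .
qed

lemma has_integral_mult:
  assumes J: "has_pvm_integral \<omega> E \<phi> h k" and J': "has_pvm_integral \<omega> E \<phi>' g h" and g: "g \<in> L2 \<omega>"
  shows "has_pvm_integral \<omega> E (\<lambda>z. \<phi> z * \<phi>' z) g k"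
proof -
  obtain s where s: "\<And>n. simple_function circle_borel (s n)"
    and u: "uniform_limit unit_circle s \<phi> sequentially"
    and l: "(\<lambda>n. L2_norm \<omega> (\<lambda>x. k x - pvm_simple_integral E (s n) h x)) \<longlonglongrightarrow> 0"
    using has_integralE[OF J] by blast
  obtain s' where s': "\<And>n. simple_function circle_borel (s' n)"
    and u': "uniform_limit unit_circle s' \<phi>' sequentially"
    and l': "(\<lambda>n. L2_norm \<omega> (\<lambda>x. h x - pvm_simple_integral E (s' n) g x)) \<longlonglongrightarrow> 0"
    using has_integralE[OF J'] by blast
  obtain B where B: "\<And>z. z \<in> unit_circle \<Longrightarrow> cmod (\<phi> z) \<le> B"
    using has_integral_bounded[OF J] by blast
  obtain B' where B': "\<And>z. z \<in> unit_circle \<Longrightarrow> cmod (\<phi>' z) \<le> B'"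
    using has_integral_bounded[OF J'] by blast
  note kL = has_integral_L2[OF J] and hL = has_integral_L2[OF J']
  let ?t = "\<lambda>n z. s n z * s' n z"
  \<comment> \<open>The error is split at the integral of \<open>s n\<close> applied to
    \<open>h\<close>. Eventually \<open>s n\<close> is bounded by \<open>B + 1\<close> on the
    circle, hence so is the operator norm of its integral; this is the factor on the error of
    approximating \<open>h\<close>.\<close>
  let ?b = "\<lambda>n. L2_norm \<omega> (\<lambda>x. k x - pvm_simple_integral E (s n) h x)
      + (B + 1) * L2_norm \<omega> (\<lambda>x. h x - pvm_simple_integral E (s' n) g x)"
  have t: "simple_function circle_borel (?t n)" for n
    by (intro simple_function_mult s s')
  have bnd: "\<forall>z\<in>unit_circle. cmod (\<phi> z) \<le> B" using B by blast
  have "\<forall>\<^sub>F n in sequentially. norm (L2_norm \<omega> (\<lambda>x. k x - pvm_simple_integral E (?t n) g x)) \<le> ?b n"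
    using uniform_limit_bounded_eventually[OF u bnd]
  proof eventually_elim
    case (elim n)
    have I'L: "pvm_simple_integral E (s' n) g \<in> L2 \<omega>" by (intro simple_integral_L2 s' g)
    have "L2_norm \<omega> (\<lambda>x. k x - pvm_simple_integral E (?t n) g x)
        = L2_norm \<omega> (\<lambda>x. k x - pvm_simple_integral E (s n) (pvm_simple_integral E (s' n) g) x)"
      using simple_integral_mult[OF s[of n] s'[of n] g]
      by (intro L2_norm_cong_AE L2_diff kL simple_integral_L2 t s I'L g) auto
    also have "\<dots> \<le> L2_norm \<omega> (\<lambda>x. k x - pvm_simple_integral E (s n) h x)
        + L2_norm \<omega> (\<lambda>x. pvm_simple_integral E (s n) h x
            - pvm_simple_integral E (s n) (pvm_simple_integral E (s' n) g) x)"
      by (intro L2_norm_diff_triangle kL simple_integral_L2 s hL I'L)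
    also have "\<dots> \<le> ?b n"
      using elim by (intro add_left_mono simple_integral_norm_diff_le s hL I'L) auto
    finally show ?case by simp
  qed
  moreover have "?b \<longlonglongrightarrow> 0 + (B + 1) * 0"
    by (intro tendsto_intros l l')
  ultimately have "(\<lambda>n. L2_norm \<omega> (\<lambda>x. k x - pvm_simple_integral E (?t n) g x)) \<longlonglongrightarrow> 0"
    by - (rule Lim_null_comparison[where g = ?b], auto)
  moreover have "uniform_limit unit_circle ?t (\<lambda>z. \<phi> z * \<phi>' z) sequentially"
  proof (intro uniform_lim_mult u u')
    show "bounded (\<phi> ` unit_circle)" using B by (intro boundedI[of _ B]) auto
    show "bounded (\<phi>' ` unit_circle)" using B' by (intro boundedI[of _ B']) auto
  qed
  ultimately show ?thesis
    unfolding has_pvm_integral_def by (intro conjI exI[of _ ?t] allI t kL)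
qed

lemma simple_integral_const: "pvm_simple_integral E (\<lambda>z. a) g x = a * E unit_circle g x"
proof -
  have "(\<lambda>z. a) ` unit_circle = {a}" "{z \<in> unit_circle. a = a} = unit_circle"
    by (auto simp: image_constant_conv intro: exI[of _ 1])
  then show ?thesis
    unfolding pvm_simple_integral_def by (simp only:) simp
qed

lemma has_integral_const:
  assumes g: "g \<in> L2 \<omega>"
  shows "has_pvm_integral \<omega> E (\<lambda>z. a) g (\<lambda>x. a * g x)"
proof -
  have "(\<lambda>x. a * g x - a * E unit_circle g x) \<in> L2 \<omega>"
    by (intro L2_diff L2_scale closed g) (use sets.top[of circle_borel] in simp)
  then have "L2_norm \<omega> (\<lambda>x. a * g x - pvm_simple_integral E (\<lambda>z. a) g x) = 0"
    unfolding simple_integral_const using circle_AE[OF g]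
    by (subst L2_norm_eq_0) (auto simp: eq_commute[of "g _"])
  then show ?thesis
    unfolding has_pvm_integral_def using g
    by (intro conjI L2_scale exI[of _ "\<lambda>n z. a"]) (auto simp: uniform_limit_const)
qed

text \<open>\<open>cnj z * z = 1\<close> on the circle, so the integral of \<open>cnj\<close>
  inverts that of the identity. As no integral of \<open>cnj\<close> at \<open>g\<close> is known
  yet, the witness is built from conjugated simple functions: integrating \<open>cnj (s n)\<close>
  after \<open>s n\<close> amounts to integrating their product, and the result at \<open>h\<close>
  tends to \<open>h\<close>.\<close>

lemma has_integral_cnj:
  assumes J: "has_pvm_integral \<omega> E (\<lambda>z. z) h g" and h: "h \<in> L2 \<omega>"
  shows "has_pvm_integral \<omega> E cnj g h"
proof -
  obtain s where s: "\<And>n. simple_function circle_borel (s n)"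
    and u: "uniform_limit unit_circle s (\<lambda>z. z) sequentially"
    and l: "(\<lambda>n. L2_norm \<omega> (\<lambda>x. g x - pvm_simple_integral E (s n) h x)) \<longlonglongrightarrow> 0"
    using has_integralE[OF J] by blast
  note g = has_integral_L2[OF J]
  have s': "simple_function circle_borel (\<lambda>z. cnj (s n z))" for n
    using simple_function_compose[OF s[of n], of cnj] by (simp add: comp_def)
  have u': "uniform_limit unit_circle (\<lambda>n z. cnj (s n z)) cnj sequentially"
    using bounded_linear.uniform_limit[OF bounded_linear_cnj u] by simp
  let ?I = "\<lambda>n. pvm_simple_integral E (\<lambda>z. cnj (s n z))"
  let ?t = "\<lambda>n z. cnj (s n z) * s n z"
  have t: "simple_function circle_borel (?t n)" for n
    by (intro simple_function_mult s s')
  have tu: "uniform_limit unit_circle ?t (\<lambda>z. cnj z * z) sequentially"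
    by (intro uniform_lim_mult u u') (auto simp: bounded_iff intro: exI[of _ 1])
  have hh: "has_pvm_integral \<omega> E (\<lambda>z. 1) h h"
    using has_integral_const[OF h, of 1] by simp
  have lt: "(\<lambda>n. L2_norm \<omega> (\<lambda>x. h x - pvm_simple_integral E (?t n) h x)) \<longlonglongrightarrow> 0"
  proof (rule tendstoI)
    fix e :: real assume e: "e > 0"
    \<comment> \<open>Adding 1 keeps the denominator positive when \<open>h\<close> has norm 0 and
      makes the resulting estimate strict.\<close>
    define e' where "e' = e / (L2_norm \<omega> h + 1)"
    have n1: "L2_norm \<omega> h + 1 > 0" using L2_norm_nonneg[of \<omega> h] by linarith
    have e': "e' > 0" unfolding e'_def using e n1 by simp
    have lt: "e' * L2_norm \<omega> h < e"
      unfolding e'_def using e n1 by (simp add: field_simps)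
    show "\<forall>\<^sub>F n in sequentially. dist (L2_norm \<omega> (\<lambda>x. h x - pvm_simple_integral E (?t n) h x)) 0 < e"
      using uniform_limitD[OF tu e']
    proof eventually_elim
      case (elim n)
      have one: "simple_function circle_borel (\<lambda>z. 1 :: complex)" by simp
      have d: "simple_function circle_borel (\<lambda>z. 1 * 1 + (-1) * ?t n z)"
        by (intro simple_function_add simple_function_mult simple_function_const t s s')
      have "AE x in \<omega>. h x - pvm_simple_integral E (?t n) h x = pvm_simple_integral E (\<lambda>z. 1 * 1 + (-1) * ?t n z) h x"
      proof -
        show ?thesis
          using simple_integral_comb_fun[OF one t h, of 1 "-1" n] circle_AE[OF h]
          by eventually_elim (simp add: simple_integral_const)
      qed
      then have "L2_norm \<omega> (\<lambda>x. h x - pvm_simple_integral E (?t n) h x) =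
          L2_norm \<omega> (pvm_simple_integral E (\<lambda>z. 1 * 1 + (-1) * ?t n z) h)"
        by (intro L2_norm_cong_AE L2_diff h simple_integral_L2 t d)
      also have "\<dots> \<le> e' * L2_norm \<omega> h"
      proof (rule simple_integral_norm_le[OF d h])
        fix z :: complex assume z: "z \<in> unit_circle"
        then have "cnj z * z = 1" by (simp add: mult.commute[of "cnj z"] flip: complex_norm_square)
        with elim z show "cmod (1 * 1 + (-1) * ?t n z) \<le> e'"
          by (metis (no_types, lifting) add_uminus_conv_diff dist_commute dist_norm less_imp_le
              mult_1 mult_minus_left)
      qed
      finally show ?case using lt by simp
    qed
  qed
  \<comment> \<open>The factor \<open>1 + 1\<close> bounds \<open>cnj (s n)\<close> eventually: its
    uniform limit has modulus 1, and the deviation is at most 1.\<close>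
  let ?b = "\<lambda>n. L2_norm \<omega> (\<lambda>x. h x - pvm_simple_integral E (?t n) h x)
      + (1 + 1) * L2_norm \<omega> (\<lambda>x. g x - pvm_simple_integral E (s n) h x)"
  have bnd: "\<forall>z\<in>unit_circle. cmod (cnj z) \<le> 1" by simp
  have "\<forall>\<^sub>F n in sequentially. norm (L2_norm \<omega> (\<lambda>x. h x - ?I n g x)) \<le> ?b n"
    using uniform_limit_bounded_eventually[OF u' bnd]
  proof eventually_elim
    case (elim n)
    have IL: "pvm_simple_integral E (s n) h \<in> L2 \<omega>" by (intro simple_integral_L2 s h)
    have "L2_norm \<omega> (\<lambda>x. h x - ?I n g x) \<le> L2_norm \<omega> (\<lambda>x. h x - ?I n (pvm_simple_integral E (s n) h) x)
        + L2_norm \<omega> (\<lambda>x. ?I n (pvm_simple_integral E (s n) h) x - ?I n g x)"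
      by (intro L2_norm_diff_triangle h simple_integral_L2 s' g IL)
    also have "L2_norm \<omega> (\<lambda>x. h x - ?I n (pvm_simple_integral E (s n) h) x)
        = L2_norm \<omega> (\<lambda>x. h x - pvm_simple_integral E (?t n) h x)"
      using simple_integral_mult[OF s'[of n] s[of n] h]
      by (intro L2_norm_cong_AE L2_diff h simple_integral_L2 t s' IL) auto
    also have "L2_norm \<omega> (\<lambda>x. ?I n (pvm_simple_integral E (s n) h) x - ?I n g x)
        \<le> (1 + 1) * L2_norm \<omega> (\<lambda>x. pvm_simple_integral E (s n) h x - g x)"
      using elim by (intro simple_integral_norm_diff_le s' IL g) auto
    finally show ?case by (simp add: L2_norm_minus_commute[of \<omega> g])
  qed
  moreover have "?b \<longlonglongrightarrow> 0 + (1 + 1) * 0"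
    by (intro tendsto_intros l lt)
  ultimately have "(\<lambda>n. L2_norm \<omega> (\<lambda>x. h x - ?I n g x)) \<longlonglongrightarrow> 0"
    by - (rule Lim_null_comparison[where g = ?b], auto)
  then show ?thesis
    unfolding has_pvm_integral_def
    by (intro conjI exI[of _ "\<lambda>n z. cnj (s n z)"] allI s' u' h)
qed

text \<open>The values \<open>h n\<close> are Cauchy by the supremum bound. The definition of the
  integral wants simple functions, so a diagonal choice takes \<open>s n\<close> within
  \<open>1/(n+1)\<close> of \<open>p n\<close> both uniformly and in the integral at
  \<open>g\<close>.\<close>

lemma has_integral_uniform_limit:
  assumes J: "\<And>n. has_pvm_integral \<omega> E (p n) g (h n)" and g: "g \<in> L2 \<omega>"
    and u: "uniform_limit unit_circle p \<phi> sequentially"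
  shows "\<exists>k. has_pvm_integral \<omega> E \<phi> g k"
proof -
  note hL = has_integral_L2[OF J]
  have n1: "L2_norm \<omega> g + 1 > 0" using L2_norm_nonneg[of \<omega> g] by linarith
  have "\<exists>k\<in>L2 \<omega>. (\<lambda>n. L2_norm \<omega> (\<lambda>x. k x - h n x)) \<longlonglongrightarrow> 0"
  proof (rule L2_complete[OF hL])
    fix e :: real assume e: "e > 0"
    define e' where "e' = e / (L2_norm \<omega> g + 1)"
    have e': "e' > 0" unfolding e'_def using e n1 by simp
    have lt: "e' * L2_norm \<omega> g < e"
      unfolding e'_def using e n1 by (simp add: field_simps)
    obtain N where N: "\<And>n z. n \<ge> N \<Longrightarrow> z \<in> unit_circle \<Longrightarrow> dist (p n z) (\<phi> z) < e' / 2"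
      using uniform_limitD[OF u half_gt_zero[OF e']] unfolding eventually_sequentially by blast
    have "L2_norm \<omega> (\<lambda>x. h m x - h n x) < e" if "m \<ge> N" "n \<ge> N" for m n
    proof -
      have "L2_norm \<omega> (\<lambda>x. 1 * h m x + (-1) * h n x) \<le> e' * L2_norm \<omega> g"
      proof (rule has_integral_norm_le[OF has_integral_comb[OF J J g] g])
        fix z :: complex assume z: "z \<in> unit_circle"
        have "dist (p m z) (p n z) < e'"
          using N[OF that(1) z] N[OF that(2) z] by (rule dist_triangle_half_l)
        then show "cmod (1 * p m z + (-1) * p n z) \<le> e'" by (simp add: dist_norm)
      qed
      then show ?thesis using lt by simp
    qed
    then show "\<exists>N. \<forall>m\<ge>N. \<forall>n\<ge>N. L2_norm \<omega> (\<lambda>x. h m x - h n x) < e" by blast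
  qed
  then obtain k where k: "k \<in> L2 \<omega>" and kl: "(\<lambda>n. L2_norm \<omega> (\<lambda>x. k x - h n x)) \<longlonglongrightarrow> 0" by blast
  have "\<exists>s. simple_function circle_borel s \<and> (\<forall>z\<in>unit_circle. dist (s z) (p n z) < inverse (Suc n))
      \<and> L2_norm \<omega> (\<lambda>x. h n x - pvm_simple_integral E s g x) < inverse (Suc n)" for n
  proof -
    obtain s where s: "\<And>m. simple_function circle_borel (s m)"
      and u: "uniform_limit unit_circle s (p n) sequentially"
      and l: "(\<lambda>m. L2_norm \<omega> (\<lambda>x. h n x - pvm_simple_integral E (s m) g x)) \<longlonglongrightarrow> 0"
      using has_integralE[OF J] by blast
    have pos: "inverse (real (Suc n)) > 0" by simp
    have "\<forall>\<^sub>F m in sequentially. (\<forall>z\<in>unit_circle. dist (s m z) (p n z) < inverse (Suc n))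
      \<and> L2_norm \<omega> (\<lambda>x. h n x - pvm_simple_integral E (s m) g x) < inverse (Suc n)"
      using uniform_limitD[OF u pos] order_tendstoD(2)[OF l pos] by (rule eventually_conj)
    from eventually_happens'[OF sequentially_bot this] show ?thesis using s by blast
  qed
  then obtain s where s: "\<And>n. simple_function circle_borel (s n)"
    and sp: "\<And>n z. z \<in> unit_circle \<Longrightarrow> dist (s n z) (p n z) < inverse (Suc n)"
    and sh: "\<And>n. L2_norm \<omega> (\<lambda>x. h n x - pvm_simple_integral E (s n) g x) < inverse (Suc n)"
    by metis
  have "uniform_limit unit_circle (\<lambda>n z. s n z - p n z) (\<lambda>z. 0) sequentially"
  proof (rule uniform_limitI)
    fix e :: real assume "e > 0"
    then have "\<forall>\<^sub>F n in sequentially. inverse (real (Suc n)) < e"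
      by (rule order_tendstoD(2)[OF LIMSEQ_inverse_real_of_nat])
    then show "\<forall>\<^sub>F n in sequentially. \<forall>z\<in>unit_circle. dist (s n z - p n z) 0 < e"
    proof eventually_elim
      case (elim n)
      show ?case
      proof
        fix z :: complex assume "z \<in> unit_circle"
        from sp[OF this, of n] elim show "dist (s n z - p n z) 0 < e" by (simp add: dist_norm)
      qed
    qed
  qed
  from uniform_limit_add[OF this u] have su: "uniform_limit unit_circle s \<phi> sequentially" by simp
  have "L2_norm \<omega> (\<lambda>x. k x - pvm_simple_integral E (s n) g x) \<le> L2_norm \<omega> (\<lambda>x. k x - h n x) + inverse (Suc n)" for n
    using L2_norm_diff_triangle[OF k hL[of n] simple_integral_L2[OF s[of n] g]] sh[of n] by linarith
  moreover have "(\<lambda>n. L2_norm \<omega> (\<lambda>x. k x - h n x) + inverse (Suc n)) \<longlonglongrightarrow> 0 + 0"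
    by (intro tendsto_intros kl LIMSEQ_inverse_real_of_nat)
  ultimately have "(\<lambda>n. L2_norm \<omega> (\<lambda>x. k x - pvm_simple_integral E (s n) g x)) \<longlonglongrightarrow> 0"
    by - (rule Lim_null_comparison[where g = "\<lambda>n. L2_norm \<omega> (\<lambda>x. k x - h n x) + inverse (Suc n)"], auto)
  then show ?thesis unfolding has_pvm_integral_def by (intro exI[of _ k] conjI exI[of _ s] allI s su k)
qed

end

section \<open>Matrix algebra of mpEDMD\<close>

lemma cscalar_prod_sum:
  fixes v w :: "complex Matrix.vec"
  shows "v \<bullet>c w = (\<Sum>i<dim_vec w. vec_index v i * cnj (vec_index w i))"
  unfolding scalar_prod_def by (simp add: lessThan_atLeast0)

lemma mat_adjoint_index:
  fixes B :: "complex Matrix.mat"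
  assumes "i < dim_col B" "j < dim_row B"
  shows "mat_adjoint B $$ (i, j) = cnj (B $$ (j, i))"
  unfolding mat_adjoint_def using assms by (simp add: mat_of_rows_index)

lemma mat_adjoint_dim [simp]: "dim_row (mat_adjoint B) = dim_col B" "dim_col (mat_adjoint B) = dim_row B"
  unfolding mat_adjoint_def by auto

lemma mat_adjoint_adjoint [simp]: "mat_adjoint (mat_adjoint B) = (B :: complex Matrix.mat)"
  by (intro eq_matI) (simp_all add: mat_adjoint_index)

lemma cscalar_prod_adjoint:
  fixes B :: "complex Matrix.mat"
  assumes B: "B \<in> carrier_mat n m" and v: "v \<in> carrier_vec m" and w: "w \<in> carrier_vec n"
  shows "(B *\<^sub>v v) \<bullet>c w = v \<bullet>c (mat_adjoint B *\<^sub>v w)"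
proof -
  have "(B *\<^sub>v v) \<bullet>c w = (\<Sum>i<n. \<Sum>j<m. B $$ (i, j) * vec_index v j * cnj (vec_index w i))"
    unfolding cscalar_prod_sum using B v w
    by (simp add: scalar_prod_def lessThan_atLeast0 sum_distrib_right)
  also have "\<dots> = (\<Sum>j<m. \<Sum>i<n. B $$ (i, j) * vec_index v j * cnj (vec_index w i))"
    by (rule sum.swap)
  also have "\<dots> = v \<bullet>c (mat_adjoint B *\<^sub>v w)"
    unfolding cscalar_prod_sum using B v w
    by (simp add: scalar_prod_def lessThan_atLeast0 sum_distrib_left mat_adjoint_index mult_ac)
  finally show ?thesis .
qed

definition vec_norm :: "complex Matrix.vec \<Rightarrow> real" where
  "vec_norm v = L2_set (\<lambda>i. cmod (vec_index v i)) {..<dim_vec v}"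

lemma vec_norm_nonneg [simp]: "0 \<le> vec_norm v"
  by (simp add: vec_norm_def)

lemma vec_norm_squared: "(vec_norm v)\<^sup>2 = (\<Sum>i<dim_vec v. (cmod (vec_index v i))\<^sup>2)"
  by (simp add: vec_norm_def L2_set_def sum_nonneg)

lemma cscalar_prod_self: "v \<bullet>c v = complex_of_real ((vec_norm v)\<^sup>2)"
  unfolding vec_norm_squared cscalar_prod_sum of_real_sum complex_norm_square ..

lemma vec_norm_unitary:
  assumes U: "U \<in> carrier_mat n n" and "mat_adjoint U * U = 1\<^sub>m n" and v: "v \<in> carrier_vec n"
  shows "vec_norm (U *\<^sub>v v) = vec_norm v"
proof -
  have Uv: "U *\<^sub>v v \<in> carrier_vec n" using U v by simp
  have "(U *\<^sub>v v) \<bullet>c (U *\<^sub>v v) = v \<bullet>c (mat_adjoint U *\<^sub>v (U *\<^sub>v v))"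
    by (rule cscalar_prod_adjoint[OF U v Uv])
  also have "mat_adjoint U *\<^sub>v (U *\<^sub>v v) = v"
    using assms by (simp flip: assoc_mult_mat_vec[OF mat_adjoint_carrier[OF U] U v])
  finally show ?thesis unfolding cscalar_prod_self of_real_eq_iff
    by (simp add: power2_eq_iff_nonneg)
qed

lemma mat_diag_carrier [simp]: "mat_diag n f \<in> carrier_mat n n"
  by (simp add: mat_diag_def)

lemma mat_diag_mult_vec:
  fixes v :: "complex Matrix.vec"
  assumes "v \<in> carrier_vec n"
  shows "mat_diag n f *\<^sub>v v = Matrix.vec n (\<lambda>i. f i * vec_index v i)"
proof (rule eq_vecI)
  fix i assume "i < dim_vec (Matrix.vec n (\<lambda>i. f i * vec_index v i))"
  then have i: "i < n" by simp
  have "vec_index (mat_diag n f *\<^sub>v v) i = (\<Sum>j<n. (if i = j then f j else 0) * vec_index v j)"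
    using i assms by (simp add: mat_diag_def scalar_prod_def lessThan_atLeast0)
  also have "\<dots> = (\<Sum>j<n. if j = i then f i * vec_index v i else 0)"
    by (intro sum.cong) auto
  finally show "vec_index (mat_diag n f *\<^sub>v v) i = vec_index (Matrix.vec n (\<lambda>i. f i * vec_index v i)) i"
    using i by simp
qed (simp add: mat_diag_def)

lemma mat_diag_const_mult_vec:
  fixes v :: "complex Matrix.vec"
  shows "v \<in> carrier_vec n \<Longrightarrow> mat_diag n (\<lambda>j. a) *\<^sub>v v = a \<cdot>\<^sub>v v"
  by (subst mat_diag_mult_vec) (auto intro!: eq_vecI)

lemma vec_norm_mat_diag_le:
  assumes v: "v \<in> carrier_vec n" and B: "\<And>j. j < n \<Longrightarrow> cmod (f j) \<le> B" "B \<ge> 0"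
  shows "vec_norm (mat_diag n f *\<^sub>v v) \<le> B * vec_norm v"
proof (rule power2_le_imp_le)
  have "(vec_norm (mat_diag n f *\<^sub>v v))\<^sup>2 = (\<Sum>i<n. (cmod (f i))\<^sup>2 * (cmod (vec_index v i))\<^sup>2)"
    unfolding mat_diag_mult_vec[OF v] vec_norm_squared by (simp add: norm_mult power_mult_distrib)
  also have "\<dots> \<le> (\<Sum>i<n. B\<^sup>2 * (cmod (vec_index v i))\<^sup>2)"
    using B by (intro sum_mono mult_right_mono power_mono) auto
  also have "\<dots> = (B * vec_norm v)\<^sup>2"
    using v by (simp add: power_mult_distrib vec_norm_squared sum_distrib_left)
  finally show "(vec_norm (mat_diag n f *\<^sub>v v))\<^sup>2 \<le> (B * vec_norm v)\<^sup>2" .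
qed (use B in simp)

lemma vec_norm_unit [simp]: "i < n \<Longrightarrow> vec_norm (unit_vec n i) = 1"
proof -
  assume i: "i < n"
  have "(vec_norm (unit_vec n i))\<^sup>2 = (\<Sum>j<n. if j = i then 1 else 0)"
    unfolding vec_norm_squared by (intro sum.cong) (auto simp: unit_vec_def i)
  then show ?thesis using i vec_norm_nonneg[of "unit_vec n i"] by (simp add: power2_eq_1_iff)
qed

section \<open>Functional calculus of one mpEDMD matrix\<close>

locale mpedmd =
  fixes N G A R Q U1 S U2 H lam
  assumes factors: "mpedmd_factors N G A R Q U1 S U2 H lam"
    and A: "A \<in> carrier_mat N N"
begin

lemma carriers [simp]:
  "R \<in> carrier_mat N N" "Q \<in> carrier_mat N N" "U1 \<in> carrier_mat N N" "U2 \<in> carrier_mat N N" "H \<in> carrier_mat N N"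
  using factors by (auto simp: mpedmd_factors_def is_matrix_sqrt_def is_matrix_inverse_def
      is_svd_def unitary_matrix_def)

lemma adjoint_carriers [simp]:
  "mat_adjoint U1 \<in> carrier_mat N N" "mat_adjoint U2 \<in> carrier_mat N N" "mat_adjoint H \<in> carrier_mat N N"
  "mat_adjoint A \<in> carrier_mat N N" "mat_adjoint Q \<in> carrier_mat N N"
  by (simp_all add: mat_adjoint_carrier A)

lemma mult_vec_carrier [simp]: "B \<in> carrier_mat N N \<Longrightarrow> v \<in> carrier_vec N \<Longrightarrow> B *\<^sub>v v \<in> carrier_vec N"
  by (rule mult_mat_vec_carrier)

lemma mult_mat_carrier [simp]: "B \<in> carrier_mat N N \<Longrightarrow> C \<in> carrier_mat N N \<Longrightarrow> B * C \<in> carrier_mat N N"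
  by (rule mult_carrier_mat)

lemma sqrt_facts: "mat_adjoint R = R" "R * R = G" "R * Q = 1\<^sub>m N" "Q * R = 1\<^sub>m N"
  using factors by (auto simp: mpedmd_factors_def is_matrix_sqrt_def is_matrix_inverse_def)

lemma unitary_facts:
  "mat_adjoint U1 * U1 = 1\<^sub>m N" "U1 * mat_adjoint U1 = 1\<^sub>m N"
  "mat_adjoint U2 * U2 = 1\<^sub>m N" "U2 * mat_adjoint U2 = 1\<^sub>m N"
  "mat_adjoint H * H = 1\<^sub>m N" "H * mat_adjoint H = 1\<^sub>m N"
  using factors by (auto simp: mpedmd_factors_def is_svd_def unitary_matrix_def)

lemma cancel_mult_vec:
  fixes B C :: "complex Matrix.mat"
  assumes "B * C = 1\<^sub>m N" "B \<in> carrier_mat N N" "C \<in> carrier_mat N N" "v \<in> carrier_vec N"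
  shows "B *\<^sub>v (C *\<^sub>v v) = v"
  unfolding assoc_mult_mat_vec[OF assms(2-4), symmetric] assms(1) using assms(4) by (rule one_mult_mat_vec)

lemma cancel [simp]:
  assumes v: "v \<in> carrier_vec N"
  shows "R *\<^sub>v (Q *\<^sub>v v) = v" "Q *\<^sub>v (R *\<^sub>v v) = v"
    "mat_adjoint U1 *\<^sub>v (U1 *\<^sub>v v) = v" "U1 *\<^sub>v (mat_adjoint U1 *\<^sub>v v) = v"
    "mat_adjoint U2 *\<^sub>v (U2 *\<^sub>v v) = v" "U2 *\<^sub>v (mat_adjoint U2 *\<^sub>v v) = v"
    "mat_adjoint H *\<^sub>v (H *\<^sub>v v) = v" "H *\<^sub>v (mat_adjoint H *\<^sub>v v) = v"
  by (rule cancel_mult_vec; simp add: sqrt_facts unitary_facts v)+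

lemma norm_unitary [simp]:
  assumes v: "v \<in> carrier_vec N"
  shows "vec_norm (mat_adjoint U1 *\<^sub>v v) = vec_norm v" "vec_norm (U1 *\<^sub>v v) = vec_norm v"
    "vec_norm (mat_adjoint U2 *\<^sub>v v) = vec_norm v" "vec_norm (U2 *\<^sub>v v) = vec_norm v"
    "vec_norm (mat_adjoint H *\<^sub>v v) = vec_norm v" "vec_norm (H *\<^sub>v v) = vec_norm v"
  by (rule vec_norm_unitary[where n = N]; simp add: unitary_facts v)+

text \<open>The norm of the inner product given by \<open>G\<close>. Written through the square root
  \<open>R\<close> it is a Euclidean norm, for which the unitary factors are isometries.\<close>

definition gnorm :: "complex Matrix.vec \<Rightarrow> real" where
  "gnorm c = vec_norm (R *\<^sub>v c)"

text \<open>This is \<open>f(K) = Q H f(\<Lambda>) H* R\<close> for the mpEDMD matrix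
  \<open>K\<close>. Keeping it a chain of matrix-vector products lets the cancellation rules
  collapse compositions.\<close>

definition calc :: "(complex \<Rightarrow> complex) \<Rightarrow> complex Matrix.vec \<Rightarrow> complex Matrix.vec" where
  "calc f c = Q *\<^sub>v (H *\<^sub>v (mat_diag N (\<lambda>j. f (lam j)) *\<^sub>v (mat_adjoint H *\<^sub>v (R *\<^sub>v c))))"

lemma gnorm_nonneg [simp]: "0 \<le> gnorm c"
  by (simp add: gnorm_def)

lemma calc_carrier [simp]: "c \<in> carrier_vec N \<Longrightarrow> calc f c \<in> carrier_vec N"
  by (simp add: calc_def)

lemma gnorm_squared: "c \<in> carrier_vec N \<Longrightarrow> (G *\<^sub>v c) \<bullet>c c = complex_of_real ((gnorm c)\<^sup>2)"
proof -
  assume c: "c \<in> carrier_vec N"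
  have "G *\<^sub>v c = R *\<^sub>v (R *\<^sub>v c)"
    using c by (simp add: assoc_mult_mat_vec[of R N N R N c] flip: sqrt_facts(2))
  then show ?thesis
    using cscalar_prod_adjoint[of R N N "R *\<^sub>v c" c] c
    by (simp add: sqrt_facts(1) gnorm_def cscalar_prod_self)
qed

lemma eigen_identity:
  assumes v: "v \<in> carrier_vec N"
  shows "H *\<^sub>v (mat_diag N lam *\<^sub>v (mat_adjoint H *\<^sub>v v)) = U2 *\<^sub>v (mat_adjoint U1 *\<^sub>v v)"
proof -
  have "U2 * mat_adjoint U1 = H * mat_diag N lam * mat_adjoint H"
    using factors by (simp add: mpedmd_factors_def)
  then have "(U2 * mat_adjoint U1) *\<^sub>v v = (H * mat_diag N lam * mat_adjoint H) *\<^sub>v v" by simp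
  also have "(H * mat_diag N lam * mat_adjoint H) *\<^sub>v v = H *\<^sub>v (mat_diag N lam *\<^sub>v (mat_adjoint H *\<^sub>v v))"
    using v by (simp add: assoc_mult_mat_vec[of _ N N _ N])
  also have "(U2 * mat_adjoint U1) *\<^sub>v v = U2 *\<^sub>v (mat_adjoint U1 *\<^sub>v v)"
    using v by (simp add: assoc_mult_mat_vec[of _ N N _ N])
  finally show ?thesis ..
qed

lemma calc_mult: "c \<in> carrier_vec N \<Longrightarrow> calc f (calc g c) = calc (\<lambda>z. f z * g z) c"
proof -
  assume c: "c \<in> carrier_vec N"
  let ?v = "mat_adjoint H *\<^sub>v (R *\<^sub>v c)"
  have v: "?v \<in> carrier_vec N" using c by simp
  have "mat_diag N (\<lambda>j. f (lam j)) *\<^sub>v (mat_diag N (\<lambda>j. g (lam j)) *\<^sub>v ?v)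
      = mat_diag N (\<lambda>j. f (lam j) * g (lam j)) *\<^sub>v ?v"
    unfolding mat_diag_mult_vec[OF v] by (subst mat_diag_mult_vec) (auto intro!: eq_vecI)
  then show ?thesis unfolding calc_def using c by simp
qed

lemma calc_cong: "(\<And>j. j < N \<Longrightarrow> f (lam j) = g (lam j)) \<Longrightarrow> calc f c = calc g c"
proof -
  assume "\<And>j. j < N \<Longrightarrow> f (lam j) = g (lam j)"
  then have "mat_diag N (\<lambda>j. f (lam j)) = mat_diag N (\<lambda>j. g (lam j))"
    by (intro eq_matI) (auto simp: mat_diag_def)
  then show ?thesis by (simp add: calc_def)
qed

lemma mult_mat_vec_add: "B \<in> carrier_mat N N \<Longrightarrow> v \<in> carrier_vec N \<Longrightarrow> w \<in> carrier_vec N \<Longrightarrow>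
    B *\<^sub>v v + B *\<^sub>v w = B *\<^sub>v (v + w)"
  by (simp add: mult_add_distrib_mat_vec[of B N N])

lemma calc_add: "c \<in> carrier_vec N \<Longrightarrow> calc f c + calc g c = calc (\<lambda>z. f z + g z) c"
proof -
  assume c: "c \<in> carrier_vec N"
  let ?v = "mat_adjoint H *\<^sub>v (R *\<^sub>v c)"
  have v: "?v \<in> carrier_vec N" using c by simp
  have "mat_diag N (\<lambda>j. f (lam j)) *\<^sub>v ?v + mat_diag N (\<lambda>j. g (lam j)) *\<^sub>v ?v
      = mat_diag N (\<lambda>j. f (lam j) + g (lam j)) *\<^sub>v ?v"
    unfolding mat_diag_mult_vec[OF v] by (auto intro!: eq_vecI simp: ring_distribs)
  then show ?thesis unfolding calc_def using c by (simp add: mult_mat_vec_add)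
qed

lemma calc_minus: "c \<in> carrier_vec N \<Longrightarrow> d \<in> carrier_vec N \<Longrightarrow> calc f c - calc f d = calc f (c - d)"
  unfolding calc_def by (simp flip: mult_minus_distrib_mat_vec[of _ N N])

lemma calc_const: "c \<in> carrier_vec N \<Longrightarrow> calc (\<lambda>z. a) c = a \<cdot>\<^sub>v c"
proof -
  assume c: "c \<in> carrier_vec N"
  let ?v = "mat_adjoint H *\<^sub>v (R *\<^sub>v c)"
  have v: "?v \<in> carrier_vec N" using c by simp
  have "mat_diag N (\<lambda>j. a) *\<^sub>v ?v = a \<cdot>\<^sub>v ?v"
    by (rule mat_diag_const_mult_vec[OF v])
  then show ?thesis unfolding calc_def using c by (simp add: mult_mat_vec[of _ N N])
qed

lemma calc_ident: "c \<in> carrier_vec N \<Longrightarrow> calc (\<lambda>z. z) c = Q *\<^sub>v (U2 *\<^sub>v (mat_adjoint U1 *\<^sub>v (R *\<^sub>v c)))"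
  unfolding calc_def by (simp add: eigen_identity)

lemma gnorm_calc_ident: "c \<in> carrier_vec N \<Longrightarrow> gnorm (calc (\<lambda>z. z) c) = gnorm c"
  by (simp add: calc_ident gnorm_def)

text \<open>\<open>R\<close> cancels \<open>Q\<close> and \<open>H\<close> is unitary, so only a
  diagonal matrix has to be bounded. As the eigenvalues lie on the circle, a supremum bound there
  serves all pairs \<open>(N, M)\<close> alike.\<close>

lemma gnorm_calc_le:
  assumes c: "c \<in> carrier_vec N" and "\<And>j. j < N \<Longrightarrow> cmod (f (lam j)) \<le> B" "B \<ge> 0"
  shows "gnorm (calc f c) \<le> B * gnorm c"
  using vec_norm_mat_diag_le[of "mat_adjoint H *\<^sub>v (R *\<^sub>v c)" N "\<lambda>j. f (lam j)" B] assms
  by (simp add: calc_def gnorm_def)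

text \<open>The \<open>j\<close>th column of \<open>H\<close> is a unit eigenvector of the unitary
  matrix \<open>U2 U1*\<close>; comparing norms gives modulus 1.\<close>

lemma eigenvalue_in_circle: "j < N \<Longrightarrow> lam j \<in> unit_circle"
proof -
  assume j: "j < N"
  let ?e = "unit_vec N j :: complex Matrix.vec"
  have e: "?e \<in> carrier_vec N" by simp
  have D: "mat_diag N lam *\<^sub>v ?e = lam j \<cdot>\<^sub>v ?e"
    unfolding mat_diag_mult_vec[OF e] by (intro eq_vecI) (auto simp: unit_vec_def)
  have "vec_norm (H *\<^sub>v (mat_diag N lam *\<^sub>v (mat_adjoint H *\<^sub>v (H *\<^sub>v ?e)))) = 1"
    by (subst eigen_identity) (simp_all add: j)
  then have "vec_norm (lam j \<cdot>\<^sub>v ?e) = 1" by (simp add: D)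
  moreover have "(vec_norm (lam j \<cdot>\<^sub>v ?e))\<^sup>2 = (\<Sum>i<N. if i = j then (cmod (lam j))\<^sup>2 else 0)"
    unfolding vec_norm_squared by (intro sum.cong) (auto simp: unit_vec_def)
  ultimately have "(cmod (lam j))\<^sup>2 = 1" using j by simp
  then show ?thesis using norm_ge_zero[of "lam j"] by (auto simp: power2_eq_1_iff simp del: norm_ge_zero)
qed

text \<open>Since \<open>v_j\<close> is \<open>Q\<close> applied to the \<open>j\<close>th column of
  \<open>H\<close>, and \<open>G = R R\<close>, the number \<open>v_j* G c\<close> is the
  \<open>j\<close>th coordinate of \<open>H* R c\<close>. The sum of rank-one terms is thus the
  eigenvector expansion of \<open>calc f c\<close>. Measurability of \<open>f\<close> and the
  position of the eigenvalues on the circle evaluate the Dirac integrals.\<close>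

lemma mpedmd_integral_calc:
  assumes c: "c \<in> carrier_vec N" and f: "f \<in> borel_measurable circle_borel"
  shows "mpedmd_integral N G (mpedmd_V Q H) lam f *\<^sub>v c = calc f c"
proof -
  define V where "V = Q * H"
  have V: "V \<in> carrier_mat N N" by (simp add: V_def)
  have dimV: "dim_row V = N" "dim_col V = N" using carrier_matD[OF V] by auto
  have Gc: "G *\<^sub>v c = R *\<^sub>v (R *\<^sub>v c)"
    using c by (simp add: assoc_mult_mat_vec[of R N N R N c] flip: sqrt_facts(2))
  have G: "G \<in> carrier_mat N N" by (simp flip: sqrt_facts(2))
  have coord: "(G *\<^sub>v c) \<bullet>c col V j = vec_index (mat_adjoint H *\<^sub>v (R *\<^sub>v c)) j" if j: "j < N" for j
  proof -
    let ?e = "unit_vec N j :: complex Matrix.vec"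
    have "col H j = H *\<^sub>v ?e"
      using col_mult2[OF carriers(5) one_carrier_mat j] by (simp add: j right_mult_one_mat[OF carriers(5)])
    then have "col V j = Q *\<^sub>v (H *\<^sub>v ?e)"
      unfolding V_def using col_mult2[OF carriers(2) carriers(5) j] by simp
    then have "(G *\<^sub>v c) \<bullet>c col V j = (R *\<^sub>v c) \<bullet>c (mat_adjoint R *\<^sub>v (Q *\<^sub>v (H *\<^sub>v ?e)))"
      unfolding Gc using c by (simp add: cscalar_prod_adjoint[of R N N])
    also have "\<dots> = (R *\<^sub>v c) \<bullet>c (mat_adjoint (mat_adjoint H) *\<^sub>v ?e)"
      by (simp add: sqrt_facts)
    also have "\<dots> = (mat_adjoint H *\<^sub>v (R *\<^sub>v c)) \<bullet>c ?e"
      using c by (intro cscalar_prod_adjoint[symmetric, of _ N N]) auto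
    also have "\<dots> = (\<Sum>i<N. if i = j then vec_index (mat_adjoint H *\<^sub>v (R *\<^sub>v c)) j else 0)"
      unfolding cscalar_prod_sum by (intro sum.cong) (auto simp: unit_vec_def)
    finally show ?thesis using j by simp
  qed
  show ?thesis
  proof (rule eq_vecI)
    fix i assume "i < dim_vec (calc f c)"
    then have i: "i < N" using carrier_vecD[OF calc_carrier[OF c]] by simp
    have entry: "(outer_product (col V j) * G) $$ (i, k)
        = V $$ (i, j) * (\<Sum>l<N. G $$ (l, k) * cnj (V $$ (l, j)))" if "j < N" "k < N" for j k
      using that i G dimV
      by (simp add: outer_product_def scalar_prod_def lessThan_atLeast0 sum_distrib_left mult_ac)
    have "vec_index (mpedmd_integral N G (mpedmd_V Q H) lam f *\<^sub>v c) i
        = (\<Sum>k<N. (\<Sum>j<N. f (lam j) * (V $$ (i, j) * (\<Sum>l<N. G $$ (l, k) * cnj (V $$ (l, j))))) * vec_index c k)"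
      unfolding mpedmd_integral_def mpedmd_V_def V_def[symmetric] using i c f eigenvalue_in_circle entry
      by (simp add: scalar_prod_def lessThan_atLeast0 integral_return space_restrict_space
         )
    also have "\<dots> = (\<Sum>j<N. f (lam j) * V $$ (i, j) * (\<Sum>k<N. \<Sum>l<N. G $$ (l, k) * vec_index c k * cnj (V $$ (l, j))))"
      by (simp add: sum_distrib_left sum_distrib_right mult_ac) (rule sum.swap)
    also have "\<dots> = (\<Sum>j<N. f (lam j) * V $$ (i, j) * ((G *\<^sub>v c) \<bullet>c col V j))"
    proof (intro sum.cong refl arg_cong2[where f = "(*)"])
      fix j assume "j \<in> {..<N}"
      then show "(\<Sum>k<N. \<Sum>l<N. G $$ (l, k) * vec_index c k * cnj (V $$ (l, j))) = (G *\<^sub>v c) \<bullet>c col V j"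
        unfolding cscalar_prod_sum using G c dimV
        by (subst sum.swap) (simp add: scalar_prod_def lessThan_atLeast0 sum_distrib_right)
    qed
    also have "\<dots> = (\<Sum>j<N. V $$ (i, j) * (f (lam j) * vec_index (mat_adjoint H *\<^sub>v (R *\<^sub>v c)) j))"
      by (simp add: coord mult_ac)
    also have "\<dots> = vec_index (V *\<^sub>v (mat_diag N (\<lambda>j. f (lam j)) *\<^sub>v (mat_adjoint H *\<^sub>v (R *\<^sub>v c)))) i"
      using i c dimV by (subst mat_diag_mult_vec) (simp_all add: scalar_prod_def lessThan_atLeast0)
    also have "V *\<^sub>v (mat_diag N (\<lambda>j. f (lam j)) *\<^sub>v (mat_adjoint H *\<^sub>v (R *\<^sub>v c))) = calc f c"
      unfolding calc_def V_def using c by (simp add: assoc_mult_mat_vec[of Q N N H N])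
    finally show "vec_index (mpedmd_integral N G (mpedmd_V Q H) lam f *\<^sub>v c) i = vec_index (calc f c) i" .
  next
    show "dim_vec (mpedmd_integral N G (mpedmd_V Q H) lam f *\<^sub>v c) = dim_vec (calc f c)"
      using carrier_vecD[OF calc_carrier[OF c]] by (simp add: mpedmd_integral_def)
  qed
qed

text \<open>\<open>A = R U\<^sub>2 S U\<^sub>1\<^sup>* R\<close>, so in the coordinates \<open>U\<^sub>1\<^sup>* R c\<close> and \<open>U\<^sub>2\<^sup>* R d\<close> the form of \<open>A\<close> is diagonal.\<close>

lemma form_diagonal:
  obtains s where "\<And>i. i < N \<Longrightarrow> 0 \<le> s i"
    "\<And>c d. c \<in> carrier_vec N \<Longrightarrow> d \<in> carrier_vec N \<Longrightarrow> (A *\<^sub>v c) \<bullet>c d =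
      (\<Sum>i<N. complex_of_real (s i) * vec_index (mat_adjoint U1 *\<^sub>v (R *\<^sub>v c)) i
        * cnj (vec_index (mat_adjoint U2 *\<^sub>v (R *\<^sub>v d)) i))"
proof -
  obtain s where s: "\<And>i. i < N \<Longrightarrow> 0 \<le> s i" and S: "S = mat_diag N (\<lambda>i. complex_of_real (s i))"
    and svd: "Q * mat_adjoint A * Q = U1 * S * mat_adjoint U2"
    using factors by (auto simp: mpedmd_factors_def is_svd_def)
  have "(A *\<^sub>v c) \<bullet>c d = (\<Sum>i<N. complex_of_real (s i) * vec_index (mat_adjoint U1 *\<^sub>v (R *\<^sub>v c)) i
        * cnj (vec_index (mat_adjoint U2 *\<^sub>v (R *\<^sub>v d)) i))"
    if c: "c \<in> carrier_vec N" and d: "d \<in> carrier_vec N" for c d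
  proof -
    have [simp]: "S \<in> carrier_mat N N" by (simp add: S)
    let ?w = "S *\<^sub>v (mat_adjoint U2 *\<^sub>v (R *\<^sub>v d))"
    have "(Q * mat_adjoint A * Q) *\<^sub>v (R *\<^sub>v d) = (U1 * S * mat_adjoint U2) *\<^sub>v (R *\<^sub>v d)"
      by (simp add: svd)
    then have "Q *\<^sub>v (mat_adjoint A *\<^sub>v d) = U1 *\<^sub>v ?w"
      using d by (simp add: assoc_mult_mat_vec[of _ N N _ N] mult_carrier_mat[of _ N N _ N])
    then have "R *\<^sub>v (Q *\<^sub>v (mat_adjoint A *\<^sub>v d)) = R *\<^sub>v (U1 *\<^sub>v ?w)" by simp
    then have eq: "mat_adjoint A *\<^sub>v d = R *\<^sub>v (U1 *\<^sub>v ?w)" using d by simp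
    have "(A *\<^sub>v c) \<bullet>c d = c \<bullet>c (mat_adjoint R *\<^sub>v (U1 *\<^sub>v ?w))"
      unfolding sqrt_facts eq[symmetric] by (rule cscalar_prod_adjoint[OF A c d])
    also have "\<dots> = (R *\<^sub>v c) \<bullet>c (mat_adjoint (mat_adjoint U1) *\<^sub>v ?w)"
      using c d by (subst cscalar_prod_adjoint[symmetric, of R N N]) auto
    also have "\<dots> = (mat_adjoint U1 *\<^sub>v (R *\<^sub>v c)) \<bullet>c ?w"
      using c d by (intro cscalar_prod_adjoint[symmetric, of _ N N]) auto
    finally show ?thesis
      unfolding S cscalar_prod_sum using c d
      by (subst (asm) mat_diag_mult_vec, simp) (subst (asm) mat_diag_mult_vec, simp, simp add: mult_ac)
  qed
  with s show ?thesis by (rule that)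
qed

text \<open>The form of \<open>A\<close> equals \<open>\<langle>T L c, d\<rangle>\<close> for the unitary mpEDMD operator \<open>T\<close> and a positive \<open>L\<close>;
  for positive \<open>L\<close> with \<open>\<parallel>L\<parallel> \<le> \<mu>\<close> one has \<open>L\<^sup>2 \<le> \<mu> L\<close>.\<close>

lemma polar_bound:
  assumes mu: "\<And>c d. c \<in> carrier_vec N \<Longrightarrow> d \<in> carrier_vec N \<Longrightarrow>
      cmod ((A *\<^sub>v c) \<bullet>c d) \<le> \<mu> * gnorm c * gnorm d"
    and c: "c \<in> carrier_vec N" and d: "d \<in> carrier_vec N"
  shows "(cmod ((A *\<^sub>v c) \<bullet>c d))\<^sup>2 \<le> \<mu> * (gnorm d)\<^sup>2 * Re ((A *\<^sub>v c) \<bullet>c calc (\<lambda>z. z) c)"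
proof -
  obtain s where s: "\<And>i. i < N \<Longrightarrow> 0 \<le> s i" and
    form: "\<And>c d. c \<in> carrier_vec N \<Longrightarrow> d \<in> carrier_vec N \<Longrightarrow> (A *\<^sub>v c) \<bullet>c d =
      (\<Sum>i<N. complex_of_real (s i) * vec_index (mat_adjoint U1 *\<^sub>v (R *\<^sub>v c)) i
        * cnj (vec_index (mat_adjoint U2 *\<^sub>v (R *\<^sub>v d)) i))"
    using form_diagonal by blast
  \<comment> \<open>The mpEDMD image of \<open>c\<close> has \<open>U2\<close>-coordinates equal to
    the \<open>U1\<close>-coordinates of \<open>c\<close>, so the diagonal form becomes a weighted
    sum of squares.\<close>
  have formT: "(A *\<^sub>v c) \<bullet>c calc (\<lambda>z. z) c =
      complex_of_real (\<Sum>i<N. s i * (cmod (vec_index (mat_adjoint U1 *\<^sub>v (R *\<^sub>v c)) i))\<^sup>2)"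
    if c: "c \<in> carrier_vec N" for c
    unfolding form[OF c calc_carrier[OF c]] of_real_sum of_real_mult complex_norm_square
    using c by (simp add: calc_ident mult_ac)
  have s_le: "s i \<le> \<mu>" if i: "i < N" for i
  proof -
    \<comment> \<open>\<open>U1* R ?c\<close> is the \<open>i\<close>th unit vector:
      \<open>?c\<close> and its image have \<open>gnorm\<close> 1, and the form evaluated on them is
      \<open>s i\<close>.\<close>
    let ?c = "Q *\<^sub>v (U1 *\<^sub>v unit_vec N i)"
    have c: "?c \<in> carrier_vec N" by simp
    have "(A *\<^sub>v ?c) \<bullet>c calc (\<lambda>z. z) ?c = complex_of_real (\<Sum>j<N. if j = i then s i else 0)"
      unfolding formT[OF c] by (intro arg_cong[where f = of_real] sum.cong) (auto simp: unit_vec_def)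
    with mu[OF c calc_carrier[OF c, of "\<lambda>z. z"]] show ?thesis
      using i s[OF i] gnorm_calc_ident[OF c] by (simp add: gnorm_def)
  qed
  let ?f = "\<lambda>i. cmod (vec_index (mat_adjoint U1 *\<^sub>v (R *\<^sub>v c)) i)"
  let ?e = "\<lambda>i. cmod (vec_index (mat_adjoint U2 *\<^sub>v (R *\<^sub>v d)) i)"
  have dim: "dim_vec (mat_adjoint U2 *\<^sub>v (R *\<^sub>v d)) = N" by (simp add: carrier_matD[OF carriers(4)])
  have e: "(gnorm d)\<^sup>2 = (\<Sum>i<N. (?e i)\<^sup>2)"
    using vec_norm_squared[of "mat_adjoint U2 *\<^sub>v (R *\<^sub>v d)"] d dim by (simp add: gnorm_def)
  have "cmod ((A *\<^sub>v c) \<bullet>c d) \<le> (\<Sum>i<N. (s i * ?f i) * ?e i)"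
    unfolding form[OF c d] by (rule order_trans[OF norm_sum]) (simp add: norm_mult s)
  then have "(cmod ((A *\<^sub>v c) \<bullet>c d))\<^sup>2 \<le> (\<Sum>i<N. (s i * ?f i) * ?e i)\<^sup>2"
    by (intro power_mono) auto
  \<comment> \<open>Cauchy-Schwarz keeps \<open>s i\<close> with the coordinates of
    \<open>c\<close>. Of its two powers one is then traded for \<open>\<mu>\<close>, and the other
    reproduces the form at \<open>c\<close> and its image.\<close>
  also have "\<dots> \<le> (\<Sum>i<N. (s i * ?f i)\<^sup>2) * (\<Sum>i<N. (?e i)\<^sup>2)"
    by (rule Cauchy_Schwarz_ineq_sum)
  also have "\<dots> \<le> (\<Sum>i<N. \<mu> * (s i * (?f i)\<^sup>2)) * (\<Sum>i<N. (?e i)\<^sup>2)"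
  proof (intro mult_right_mono sum_mono sum_nonneg)
    fix i assume "i \<in> {..<N}"
    then have "s i * (s i * (?f i)\<^sup>2) \<le> \<mu> * (s i * (?f i)\<^sup>2)"
      by (intro mult_right_mono s_le mult_nonneg_nonneg s) auto
    then show "(s i * ?f i)\<^sup>2 \<le> \<mu> * (s i * (?f i)\<^sup>2)"
      by (simp add: power2_eq_square mult_ac)
  qed auto
  also have "\<dots> = \<mu> * (gnorm d)\<^sup>2 * Re ((A *\<^sub>v c) \<bullet>c calc (\<lambda>z. z) c)"
    unfolding formT[OF c] e by (simp add: sum_distrib_left mult_ac)
  finally show ?thesis .
qed

end

section \<open>Iterated limits and dictionaries\<close>

text \<open>The filter of the nested limit: \<open>N\<close> is large, and \<open>M\<close> exceeds
  a threshold that may depend on \<open>N\<close>. It makes the usual limit laws available for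
  families indexed by pairs without any joint rate.\<close>

definition iterated :: "(nat \<times> nat) filter" where
  "iterated = Abs_filter (\<lambda>P. \<forall>\<^sub>F N in sequentially. \<forall>\<^sub>F M in sequentially. P (N, M))"

lemma eventually_iterated:
  "eventually P iterated \<longleftrightarrow> (\<forall>\<^sub>F N in sequentially. \<forall>\<^sub>F M in sequentially. P (N, M))"
  unfolding iterated_def
proof (rule eventually_Abs_filter, rule is_filter.intro, goal_cases)
  case (2 P Q)
  then show ?case by eventually_elim (rule eventually_conj)
next
  case (3 P Q)
  from 3(2) show ?case
    by (rule eventually_mono) (auto elim: eventually_mono simp: 3(1))
qed simp

lemma tendsto_iterated_inner:
  assumes "\<And>N. ((\<lambda>M. f (N, M)) \<longlonglongrightarrow> l)"
  shows "(f \<longlongrightarrow> l) iterated"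
  unfolding tendsto_def eventually_iterated using assms by (auto simp: tendsto_def)

lemma tendsto_iterated_outer:
  assumes "f \<longlonglongrightarrow> l"
  shows "((\<lambda>p. f (fst p)) \<longlongrightarrow> l) iterated"
  using assms unfolding tendsto_def eventually_iterated by simp

lemma limsup_tendsto_zero:
  assumes "(f \<longlongrightarrow> 0) iterated" and nonneg: "\<And>p. 0 \<le> f p"
  shows "(\<lambda>N. limsup (\<lambda>M. ereal (f (N, M)))) \<longlonglongrightarrow> 0"
proof (rule order_tendstoI)
  fix a :: ereal assume "a < 0"
  have "0 \<le> limsup (\<lambda>M. ereal (f (N, M)))" for N
    by (rule le_Limsup) (auto simp: nonneg)
  then show "\<forall>\<^sub>F N in sequentially. a < limsup (\<lambda>M. ereal (f (N, M)))"
    using \<open>a < 0\<close> by (simp add: less_le_trans)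
next
  fix a :: ereal assume "0 < a"
  \<comment> \<open>The limsup inherits only a weak inequality from \<open>f < e\<close>, so
    \<open>e\<close> is taken strictly below \<open>a\<close>.\<close>
  then obtain e where e: "0 < ereal e" "ereal e < a" using ereal_dense2 by blast
  then have "\<forall>\<^sub>F p in iterated. f p < e"
    using order_tendstoD(2)[OF assms(1), of e] by simp
  then show "\<forall>\<^sub>F N in sequentially. limsup (\<lambda>M. ereal (f (N, M))) < a"
    unfolding eventually_iterated
  proof eventually_elim
    case (elim N)
    have "limsup (\<lambda>M. ereal (f (N, M))) \<le> ereal e"
      using elim by (intro Limsup_bounded) (auto elim: eventually_mono)
    then show ?case using e(2) by simp
  qed
qed

section \<open>Dictionary combinations and convergence of forms\<close>

lemma dict_comb_L2:
  "(\<And>j. j < N \<Longrightarrow> \<psi> j \<in> L2 \<omega>) \<Longrightarrow> c \<in> carrier_vec N \<Longrightarrow> dict_comb \<psi> c \<in> L2 \<omega>"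
  unfolding dict_comb_def by (intro L2_sum L2_scale) auto

lemma dict_comb_minus:
  "c \<in> carrier_vec N \<Longrightarrow> d \<in> carrier_vec N \<Longrightarrow> dict_comb \<psi> (c - d) = (\<lambda>x. dict_comb \<psi> c x - dict_comb \<psi> d x)"
  by (rule ext) (simp add: dict_comb_def sum_subtractf left_diff_distrib)

lemma dict_comb_add:
  "c \<in> carrier_vec N \<Longrightarrow> d \<in> carrier_vec N \<Longrightarrow> dict_comb \<psi> (c + d) x = dict_comb \<psi> c x + dict_comb \<psi> d x"
  by (simp add: dict_comb_def sum.distrib ring_distribs)

lemma dict_comb_smult: "dict_comb \<psi> (a \<cdot>\<^sub>v c) x = a * dict_comb \<psi> c x"
  by (simp add: dict_comb_def sum_distrib_left mult.assoc)

lemma L2_inner_dict_comb: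
  assumes "\<And>j. j < N \<Longrightarrow> \<psi> j \<in> L2 \<omega>" and "\<And>j. j < N \<Longrightarrow> \<theta> j \<in> L2 \<omega>"
    and "c \<in> carrier_vec N" "d \<in> carrier_vec N"
  shows "L2_inner \<omega> (dict_comb \<psi> c) (dict_comb \<theta> d)
    = (\<Sum>j<N. \<Sum>k<N. L2_inner \<omega> (\<psi> k) (\<theta> j) * vec_index c k * cnj (vec_index d j))"
proof -
  have d: "(\<lambda>x. \<Sum>j<N. vec_index d j * \<theta> j x) \<in> L2 \<omega>"
    using assms by (intro L2_sum L2_scale) auto
  have dim: "dim_vec c = N" "dim_vec d = N" using assms by auto
  have "L2_inner \<omega> (dict_comb \<psi> c) (dict_comb \<theta> d)
    = (\<Sum>k<N. vec_index c k * L2_inner \<omega> (\<psi> k) (\<lambda>x. \<Sum>j<N. vec_index d j * \<theta> j x))"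
    unfolding dict_comb_def dim by (rule L2_inner_sum_left) (use assms d in auto)
  also have "\<dots> = (\<Sum>k<N. vec_index c k * (\<Sum>j<N. cnj (vec_index d j) * L2_inner \<omega> (\<psi> k) (\<theta> j)))"
    using assms by (intro sum.cong refl arg_cong2[where f = "(*)"] L2_inner_sum_right) auto
  also have "\<dots> = (\<Sum>k<N. \<Sum>j<N. L2_inner \<omega> (\<psi> k) (\<theta> j) * vec_index c k * cnj (vec_index d j))"
    by (simp add: sum_distrib_left mult_ac)
  finally show ?thesis by (subst sum.swap) simp
qed

lemma form_sum:
  fixes B :: "complex Matrix.mat"
  assumes "B \<in> carrier_mat N N" "c \<in> carrier_vec N" "d \<in> carrier_vec N"
  shows "(B *\<^sub>v c) \<bullet>c d = (\<Sum>j<N. \<Sum>k<N. B $$ (j, k) * vec_index c k * cnj (vec_index d j))"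
  unfolding cscalar_prod_sum using assms
  by (simp add: scalar_prod_def lessThan_atLeast0 sum_distrib_right)

text \<open>The Gram matrix is invertible, since a kernel vector would give a combination of norm 0.
  The coefficients are therefore linear in the inner products with the dictionary, which
  Cauchy-Schwarz bounds. The constant depends on \<open>N\<close> in an uncontrolled way; this is
  harmless because \<open>M\<close> tends to infinity first.\<close>

lemma dict_coefficient_bound:
  assumes L: "\<And>j. j < N \<Longrightarrow> \<psi> j \<in> L2 \<omega>" and indep: "dict_independent \<omega> N \<psi>"
  shows "\<exists>\<kappa>\<ge>0. \<forall>c\<in>carrier_vec N. \<forall>i<N. cmod (vec_index c i) \<le> \<kappa> * L2_norm \<omega> (dict_comb \<psi> c)"
proof -
  define B where "B = Matrix.mat N N (\<lambda>(j, k). L2_inner \<omega> (\<psi> k) (\<psi> j))"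
  have B: "B \<in> carrier_mat N N" by (simp add: B_def)
  have Bc: "vec_index (B *\<^sub>v c) j = L2_inner \<omega> (dict_comb \<psi> c) (\<psi> j)" if "c \<in> carrier_vec N" "j < N" for c j
  proof -
    have dim: "dim_vec c = N" using that by simp
    have "L2_inner \<omega> (dict_comb \<psi> c) (\<psi> j) = (\<Sum>k<N. vec_index c k * L2_inner \<omega> (\<psi> k) (\<psi> j))"
      unfolding dict_comb_def dim by (rule L2_inner_sum_left) (use that L in auto)
    then show ?thesis
      using that by (simp add: B_def scalar_prod_def lessThan_atLeast0 mult.commute)
  qed
  have "det B \<noteq> 0"
  proof
    assume "det B = 0"
    then obtain v where v: "v \<in> carrier_vec N" "v \<noteq> 0\<^sub>v N" "B *\<^sub>v v = 0\<^sub>v N"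
      using det_0_iff_vec_prod_zero_field[OF B] by blast
    have "L2_inner \<omega> (dict_comb \<psi> v) (dict_comb \<psi> v)
        = (\<Sum>j<N. \<Sum>k<N. L2_inner \<omega> (\<psi> k) (\<psi> j) * vec_index v k * cnj (vec_index v j))"
      by (rule L2_inner_dict_comb) (use L v in auto)
    also have "\<dots> = (B *\<^sub>v v) \<bullet>c v"
      unfolding form_sum[OF B v(1) v(1)] by (simp add: B_def)
    also have "\<dots> = 0" using v by simp
    finally have "L2_norm \<omega> (dict_comb \<psi> v) = 0" by (simp add: L2_inner_self)
    then have "AE x in \<omega>. dict_comb \<psi> v x = 0"
      using L2_norm_eq_0[OF dict_comb_L2[of N \<psi>, OF L v(1)]] by simp
    with indep v show False by (auto simp: dict_independent_def)
  qed
  then obtain C where C: "C \<in> carrier_mat N N" "C * B = 1\<^sub>m N"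
    using det_non_zero_imp_unit[OF B] unfolding Units_def ring_mat_def by auto
  \<comment> \<open>Summing over the rows too gives one constant for all \<open>i\<close>.\<close>
  define \<kappa> where "\<kappa> = (\<Sum>i<N. \<Sum>j<N. cmod (C $$ (i, j)) * L2_norm \<omega> (\<psi> j))"
  have "cmod (vec_index c i) \<le> \<kappa> * L2_norm \<omega> (dict_comb \<psi> c)" if c: "c \<in> carrier_vec N" and i: "i < N" for c i
  proof -
    have "c = C *\<^sub>v (B *\<^sub>v c)"
      using C B c by (simp flip: assoc_mult_mat_vec[of C N N B N c])
    then have "vec_index c i = vec_index (C *\<^sub>v (B *\<^sub>v c)) i" by simp
    also have "\<dots> = (\<Sum>j<N. C $$ (i, j) * vec_index (B *\<^sub>v c) j)"
      using C B c i by (simp add: scalar_prod_def lessThan_atLeast0)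
    also have "\<dots> = (\<Sum>j<N. C $$ (i, j) * L2_inner \<omega> (dict_comb \<psi> c) (\<psi> j))"
      by (intro sum.cong refl) (simp add: Bc[OF c] del: index_mult_mat_vec)
    also have "cmod \<dots> \<le> (\<Sum>j<N. cmod (C $$ (i, j)) * (L2_norm \<omega> (dict_comb \<psi> c) * L2_norm \<omega> (\<psi> j)))"
      by (rule order_trans[OF norm_sum], intro sum_mono)
        (auto simp: norm_mult intro!: mult_left_mono L2_Cauchy_Schwarz L dict_comb_L2[of N \<psi>, OF L c])
    also have "\<dots> = (\<Sum>j<N. cmod (C $$ (i, j)) * L2_norm \<omega> (\<psi> j)) * L2_norm \<omega> (dict_comb \<psi> c)"
      by (simp add: sum_distrib_left sum_distrib_right mult_ac)
    also have "\<dots> \<le> \<kappa> * L2_norm \<omega> (dict_comb \<psi> c)"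
      unfolding \<kappa>_def using i by (intro mult_right_mono member_le_sum sum_nonneg mult_nonneg_nonneg) auto
    finally show ?thesis .
  qed
  moreover have "\<kappa> \<ge> 0" unfolding \<kappa>_def by (intro sum_nonneg mult_nonneg_nonneg) auto
  ultimately show ?thesis by blast
qed

text \<open>By linear independence the coefficients are controlled by the \<open>L\<^sup>2\<close> norm, so that entrywise
  convergence of the matrices is convergence of the forms in operator norm.\<close>

lemma form_error:
  assumes L: "\<And>j. j < N \<Longrightarrow> \<psi> j \<in> L2 \<omega>" and indep: "dict_independent \<omega> N \<psi>"
    and B: "\<And>M. B M \<in> carrier_mat N N"
    and lim: "\<And>j k. j < N \<Longrightarrow> k < N \<Longrightarrow> (\<lambda>M. B M $$ (j, k)) \<longlonglongrightarrow> b j k"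
  shows "\<exists>\<delta>. \<delta> \<longlonglongrightarrow> 0 \<and> (\<forall>M. 0 \<le> \<delta> M) \<and> (\<forall>M. \<forall>c\<in>carrier_vec N. \<forall>d\<in>carrier_vec N.
    cmod ((B M *\<^sub>v c) \<bullet>c d - (\<Sum>j<N. \<Sum>k<N. b j k * vec_index c k * cnj (vec_index d j)))
      \<le> \<delta> M * L2_norm \<omega> (dict_comb \<psi> c) * L2_norm \<omega> (dict_comb \<psi> d))"
proof -
  obtain \<kappa> where \<kappa>: "\<kappa> \<ge> 0"
    "\<And>c i. c \<in> carrier_vec N \<Longrightarrow> i < N \<Longrightarrow> cmod (vec_index c i) \<le> \<kappa> * L2_norm \<omega> (dict_comb \<psi> c)"
    using dict_coefficient_bound[of N \<psi> \<omega>, OF L indep] by blast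
  define \<delta> where "\<delta> M = (\<Sum>j<N. \<Sum>k<N. cmod (B M $$ (j, k) - b j k)) * \<kappa>\<^sup>2" for M
  have "\<delta> \<longlonglongrightarrow> (\<Sum>j<N. \<Sum>k<N. cmod (b j k - b j k)) * \<kappa>\<^sup>2"
    unfolding \<delta>_def by (intro tendsto_intros lim) auto
  moreover have "0 \<le> \<delta> M" for M
    unfolding \<delta>_def by (intro mult_nonneg_nonneg sum_nonneg) auto
  moreover have "cmod ((B M *\<^sub>v c) \<bullet>c d - (\<Sum>j<N. \<Sum>k<N. b j k * vec_index c k * cnj (vec_index d j)))
      \<le> \<delta> M * L2_norm \<omega> (dict_comb \<psi> c) * L2_norm \<omega> (dict_comb \<psi> d)"
    if c: "c \<in> carrier_vec N" and d: "d \<in> carrier_vec N" for M c d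
  proof -
    let ?n = "\<lambda>c. L2_norm \<omega> (dict_comb \<psi> c)"
    have "(B M *\<^sub>v c) \<bullet>c d - (\<Sum>j<N. \<Sum>k<N. b j k * vec_index c k * cnj (vec_index d j))
        = (\<Sum>j<N. \<Sum>k<N. (B M $$ (j, k) - b j k) * vec_index c k * cnj (vec_index d j))"
      unfolding form_sum[OF B c d] by (simp add: left_diff_distrib sum_subtractf)
    also have "cmod \<dots> \<le> (\<Sum>j<N. \<Sum>k<N. cmod (B M $$ (j, k) - b j k) * (\<kappa> * ?n c) * (\<kappa> * ?n d))"
      using \<kappa> c d
      by (intro order_trans[OF norm_sum] sum_mono) (auto simp: norm_mult intro!: mult_mono mult_nonneg_nonneg)
    also have "\<dots> = \<delta> M * ?n c * ?n d"
      by (simp add: \<delta>_def sum_distrib_left sum_distrib_right power2_eq_square mult_ac)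
    finally show ?thesis .
  qed
  ultimately show ?thesis by auto
qed

lemma dense_approximation:
  assumes L: "\<And>N j. j < N \<Longrightarrow> \<psi> N j \<in> L2 \<omega>" and h: "h \<in> L2 \<omega>"
    and dense: "(\<lambda>N. L2_dist \<omega> h (dict_span N (\<psi> N))) \<longlonglongrightarrow> 0"
  shows "\<exists>d. (\<forall>N. d N \<in> carrier_vec N) \<and> (\<lambda>N. L2_norm \<omega> (\<lambda>x. h x - dict_comb (\<psi> N) (d N) x)) \<longlonglongrightarrow> 0"
proof -
  \<comment> \<open>The slack \<open>inverse (Suc N)\<close> stands in for a minimiser of the
    infimum and vanishes in the limit.\<close>
  have "\<exists>d\<in>carrier_vec N. L2_norm \<omega> (\<lambda>x. h x - dict_comb (\<psi> N) d x)
      < L2_dist \<omega> h (dict_span N (\<psi> N)) + inverse (Suc N)" for N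
  proof -
    have ne: "dict_span N (\<psi> N) \<noteq> {}" unfolding dict_span_def using zero_carrier_vec[of N] by blast
    have bdd: "bdd_below ((\<lambda>f. L2_norm \<omega> (\<lambda>x. h x - f x)) ` dict_span N (\<psi> N))"
      by (rule bdd_belowI[of _ 0]) auto
    have "\<exists>f\<in>dict_span N (\<psi> N). L2_norm \<omega> (\<lambda>x. h x - f x) < L2_dist \<omega> h (dict_span N (\<psi> N)) + inverse (Suc N)"
      unfolding L2_dist_def cINF_less_iff[OF ne bdd, symmetric] by simp
    then show ?thesis unfolding dict_span_def by blast
  qed
  then obtain d where d: "\<And>N. d N \<in> carrier_vec N"
    and dn: "\<And>N. L2_norm \<omega> (\<lambda>x. h x - dict_comb (\<psi> N) (d N) x)
      < L2_dist \<omega> h (dict_span N (\<psi> N)) + inverse (Suc N)" by metis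
  have "(\<lambda>N. L2_dist \<omega> h (dict_span N (\<psi> N)) + inverse (Suc N)) \<longlonglongrightarrow> 0"
    using tendsto_add[OF dense LIMSEQ_inverse_real_of_nat] by simp
  then have "(\<lambda>N. L2_norm \<omega> (\<lambda>x. h x - dict_comb (\<psi> N) (d N) x)) \<longlonglongrightarrow> 0"
    by (rule Lim_null_comparison[rotated]) (auto intro!: always_eventually less_imp_le[OF dn] simp del: of_nat_Suc)
  with d show ?thesis by blast
qed

section \<open>Strong convergence of the functional calculus\<close>

text \<open>Families are indexed by pairs so that the filter \<open>iterated\<close> applies
  directly. The factorisation is required only for large \<open>M\<close>, with a threshold
  depending on \<open>N\<close>: with fewer than \<open>N\<close> data points the matrix
  \<open>G\<close> is singular.\<close>

locale mpedmd_limit = pvm \<omega> E for \<omega> :: "'a measure" and E +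
  fixes T :: "('a \<Rightarrow> complex) \<Rightarrow> 'a \<Rightarrow> complex" and \<psi> :: "nat \<Rightarrow> nat \<Rightarrow> 'a \<Rightarrow> complex"
    and G A R Q U1 S U2 H :: "nat \<times> nat \<Rightarrow> complex Matrix.mat" and lam :: "nat \<times> nat \<Rightarrow> nat \<Rightarrow> complex"
  assumes dict_L2: "\<And>N j. j < N \<Longrightarrow> \<psi> N j \<in> L2 \<omega>"
    and dict_indep: "\<And>N. dict_independent \<omega> N (\<psi> N)"
    and G_carrier: "\<And>N M. G (N, M) \<in> carrier_mat N N"
    and A_carrier: "\<And>N M. A (N, M) \<in> carrier_mat N N"
    and factors: "\<And>N. \<forall>\<^sub>F M in sequentially. mpedmd_factors N (G (N, M)) (A (N, M)) (R (N, M)) (Q (N, M))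
        (U1 (N, M)) (S (N, M)) (U2 (N, M)) (H (N, M)) (lam (N, M))"
    and dense: "\<And>h. h \<in> L2 \<omega> \<Longrightarrow> (\<lambda>N. L2_dist \<omega> h (dict_span N (\<psi> N))) \<longlonglongrightarrow> 0"
    and quadrature_G: "\<And>N j k. j < N \<Longrightarrow> k < N \<Longrightarrow>
        (\<lambda>M. G (N, M) $$ (j, k)) \<longlonglongrightarrow> L2_inner \<omega> (\<psi> N k) (\<psi> N j)"
    and quadrature_A: "\<And>N j k. j < N \<Longrightarrow> k < N \<Longrightarrow>
        (\<lambda>M. A (N, M) $$ (j, k)) \<longlonglongrightarrow> L2_inner \<omega> (T (\<psi> N k)) (\<psi> N j)"
    and unitary: "L2_unitary \<omega> T"
    and spectral: "\<And>g. g \<in> L2 \<omega> \<Longrightarrow> has_pvm_integral \<omega> E (\<lambda>z. z) g (T g)"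
begin

abbreviation good :: "nat \<times> nat \<Rightarrow> bool" where
  "good p \<equiv> mpedmd (fst p) (G p) (A p) (R p) (Q p) (U1 p) (S p) (U2 p) (H p) (lam p)"

abbreviation comb :: "nat \<times> nat \<Rightarrow> complex Matrix.vec \<Rightarrow> 'a \<Rightarrow> complex" where
  "comb p \<equiv> dict_comb (\<psi> (fst p))"

abbreviation cnorm :: "nat \<times> nat \<Rightarrow> complex Matrix.vec \<Rightarrow> real" where
  "cnorm p c \<equiv> L2_norm \<omega> (comb p c)"

abbreviation gnorm :: "nat \<times> nat \<Rightarrow> complex Matrix.vec \<Rightarrow> real" where
  "gnorm p \<equiv> mpedmd.gnorm (R p)"

abbreviation calc :: "nat \<times> nat \<Rightarrow> (complex \<Rightarrow> complex) \<Rightarrow> complex Matrix.vec \<Rightarrow> complex Matrix.vec" where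
  "calc p \<equiv> mpedmd.calc (fst p) (R p) (Q p) (H p) (lam p)"

lemma eventually_good: "eventually good iterated"
  unfolding eventually_iterated
  by (intro always_eventually allI eventually_mono[OF factors]) (simp add: mpedmd_def A_carrier)

lemma comb_L2: "c \<in> carrier_vec (fst p) \<Longrightarrow> comb p c \<in> L2 \<omega>"
  by (rule dict_comb_L2) (rule dict_L2)

lemma T_linear: "L2_linear \<omega> T"
  using unitary by (simp add: L2_unitary_def)

lemma T_closed: "f \<in> L2 \<omega> \<Longrightarrow> T f \<in> L2 \<omega>"
  by (rule L2_linear_closed[OF T_linear])

lemma T_inner: "f \<in> L2 \<omega> \<Longrightarrow> g \<in> L2 \<omega> \<Longrightarrow> L2_inner \<omega> (T f) (T g) = L2_inner \<omega> f g"
  using unitary by (simp add: L2_unitary_def)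

lemma T_norm: "f \<in> L2 \<omega> \<Longrightarrow> L2_norm \<omega> (T f) = L2_norm \<omega> f"
  using T_inner[of f f] unfolding L2_inner_self of_real_eq_iff by (simp add: power2_eq_iff_nonneg)

lemma T_norm_diff:
  assumes f: "f \<in> L2 \<omega>" and g: "g \<in> L2 \<omega>"
  shows "L2_norm \<omega> (\<lambda>x. T f x - T g x) = L2_norm \<omega> (\<lambda>x. f x - g x)"
proof -
  have "L2_norm \<omega> (\<lambda>x. T f x - T g x) = L2_norm \<omega> (T (\<lambda>x. f x - g x))"
    using L2_linear_diff[OF T_linear f g]
    by (intro L2_norm_cong_AE L2_diff T_closed f g) (auto elim: AE_mp)
  then show ?thesis using T_norm[OF L2_diff[OF f g]] by simp
qed

lemma T_comb_inner:
  assumes c: "c \<in> carrier_vec (fst p)" and d: "d \<in> carrier_vec (fst p)"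
  shows "L2_inner \<omega> (T (comb p c)) (comb p d) = (\<Sum>j<fst p. \<Sum>k<fst p.
    L2_inner \<omega> (T (\<psi> (fst p) k)) (\<psi> (fst p) j) * vec_index c k * cnj (vec_index d j))"
proof -
  have dim: "dim_vec c = fst p" using c by auto
  have TL: "j < fst p \<Longrightarrow> T (\<psi> (fst p) j) \<in> L2 \<omega>" for j by (intro T_closed dict_L2)
  have "AE x in \<omega>. T (comb p c) x = dict_comb (\<lambda>j. T (\<psi> (fst p) j)) c x"
    unfolding dict_comb_def dim by (rule L2_linear_sum[OF T_linear]) (auto intro: dict_L2)
  then have "L2_inner \<omega> (T (comb p c)) (comb p d) = L2_inner \<omega> (dict_comb (\<lambda>j. T (\<psi> (fst p) j)) c) (comb p d)"
    by (intro L2_inner_cong_AE T_closed comb_L2 c d dict_comb_L2[of "fst p"] TL) auto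
  then show ?thesis
    using L2_inner_dict_comb[of "fst p" "\<lambda>j. T (\<psi> (fst p) j)" \<omega> "\<psi> (fst p)" c d] TL dict_L2 c d by simp
qed

section \<open>Quadrature errors and comparison of norms\<close>

lemma uniform_form_error:
  assumes B: "\<And>N M. B (N, M) \<in> carrier_mat N N"
    and lim: "\<And>N j k. j < N \<Longrightarrow> k < N \<Longrightarrow> (\<lambda>M. B (N, M) $$ (j, k)) \<longlonglongrightarrow> b N j k"
  shows "\<exists>\<delta>. (\<delta> \<longlongrightarrow> 0) iterated \<and> (\<forall>p. 0 \<le> \<delta> p) \<and>
    (\<forall>p. \<forall>c\<in>carrier_vec (fst p). \<forall>d\<in>carrier_vec (fst p).
      cmod ((B p *\<^sub>v c) \<bullet>c d - (\<Sum>j<fst p. \<Sum>k<fst p. b (fst p) j k * vec_index c k * cnj (vec_index d j)))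
        \<le> \<delta> p * cnorm p c * cnorm p d)"
proof -
  define P where "P N \<delta> \<longleftrightarrow> \<delta> \<longlonglongrightarrow> 0 \<and> (\<forall>M. 0 \<le> \<delta> M) \<and> (\<forall>M. \<forall>c\<in>carrier_vec N. \<forall>d\<in>carrier_vec N.
    cmod ((B (N, M) *\<^sub>v c) \<bullet>c d - (\<Sum>j<N. \<Sum>k<N. b N j k * vec_index c k * cnj (vec_index d j)))
      \<le> \<delta> M * L2_norm \<omega> (dict_comb (\<psi> N) c) * L2_norm \<omega> (dict_comb (\<psi> N) d))" for N \<delta>
  have "\<exists>\<delta>. P N \<delta>" for N
    unfolding P_def by (rule form_error) (auto intro: dict_L2 dict_indep B lim)
  \<comment> \<open>Each \<open>N\<close> has its own null sequence in \<open>M\<close>. Gluing them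
    gives a function that is null along \<open>iterated\<close>, whatever the speeds.\<close>
  then obtain \<delta> where \<delta>: "\<And>N. P N (\<delta> N)" by metis
  have "((\<lambda>p. \<delta> (fst p) (snd p)) \<longlongrightarrow> 0) iterated"
    by (rule tendsto_iterated_inner) (use \<delta> in \<open>simp add: P_def\<close>)
  then show ?thesis
    using \<delta> by (intro exI[of _ "\<lambda>p. \<delta> (fst p) (snd p)"]) (auto simp: P_def)
qed

text \<open>A common relative error for both forms. As the bound covers all coefficient vectors at a
  pair, it applies to vectors that change with the pair, in particular to mpEDMD images.\<close>

definition error_rate :: "(nat \<times> nat \<Rightarrow> real) \<Rightarrow> bool" where
  "error_rate \<delta> \<longleftrightarrow> (\<delta> \<longlongrightarrow> 0) iterated \<and> (\<forall>p. 0 \<le> \<delta> p) \<and>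
    (\<forall>p. \<forall>c\<in>carrier_vec (fst p). \<forall>d\<in>carrier_vec (fst p).
      cmod ((G p *\<^sub>v c) \<bullet>c d - L2_inner \<omega> (comb p c) (comb p d)) \<le> \<delta> p * cnorm p c * cnorm p d \<and>
      cmod ((A p *\<^sub>v c) \<bullet>c d - L2_inner \<omega> (T (comb p c)) (comb p d)) \<le> \<delta> p * cnorm p c * cnorm p d)"

lemma ex_error_rate: "\<exists>\<delta>. error_rate \<delta>"
proof -
  obtain \<delta>1 where \<delta>1: "(\<delta>1 \<longlongrightarrow> 0) iterated \<and> (\<forall>p. 0 \<le> \<delta>1 p) \<and>
    (\<forall>p. \<forall>c\<in>carrier_vec (fst p). \<forall>d\<in>carrier_vec (fst p).
      cmod ((G p *\<^sub>v c) \<bullet>c d - (\<Sum>j<fst p. \<Sum>k<fst p.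
          L2_inner \<omega> (\<psi> (fst p) k) (\<psi> (fst p) j) * vec_index c k * cnj (vec_index d j)))
        \<le> \<delta>1 p * cnorm p c * cnorm p d)"
    by (atomize_elim, rule uniform_form_error) (auto intro: G_carrier quadrature_G)
  obtain \<delta>2 where \<delta>2: "(\<delta>2 \<longlongrightarrow> 0) iterated \<and> (\<forall>p. 0 \<le> \<delta>2 p) \<and>
    (\<forall>p. \<forall>c\<in>carrier_vec (fst p). \<forall>d\<in>carrier_vec (fst p).
      cmod ((A p *\<^sub>v c) \<bullet>c d - (\<Sum>j<fst p. \<Sum>k<fst p.
          L2_inner \<omega> (T (\<psi> (fst p) k)) (\<psi> (fst p) j) * vec_index c k * cnj (vec_index d j)))
        \<le> \<delta>2 p * cnorm p c * cnorm p d)"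
    by (atomize_elim, rule uniform_form_error) (auto intro: A_carrier quadrature_A)
  have nonneg: "0 \<le> \<delta>1 p" "0 \<le> \<delta>2 p" for p using \<delta>1 \<delta>2 by blast+
  define \<delta> where "\<delta> p = \<delta>1 p + \<delta>2 p" for p
  have le: "\<delta>1 p * cnorm p c * cnorm p d \<le> \<delta> p * cnorm p c * cnorm p d"
    "\<delta>2 p * cnorm p c * cnorm p d \<le> \<delta> p * cnorm p c * cnorm p d" for p c d
    unfolding \<delta>_def using nonneg by (intro mult_right_mono; simp)+
  have "(\<delta> \<longlongrightarrow> 0) iterated"
    unfolding \<delta>_def using tendsto_add[of \<delta>1 0 iterated \<delta>2 0] \<delta>1 \<delta>2 by simp
  moreover have "0 \<le> \<delta> p" for p unfolding \<delta>_def using nonneg by simp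
  moreover have "cmod ((G p *\<^sub>v c) \<bullet>c d - L2_inner \<omega> (comb p c) (comb p d)) \<le> \<delta> p * cnorm p c * cnorm p d"
    "cmod ((A p *\<^sub>v c) \<bullet>c d - L2_inner \<omega> (T (comb p c)) (comb p d)) \<le> \<delta> p * cnorm p c * cnorm p d"
    if c: "c \<in> carrier_vec (fst p)" and d: "d \<in> carrier_vec (fst p)" for p c d
  proof -
    have "L2_inner \<omega> (comb p c) (comb p d) = (\<Sum>j<fst p. \<Sum>k<fst p.
      L2_inner \<omega> (\<psi> (fst p) k) (\<psi> (fst p) j) * vec_index c k * cnj (vec_index d j))"
      by (rule L2_inner_dict_comb) (use c d dict_L2 in auto)
    then show "cmod ((G p *\<^sub>v c) \<bullet>c d - L2_inner \<omega> (comb p c) (comb p d)) \<le> \<delta> p * cnorm p c * cnorm p d"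
      using \<delta>1 c d by (intro order_trans[OF _ le(1)]) (simp del: split_paired_All)
    show "cmod ((A p *\<^sub>v c) \<bullet>c d - L2_inner \<omega> (T (comb p c)) (comb p d)) \<le> \<delta> p * cnorm p c * cnorm p d"
      unfolding T_comb_inner[OF c d] using \<delta>2 c d by (intro order_trans[OF _ le(2)]) (simp del: split_paired_All)
  qed
  ultimately show ?thesis unfolding error_rate_def by (intro exI[of _ \<delta>]) (simp del: split_paired_All)
qed

lemma error_rate_tendsto: "error_rate \<delta> \<Longrightarrow> (\<delta> \<longlongrightarrow> 0) iterated"
  unfolding error_rate_def by blast

lemma error_rate_nonneg: "error_rate \<delta> \<Longrightarrow> 0 \<le> \<delta> p"
  unfolding error_rate_def by blast

lemma error_rate_koopman:
  "error_rate \<delta> \<Longrightarrow> c \<in> carrier_vec (fst p) \<Longrightarrow> d \<in> carrier_vec (fst p) \<Longrightarrow>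
    cmod ((A p *\<^sub>v c) \<bullet>c d - L2_inner \<omega> (T (comb p c)) (comb p d)) \<le> \<delta> p * cnorm p c * cnorm p d"
  unfolding error_rate_def by blast

lemma error_rate_gnorm:
  assumes "error_rate \<delta>" and g: "good p" and c: "c \<in> carrier_vec (fst p)"
  shows "\<bar>(gnorm p c)\<^sup>2 - (cnorm p c)\<^sup>2\<bar> \<le> \<delta> p * (cnorm p c)\<^sup>2"
proof -
  have "cmod ((G p *\<^sub>v c) \<bullet>c c - L2_inner \<omega> (comb p c) (comb p c)) \<le> \<delta> p * cnorm p c * cnorm p c"
    using assms unfolding error_rate_def by blast
  then show ?thesis
    unfolding mpedmd.gnorm_squared[OF g c] L2_inner_self of_real_diff[symmetric] norm_of_real
    by (simp add: power2_eq_square mult.assoc)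
qed

text \<open>Once the error rate is below \<open>3/4\<close>, the squared norms satisfy
  \<open>cnorm^2 \<le> 4 gnorm^2\<close> because \<open>1 - 3/4 = 1/4\<close>, and
  \<open>gnorm^2 \<le> 4 cnorm^2\<close> because \<open>1 + 3/4 \<le> 4\<close>. The constant 2 is
  independent of the pair and of the vector.\<close>

lemma norms_equivalent:
  "\<forall>\<^sub>F p in iterated. good p \<and> (\<forall>c\<in>carrier_vec (fst p). cnorm p c \<le> 2 * gnorm p c \<and> gnorm p c \<le> 2 * cnorm p c)"
proof -
  obtain \<delta> where rate: "error_rate \<delta>" using ex_error_rate by blast
  note \<delta> = error_rate_tendsto[OF rate] error_rate_nonneg[OF rate] error_rate_gnorm[OF rate]
  have "\<forall>\<^sub>F p in iterated. \<delta> p < 3 / 4" using order_tendstoD(2)[OF \<delta>(1), of "3 / 4"] by simp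
  with eventually_good show ?thesis
  proof eventually_elim
    case (elim p)
    have "cnorm p c \<le> 2 * gnorm p c \<and> gnorm p c \<le> 2 * cnorm p c" if c: "c \<in> carrier_vec (fst p)" for c
    proof -
      have "\<delta> p * (cnorm p c)\<^sup>2 \<le> 3 / 4 * (cnorm p c)\<^sup>2" using elim by (intro mult_right_mono) auto
      with \<delta>(3)[OF elim(1) c] have "(cnorm p c)\<^sup>2 \<le> (2 * gnorm p c)\<^sup>2" "(gnorm p c)\<^sup>2 \<le> (2 * cnorm p c)\<^sup>2"
        by (simp_all add: power_mult_distrib abs_le_iff)
      then show ?thesis
        by (intro conjI; elim power2_le_imp_le) (simp_all add: mpedmd.gnorm_nonneg[OF elim(1)])
    qed
    with elim show ?case by blast
  qed
qed

text \<open>Membership in the coefficient space is asked only eventually, because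
  \<open>calc\<close> is controlled only at pairs where the factorisation exists. The vector may
  depend on \<open>M\<close>, as mpEDMD images do.\<close>

definition approx :: "(nat \<times> nat \<Rightarrow> complex Matrix.vec) \<Rightarrow> ('a \<Rightarrow> complex) \<Rightarrow> bool" where
  "approx c h \<longleftrightarrow> (\<forall>\<^sub>F p in iterated. c p \<in> carrier_vec (fst p)) \<and>
     ((\<lambda>p. L2_norm \<omega> (\<lambda>x. h x - comb p (c p) x)) \<longlongrightarrow> 0) iterated"

lemma approx_carrier: "approx c h \<Longrightarrow> \<forall>\<^sub>F p in iterated. c p \<in> carrier_vec (fst p)"
  by (simp add: approx_def)

lemma approx_tendsto: "approx c h \<Longrightarrow> ((\<lambda>p. L2_norm \<omega> (\<lambda>x. h x - comb p (c p) x)) \<longlongrightarrow> 0) iterated"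
  by (simp add: approx_def)

lemma approxI:
  assumes "\<forall>\<^sub>F p in iterated. c p \<in> carrier_vec (fst p)"
    and "\<forall>\<^sub>F p in iterated. L2_norm \<omega> (\<lambda>x. h x - comb p (c p) x) \<le> f p" and "(f \<longlongrightarrow> 0) iterated"
  shows "approx c h"
  unfolding approx_def using assms(1)
  by (rule conjI) (rule Lim_null_comparison[OF _ assms(3)], simp add: assms(2))

lemma approx_norm:
  assumes c: "approx c h" and h: "h \<in> L2 \<omega>"
  shows "((\<lambda>p. cnorm p (c p)) \<longlongrightarrow> L2_norm \<omega> h) iterated"
proof (rule LIM_zero_cancel, rule Lim_null_comparison[OF _ approx_tendsto[OF c]])
  show "\<forall>\<^sub>F p in iterated. norm (cnorm p (c p) - L2_norm \<omega> h) \<le> L2_norm \<omega> (\<lambda>x. h x - comb p (c p) x)"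
    using approx_carrier[OF c]
    by eventually_elim (use L2_norm_abs_diff[OF h comb_L2] in \<open>simp add: abs_minus_commute\<close>)
qed

text \<open>The difference is at most the error rate times the squared \<open>cnorm\<close>, so a
  bound on either norm suffices: one on \<open>gnorm\<close> passes to \<open>cnorm\<close> by
  equivalence. The disjunction serves the transfer of limits in both directions.\<close>

lemma gnorm_cnorm_difference:
  assumes c: "\<forall>\<^sub>F p in iterated. c p \<in> carrier_vec (fst p)"
    and l: "((\<lambda>p. cnorm p (c p)) \<longlongrightarrow> l) iterated \<or> ((\<lambda>p. gnorm p (c p)) \<longlongrightarrow> l) iterated"
  shows "((\<lambda>p. (gnorm p (c p))\<^sup>2 - (cnorm p (c p))\<^sup>2) \<longlongrightarrow> 0) iterated"
proof -
  obtain \<delta> where rate: "error_rate \<delta>" using ex_error_rate by blast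
  note \<delta> = error_rate_tendsto[OF rate] error_rate_nonneg[OF rate] error_rate_gnorm[OF rate]
  have bound: "\<forall>\<^sub>F p in iterated. norm ((gnorm p (c p))\<^sup>2 - (cnorm p (c p))\<^sup>2) \<le> \<delta> p * (cnorm p (c p))\<^sup>2"
    using c eventually_good by eventually_elim (simp add: \<delta>(3))
  from l show ?thesis
  proof
    assume "((\<lambda>p. cnorm p (c p)) \<longlongrightarrow> l) iterated"
    then have "((\<lambda>p. \<delta> p * (cnorm p (c p))\<^sup>2) \<longlongrightarrow> 0 * l\<^sup>2) iterated" by (intro tendsto_intros \<delta>(1))
    then show ?thesis by - (rule Lim_null_comparison[OF bound], simp)
  next
    assume "((\<lambda>p. gnorm p (c p)) \<longlongrightarrow> l) iterated"
    then have lim: "((\<lambda>p. \<delta> p * (2 * gnorm p (c p))\<^sup>2) \<longlongrightarrow> 0 * (2 * l)\<^sup>2) iterated" by (intro tendsto_intros \<delta>(1))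
    have "\<forall>\<^sub>F p in iterated. norm ((gnorm p (c p))\<^sup>2 - (cnorm p (c p))\<^sup>2) \<le> \<delta> p * (2 * gnorm p (c p))\<^sup>2"
      using bound norms_equivalent c
    proof eventually_elim
      case (elim p)
      have "\<delta> p * (cnorm p (c p))\<^sup>2 \<le> \<delta> p * (2 * gnorm p (c p))\<^sup>2"
        using elim by (intro mult_left_mono power_mono \<delta>(2)) auto
      with elim(1) show ?case by linarith
    qed
    from Lim_null_comparison[OF this] lim show ?thesis by simp
  qed
qed

lemma gnorm_tendsto:
  assumes "\<forall>\<^sub>F p in iterated. c p \<in> carrier_vec (fst p)" "((\<lambda>p. cnorm p (c p)) \<longlongrightarrow> l) iterated" "l \<ge> 0"
  shows "((\<lambda>p. gnorm p (c p)) \<longlongrightarrow> l) iterated"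
proof -
  have "((\<lambda>p. sqrt (((gnorm p (c p))\<^sup>2 - (cnorm p (c p))\<^sup>2) + (cnorm p (c p))\<^sup>2)) \<longlongrightarrow> sqrt (0 + l\<^sup>2)) iterated"
    by (intro tendsto_intros assms(2) gnorm_cnorm_difference[OF assms(1) disjI1[OF assms(2)]])
  moreover have "\<forall>\<^sub>F p in iterated. sqrt (((gnorm p (c p))\<^sup>2 - (cnorm p (c p))\<^sup>2) + (cnorm p (c p))\<^sup>2) = gnorm p (c p)"
    using eventually_good by eventually_elim (simp add: mpedmd.gnorm_nonneg)
  ultimately show ?thesis using \<open>l \<ge> 0\<close> by (simp add: tendsto_cong)
qed

lemma cnorm_tendsto:
  assumes "\<forall>\<^sub>F p in iterated. c p \<in> carrier_vec (fst p)" "((\<lambda>p. gnorm p (c p)) \<longlongrightarrow> l) iterated" "l \<ge> 0"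
  shows "((\<lambda>p. cnorm p (c p)) \<longlongrightarrow> l) iterated"
proof -
  have "((\<lambda>p. sqrt ((gnorm p (c p))\<^sup>2 - ((gnorm p (c p))\<^sup>2 - (cnorm p (c p))\<^sup>2))) \<longlongrightarrow> sqrt (l\<^sup>2 - 0)) iterated"
    by (intro tendsto_intros assms(2) gnorm_cnorm_difference[OF assms(1) disjI2[OF assms(2)]])
  then show ?thesis using \<open>l \<ge> 0\<close> by simp
qed

section \<open>Strong convergence for the identity function\<close>

lemma approx_dense:
  assumes h: "h \<in> L2 \<omega>"
  shows "\<exists>d. (\<forall>p. d p \<in> carrier_vec (fst p)) \<and> approx d h"
proof -
  obtain d where d: "\<And>N. d N \<in> carrier_vec N"
    "(\<lambda>N. L2_norm \<omega> (\<lambda>x. h x - dict_comb (\<psi> N) (d N) x)) \<longlonglongrightarrow> 0"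
    using dense_approximation[of \<psi>, OF dict_L2 h dense[OF h]] by blast
  from d tendsto_iterated_outer[OF d(2)] show ?thesis
    unfolding approx_def by (intro exI[of _ "\<lambda>p. d (fst p)"]) simp
qed


text \<open>The squared distance is expanded. The image has norm tending to that of
  \<open>h\<close>, being the image under an isometry for \<open>G\<close>; it remains to bound the
  real part of its pairing with \<open>T h\<close> from below. There \<open>polar_bound\<close> is
  tested on \<open>d\<close> approximating \<open>T h\<close>: the form of \<open>A\<close> at
  \<open>c\<close> and \<open>d\<close> tends to \<open>\<parallel>h\<parallel>^2\<close>, its
  square is divided by the squared norm of \<open>d\<close>, and
  \<open>\<parallel>h\<parallel>^2\<close> remains.\<close>

lemma approx_calc_ident:
  assumes h: "h \<in> L2 \<omega>" and c: "approx c h"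
  shows "approx (\<lambda>p. calc p (\<lambda>z. z) (c p)) (T h)"
proof -
  obtain \<delta> where rate: "error_rate \<delta>" using ex_error_rate by blast
  note \<delta> = error_rate_tendsto[OF rate] error_rate_nonneg[OF rate] error_rate_gnorm[OF rate]
    error_rate_koopman[OF rate]
  let ?t = "\<lambda>p. calc p (\<lambda>z. z) (c p)"
  let ?n = "L2_norm \<omega> h"
  let ?r = "\<lambda>p. L2_norm \<omega> (\<lambda>x. h x - comb p (c p) x)"
  note cc = approx_carrier[OF c] and r = approx_tendsto[OF c]
  have ThL: "T h \<in> L2 \<omega>" by (rule T_closed[OF h])
  have tc: "\<forall>\<^sub>F p in iterated. ?t p \<in> carrier_vec (fst p)"
    using cc eventually_good by eventually_elim (rule mpedmd.calc_carrier)
  have cn: "((\<lambda>p. cnorm p (c p)) \<longlongrightarrow> ?n) iterated" by (rule approx_norm[OF c h])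
  have gn: "((\<lambda>p. gnorm p (c p)) \<longlongrightarrow> ?n) iterated" by (rule gnorm_tendsto[OF cc cn]) simp
  have "\<forall>\<^sub>F p in iterated. gnorm p (c p) = gnorm p (?t p)"
    using cc eventually_good by eventually_elim (simp add: mpedmd.gnorm_calc_ident)
  then have "((\<lambda>p. gnorm p (?t p)) \<longlongrightarrow> ?n) iterated" using gn by (rule Lim_transform_eventually[rotated])
  then have tn: "((\<lambda>p. cnorm p (?t p)) \<longlongrightarrow> ?n) iterated" by (rule cnorm_tendsto[OF tc]) simp
  show ?thesis
  \<comment> \<open>The lower bound divides by the norm of \<open>d\<close>, which tends to that of
    \<open>h\<close>; for \<open>h\<close> of norm 0 the isometry alone gives the claim.\<close>
  proof (cases "?n = 0")
    case True
    show ?thesis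
    proof (rule approxI[OF tc])
      show "\<forall>\<^sub>F p in iterated. L2_norm \<omega> (\<lambda>x. T h x - comb p (?t p) x) \<le> 0 + cnorm p (?t p)"
        using tc
      proof eventually_elim
        case (elim p)
        show ?case using L2_norm_triangle_sub[OF ThL comb_L2[OF elim]] True T_norm[OF h] by simp
      qed
      show "((\<lambda>p. 0 + cnorm p (?t p)) \<longlongrightarrow> 0) iterated" using tn True by simp
    qed
  next
    case False
    then have n: "?n > 0" using L2_norm_nonneg[of \<omega> h] by linarith
    obtain d where dc: "\<And>p. d p \<in> carrier_vec (fst p)" and d: "approx d (T h)"
      using approx_dense[OF ThL] by blast
    let ?s = "\<lambda>p. L2_norm \<omega> (\<lambda>x. T h x - comb p (d p) x)"
    note s = approx_tendsto[OF d]
    have dn: "((\<lambda>p. cnorm p (d p)) \<longlongrightarrow> ?n) iterated" using approx_norm[OF d ThL] T_norm[OF h] by simp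
    have dg: "((\<lambda>p. gnorm p (d p)) \<longlongrightarrow> ?n) iterated" by (rule gnorm_tendsto[OF _ dn]) (simp_all add: dc)
    let ?A = "\<lambda>p. (A p *\<^sub>v c p) \<bullet>c d p"
    let ?X = "\<lambda>p. Re ((A p *\<^sub>v c p) \<bullet>c ?t p)"
    \<comment> \<open>The form of \<open>A\<close> is bounded by \<open>1 + \<delta>\<close>
      relative to L2 norms, and a squared L2 norm by the squared \<open>gnorm\<close> divided by
      \<open>1 - \<delta>\<close>.\<close>
    let ?\<mu> = "\<lambda>p. (1 + \<delta> p) / (1 - \<delta> p)"
    have Alim: "((\<lambda>p. cmod (?A p)) \<longlongrightarrow> ?n\<^sup>2) iterated"
    proof -
      have "\<forall>\<^sub>F p in iterated. norm (?A p - complex_of_real (?n\<^sup>2))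
          \<le> \<delta> p * cnorm p (c p) * cnorm p (d p) + ?r p * cnorm p (d p) + ?n * ?s p"
        using cc
      proof eventually_elim
        case (elim p)
        note L = comb_L2[OF elim] comb_L2[OF dc, of p]
        note TL = T_closed[OF L(1)]
        \<comment> \<open>Three errors: quadrature, the replacement of \<open>c\<close> by
          \<open>h\<close> under \<open>T\<close>, and the distance of \<open>d\<close> from
          \<open>T h\<close>.\<close>
        have eq: "?A p - complex_of_real (?n\<^sup>2) = (?A p - L2_inner \<omega> (T (comb p (c p))) (comb p (d p)))
          - L2_inner \<omega> (\<lambda>x. T h x - T (comb p (c p)) x) (comb p (d p))
          - L2_inner \<omega> (T h) (\<lambda>x. T h x - comb p (d p) x)"
          using L2_inner_self[of \<omega> "T h"] T_norm[OF h]
          by (simp add: L2_inner_diff_left[OF ThL TL L(2)] L2_inner_diff_right[OF ThL L(2) ThL])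
        show ?case
          unfolding eq
        proof (rule order_trans[OF norm_triangle_ineq4], rule add_mono, rule order_trans[OF norm_triangle_ineq4], rule add_mono)
          show "cmod (?A p - L2_inner \<omega> (T (comb p (c p))) (comb p (d p))) \<le> \<delta> p * cnorm p (c p) * cnorm p (d p)"
            by (rule \<delta>(4)[OF elim dc])
          show "cmod (L2_inner \<omega> (\<lambda>x. T h x - T (comb p (c p)) x) (comb p (d p))) \<le> ?r p * cnorm p (d p)"
            using L2_Cauchy_Schwarz[OF L2_diff[OF ThL TL] L(2)] T_norm_diff[OF h L(1)] by simp
          show "cmod (L2_inner \<omega> (T h) (\<lambda>x. T h x - comb p (d p) x)) \<le> ?n * ?s p"
            using L2_Cauchy_Schwarz[OF ThL L2_diff[OF ThL L(2)]] T_norm[OF h] by simp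
        qed
      qed
      moreover have "((\<lambda>p. \<delta> p * cnorm p (c p) * cnorm p (d p) + ?r p * cnorm p (d p) + ?n * ?s p)
          \<longlongrightarrow> 0 * ?n * ?n + 0 * ?n + ?n * 0) iterated"
        by (intro tendsto_add tendsto_mult tendsto_const \<delta>(1) cn dn r s)
      ultimately have "((\<lambda>p. ?A p - complex_of_real (?n\<^sup>2)) \<longlongrightarrow> 0) iterated"
        by - (rule Lim_null_comparison, assumption, simp)
      then have "(?A \<longlongrightarrow> complex_of_real (?n\<^sup>2)) iterated" by (rule LIM_zero_cancel)
      from tendsto_norm[OF this] show ?thesis by (simp del: of_real_power)
    qed
    have mu: "(?\<mu> \<longlongrightarrow> (1 + 0) / (1 - 0)) iterated" by (intro tendsto_divide tendsto_add tendsto_diff tendsto_const \<delta>(1)) simp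
    have Xlim: "((\<lambda>p. (cmod (?A p))\<^sup>2 / (?\<mu> p * (gnorm p (d p))\<^sup>2))
        \<longlongrightarrow> (?n\<^sup>2)\<^sup>2 / ((1 + 0) / (1 - 0) * ?n\<^sup>2)) iterated"
      by (intro tendsto_divide tendsto_mult tendsto_power Alim mu dg) (use n in simp)
    have Xge: "\<forall>\<^sub>F p in iterated. (cmod (?A p))\<^sup>2 / (?\<mu> p * (gnorm p (d p))\<^sup>2) \<le> ?X p"
    proof -
      have "\<forall>\<^sub>F p in iterated. \<delta> p < 1" using order_tendstoD(2)[OF \<delta>(1), of 1] by simp
      moreover have "\<forall>\<^sub>F p in iterated. 0 < gnorm p (d p)" by (rule order_tendstoD(1)[OF dg n])
      ultimately show ?thesis using cc eventually_good
      proof eventually_elim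
        case (elim p)
        interpret m: mpedmd "fst p" "G p" "A p" "R p" "Q p" "U1 p" "S p" "U2 p" "H p" "lam p" by (rule elim(4))
        have d1: "1 - \<delta> p > 0" using elim by simp
        have le: "(1 - \<delta> p) * (cnorm p e)\<^sup>2 \<le> (gnorm p e)\<^sup>2" if "e \<in> carrier_vec (fst p)" for e
          using \<delta>(3)[OF elim(4) that] by (simp add: abs_le_iff left_diff_distrib)
        have "cmod ((A p *\<^sub>v e) \<bullet>c f) \<le> ?\<mu> p * gnorm p e * gnorm p f"
          if e: "e \<in> carrier_vec (fst p)" and f: "f \<in> carrier_vec (fst p)" for e f
        proof -
          have "cmod (L2_inner \<omega> (T (comb p e)) (comb p f)) \<le> cnorm p e * cnorm p f"
            using L2_Cauchy_Schwarz[OF T_closed[OF comb_L2[OF e]] comb_L2[OF f]] T_norm[OF comb_L2[OF e]] by simp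
          then have "cmod ((A p *\<^sub>v e) \<bullet>c f) \<le> (1 + \<delta> p) * (cnorm p e * cnorm p f)"
            using \<delta>(4)[OF e f] norm_triangle_sub[of "(A p *\<^sub>v e) \<bullet>c f" "L2_inner \<omega> (T (comb p e)) (comb p f)"]
            by (simp add: ring_distribs)
          moreover have "(1 - \<delta> p) * (cnorm p e * cnorm p f) \<le> gnorm p e * gnorm p f"
          proof (rule power2_le_imp_le)
            have "((1 - \<delta> p) * (cnorm p e)\<^sup>2) * ((1 - \<delta> p) * (cnorm p f)\<^sup>2) \<le> (gnorm p e)\<^sup>2 * (gnorm p f)\<^sup>2"
              using d1 by (intro mult_mono le e f) auto
            then show "((1 - \<delta> p) * (cnorm p e * cnorm p f))\<^sup>2 \<le> (gnorm p e * gnorm p f)\<^sup>2"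
              by (simp add: power2_eq_square mult_ac)
          qed simp
          then have "(1 + \<delta> p) * (cnorm p e * cnorm p f) \<le> (1 + \<delta> p) * (gnorm p e * gnorm p f / (1 - \<delta> p))"
            using d1 \<delta>(2)[of p] by (intro mult_left_mono) (simp_all add: field_simps)
          ultimately show ?thesis by (simp add: mult_ac)
        qed
        then have "(cmod (?A p))\<^sup>2 \<le> ?\<mu> p * (gnorm p (d p))\<^sup>2 * ?X p"
          by (intro m.polar_bound elim(3) dc)
        moreover have "?\<mu> p * (gnorm p (d p))\<^sup>2 > 0"
          using d1 \<delta>(2)[of p] elim(2) by (intro mult_pos_pos divide_pos_pos) auto
        ultimately show ?case by (simp only: pos_divide_le_eq mult.commute[of "?X p"])
      qed
    qed
    \<comment> \<open>The expanded square with the pairing replaced by its lower bound, plus the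
      errors made in doing so. Its limit is \<open>?n^2 + ?n^2 - 2 ?n^2 = 0\<close>.\<close>
    let ?b = "\<lambda>p. ?n\<^sup>2 + (cnorm p (?t p))\<^sup>2 - 2 * ((cmod (?A p))\<^sup>2 / (?\<mu> p * (gnorm p (d p))\<^sup>2))
        + 2 * (\<delta> p * cnorm p (c p) * cnorm p (?t p) + ?r p * cnorm p (?t p))"
    have "\<forall>\<^sub>F p in iterated. (L2_norm \<omega> (\<lambda>x. T h x - comb p (?t p) x))\<^sup>2 \<le> ?b p"
      using cc tc Xge
    proof eventually_elim
      case (elim p)
      note L = comb_L2[OF elim(1)] comb_L2[OF elim(2)]
      note TL = T_closed[OF L(1)]
      have eq: "(A p *\<^sub>v c p) \<bullet>c ?t p - L2_inner \<omega> (T h) (comb p (?t p))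
          = ((A p *\<^sub>v c p) \<bullet>c ?t p - L2_inner \<omega> (T (comb p (c p))) (comb p (?t p)))
            - L2_inner \<omega> (\<lambda>x. T h x - T (comb p (c p)) x) (comb p (?t p))"
        by (simp add: L2_inner_diff_left[OF ThL TL L(2)])
      have "cmod ((A p *\<^sub>v c p) \<bullet>c ?t p - L2_inner \<omega> (T h) (comb p (?t p)))
          \<le> \<delta> p * cnorm p (c p) * cnorm p (?t p) + ?r p * cnorm p (?t p)"
        unfolding eq
      proof (rule order_trans[OF norm_triangle_ineq4], rule add_mono)
        show "cmod ((A p *\<^sub>v c p) \<bullet>c ?t p - L2_inner \<omega> (T (comb p (c p))) (comb p (?t p)))
            \<le> \<delta> p * cnorm p (c p) * cnorm p (?t p)"
          by (rule \<delta>(4)[OF elim(1,2)])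
        show "cmod (L2_inner \<omega> (\<lambda>x. T h x - T (comb p (c p)) x) (comb p (?t p))) \<le> ?r p * cnorm p (?t p)"
          using L2_Cauchy_Schwarz[OF L2_diff[OF ThL TL] L(2)] T_norm_diff[OF h L(1)] by simp
      qed
      then have "?X p - Re (L2_inner \<omega> (T h) (comb p (?t p)))
          \<le> \<delta> p * cnorm p (c p) * cnorm p (?t p) + ?r p * cnorm p (?t p)"
        using complex_Re_le_cmod[of "(A p *\<^sub>v c p) \<bullet>c ?t p - L2_inner \<omega> (T h) (comb p (?t p))"] by simp
      moreover have "a + b - 2 * r \<le> a + b - 2 * x + 2 * y" if "X - r \<le> y" "x \<le> X" for a b r x y X :: real
        using that by linarith
      ultimately show ?case
        unfolding L2_norm_diff_squared[OF ThL L(2)] T_norm[OF h] using elim(3) by blast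
    qed
    then have bound: "\<forall>\<^sub>F p in iterated. L2_norm \<omega> (\<lambda>x. T h x - comb p (?t p) x) \<le> sqrt (?b p)"
      by eventually_elim (rule real_le_rsqrt)
    have "((\<lambda>p. sqrt (?b p)) \<longlongrightarrow> sqrt (?n\<^sup>2 + ?n\<^sup>2 - 2 * ((?n\<^sup>2)\<^sup>2 / ((1 + 0) / (1 - 0) * ?n\<^sup>2))
        + 2 * (0 * ?n * ?n + 0 * ?n))) iterated"
      by (intro tendsto_add tendsto_diff tendsto_mult tendsto_power tendsto_real_sqrt tendsto_const Xlim \<delta>(1) cn tn r)
    moreover have "?n\<^sup>2 + ?n\<^sup>2 - 2 * ((?n\<^sup>2)\<^sup>2 / ((1 + 0) / (1 - 0) * ?n\<^sup>2)) + 2 * (0 * ?n * ?n + 0 * ?n) = 0"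
      using n by (simp add: power2_eq_square)
    ultimately have "((\<lambda>p. sqrt (?b p)) \<longlongrightarrow> 0) iterated" by simp
    then show ?thesis by (rule approxI[OF tc bound])
  qed
qed

text \<open>Existence of the integral is part of the notion, because \<open>pvm_integral\<close> is
  meaningful only where one exists. The value \<open>k\<close> is fixed before the family
  \<open>c\<close>, so one limit serves all families approximating \<open>h\<close>; products rely
  on this.\<close>

definition approximable :: "(complex \<Rightarrow> complex) \<Rightarrow> bool" where
  "approximable \<phi> \<longleftrightarrow> (\<forall>h\<in>L2 \<omega>. \<exists>k. has_pvm_integral \<omega> E \<phi> h k \<and>
     (\<forall>c. approx c h \<longrightarrow> approx (\<lambda>p. calc p \<phi> (c p)) k))"

lemma calc_carrier_eventually:
  assumes "\<forall>\<^sub>F p in iterated. c p \<in> carrier_vec (fst p)"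
  shows "\<forall>\<^sub>F p in iterated. calc p f (c p) \<in> carrier_vec (fst p)"
  using assms eventually_good by eventually_elim (rule mpedmd.calc_carrier)

lemma approx_cong:
  assumes "approx c h" "\<forall>\<^sub>F p in iterated. c p = d p"
  shows "approx d h"
  unfolding approx_def
proof
  show "\<forall>\<^sub>F p in iterated. d p \<in> carrier_vec (fst p)"
    using approx_carrier[OF assms(1)] assms(2) by eventually_elim simp
  show "((\<lambda>p. L2_norm \<omega> (\<lambda>x. h x - comb p (d p) x)) \<longlongrightarrow> 0) iterated"
    using approx_tendsto[OF assms(1)]
    by (rule Lim_transform_eventually) (use assms(2) in eventually_elim, simp)
qed

text \<open>The images under \<open>\<phi>'\<close> are themselves a family approximating
  \<open>k\<close>, to which the property of \<open>\<phi>\<close> applies; \<open>calc\<close> and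
  the integral are both multiplicative.\<close>

lemma approximable_mult:
  assumes \<phi>: "approximable \<phi>" and \<phi>': "approximable \<phi>'"
  shows "approximable (\<lambda>z. \<phi> z * \<phi>' z)"
  unfolding approximable_def
proof
  fix h assume h: "h \<in> L2 \<omega>"
  obtain k where k: "has_pvm_integral \<omega> E \<phi>' h k" "\<And>c. approx c h \<Longrightarrow> approx (\<lambda>p. calc p \<phi>' (c p)) k"
    using \<phi>' h unfolding approximable_def by blast
  obtain l where l: "has_pvm_integral \<omega> E \<phi> k l" "\<And>c. approx c k \<Longrightarrow> approx (\<lambda>p. calc p \<phi> (c p)) l"
    using \<phi> has_integral_L2[OF k(1)] unfolding approximable_def by blast
  have "approx (\<lambda>p. calc p (\<lambda>z. \<phi> z * \<phi>' z) (c p)) l" if c: "approx c h" for c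
  proof (rule approx_cong[OF l(2)[OF k(2)[OF c]]])
    show "\<forall>\<^sub>F p in iterated. calc p \<phi> (calc p \<phi>' (c p)) = calc p (\<lambda>z. \<phi> z * \<phi>' z) (c p)"
      using approx_carrier[OF c] eventually_good by eventually_elim (rule mpedmd.calc_mult)
  qed
  with has_integral_mult[OF l(1) k(1) h]
  show "\<exists>k. has_pvm_integral \<omega> E (\<lambda>z. \<phi> z * \<phi>' z) h k \<and>
      (\<forall>c. approx c h \<longrightarrow> approx (\<lambda>p. calc p (\<lambda>z. \<phi> z * \<phi>' z) (c p)) k)" by blast
qed

lemma approximable_add:
  assumes \<phi>: "approximable \<phi>" and \<phi>': "approximable \<phi>'"
  shows "approximable (\<lambda>z. \<phi> z + \<phi>' z)"
  unfolding approximable_def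
proof
  fix h assume h: "h \<in> L2 \<omega>"
  obtain k where k: "has_pvm_integral \<omega> E \<phi> h k" "\<And>c. approx c h \<Longrightarrow> approx (\<lambda>p. calc p \<phi> (c p)) k"
    using \<phi> h unfolding approximable_def by blast
  obtain l where l: "has_pvm_integral \<omega> E \<phi>' h l" "\<And>c. approx c h \<Longrightarrow> approx (\<lambda>p. calc p \<phi>' (c p)) l"
    using \<phi>' h unfolding approximable_def by blast
  note kL = has_integral_L2[OF k(1)] and lL = has_integral_L2[OF l(1)]
  have "approx (\<lambda>p. calc p (\<lambda>z. \<phi> z + \<phi>' z) (c p)) (\<lambda>x. k x + l x)" if c: "approx c h" for c
  proof (rule approx_cong)
    let ?a = "\<lambda>p. calc p \<phi> (c p)" and ?b = "\<lambda>p. calc p \<phi>' (c p)"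
    note a = k(2)[OF c] and b = l(2)[OF c]
    show "\<forall>\<^sub>F p in iterated. calc p \<phi> (c p) + calc p \<phi>' (c p) = calc p (\<lambda>z. \<phi> z + \<phi>' z) (c p)"
      using approx_carrier[OF c] eventually_good by eventually_elim (rule mpedmd.calc_add)
    show "approx (\<lambda>p. ?a p + ?b p) (\<lambda>x. k x + l x)"
    proof (rule approxI)
      show "\<forall>\<^sub>F p in iterated. ?a p + ?b p \<in> carrier_vec (fst p)"
        using approx_carrier[OF a] approx_carrier[OF b] by eventually_elim simp
      show "\<forall>\<^sub>F p in iterated. L2_norm \<omega> (\<lambda>x. k x + l x - comb p (?a p + ?b p) x)
        \<le> L2_norm \<omega> (\<lambda>x. k x - comb p (?a p) x) + L2_norm \<omega> (\<lambda>x. l x - comb p (?b p) x)"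
        using approx_carrier[OF a] approx_carrier[OF b]
      proof eventually_elim
        case (elim p)
        show ?case
          using L2_norm_triangle[OF L2_diff[OF kL comb_L2[OF elim(1)]] L2_diff[OF lL comb_L2[OF elim(2)]]]
          by (simp add: dict_comb_add[OF elim] algebra_simps)
      qed
      show "((\<lambda>p. L2_norm \<omega> (\<lambda>x. k x - comb p (?a p) x) + L2_norm \<omega> (\<lambda>x. l x - comb p (?b p) x)) \<longlongrightarrow> 0) iterated"
        using tendsto_add[OF approx_tendsto[OF a] approx_tendsto[OF b]] by simp
    qed
  qed
  with has_integral_comb[OF k(1) l(1) h, of 1 1]
  show "\<exists>k. has_pvm_integral \<omega> E (\<lambda>z. \<phi> z + \<phi>' z) h k \<and>
      (\<forall>c. approx c h \<longrightarrow> approx (\<lambda>p. calc p (\<lambda>z. \<phi> z + \<phi>' z) (c p)) k)" by auto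
qed

lemma approximable_const: "approximable (\<lambda>z. a)"
  unfolding approximable_def
proof
  fix h assume h: "h \<in> L2 \<omega>"
  have "approx (\<lambda>p. calc p (\<lambda>z. a) (c p)) (\<lambda>x. a * h x)" if c: "approx c h" for c
  proof (rule approx_cong)
    show "\<forall>\<^sub>F p in iterated. a \<cdot>\<^sub>v c p = calc p (\<lambda>z. a) (c p)"
      using approx_carrier[OF c] eventually_good by eventually_elim (simp add: mpedmd.calc_const)
    show "approx (\<lambda>p. a \<cdot>\<^sub>v c p) (\<lambda>x. a * h x)"
    proof (rule approxI)
      show "\<forall>\<^sub>F p in iterated. a \<cdot>\<^sub>v c p \<in> carrier_vec (fst p)"
        using approx_carrier[OF c] by eventually_elim simp
      show "\<forall>\<^sub>F p in iterated. L2_norm \<omega> (\<lambda>x. a * h x - comb p (a \<cdot>\<^sub>v c p) x)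
        \<le> cmod a * L2_norm \<omega> (\<lambda>x. h x - comb p (c p) x)"
        by (simp add: dict_comb_smult L2_norm_scale flip: right_diff_distrib)
      show "((\<lambda>p. cmod a * L2_norm \<omega> (\<lambda>x. h x - comb p (c p) x)) \<longlongrightarrow> 0) iterated"
        using tendsto_mult_left[OF approx_tendsto[OF c], of "cmod a"] by simp
    qed
  qed
  with has_integral_const[OF h, of a]
  show "\<exists>k. has_pvm_integral \<omega> E (\<lambda>z. a) h k \<and>
      (\<forall>c. approx c h \<longrightarrow> approx (\<lambda>p. calc p (\<lambda>z. a) (c p)) k)" by blast
qed

lemma approximable_ident: "approximable (\<lambda>z. z)"
  unfolding approximable_def using spectral approx_calc_ident by blast

text \<open>Since \<open>T\<close> is onto, \<open>h = T k\<close>; approximants \<open>d\<close> of \<open>k\<close> are then mapped to approximants of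
  \<open>h\<close>, and the isometry inverse to the mpEDMD operator takes them back.\<close>

lemma approximable_cnj: "approximable cnj"
  unfolding approximable_def
proof
  fix h assume h: "h \<in> L2 \<omega>"
  obtain k where k: "k \<in> L2 \<omega>" and Tk: "AE x in \<omega>. T k x = h x"
    using unitary h unfolding L2_unitary_def by blast
  \<comment> \<open>Surjectivity gives \<open>T k = h\<close> only almost everywhere, so the two are
    exchanged inside norms.\<close>
  have cong: "L2_norm \<omega> (\<lambda>x. h x - f x) = L2_norm \<omega> (\<lambda>x. T k x - f x)" if "f \<in> L2 \<omega>" for f
    using Tk by (intro L2_norm_cong_AE L2_diff h T_closed k that) (auto elim: AE_mp)
  obtain s where s: "\<And>n. simple_function circle_borel (s n)"
    "uniform_limit unit_circle s (\<lambda>z. z) sequentially"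
    "(\<lambda>n. L2_norm \<omega> (\<lambda>x. T k x - pvm_simple_integral E (s n) k x)) \<longlonglongrightarrow> 0"
    using has_integralE[OF spectral[OF k]] by blast
  have "has_pvm_integral \<omega> E (\<lambda>z. z) k h"
    unfolding has_pvm_integral_def
    by (intro conjI h exI[of _ s] allI s(1,2), subst cong[OF simple_integral_L2[OF s(1) k]], rule s(3))
  then have J: "has_pvm_integral \<omega> E cnj h k" by (rule has_integral_cnj[OF _ k])
  have "approx (\<lambda>p. calc p cnj (c p)) k" if c: "approx c h" for c
  proof -
    obtain d where dc: "\<And>p. d p \<in> carrier_vec (fst p)" and d: "approx d k"
      using approx_dense[OF k] by blast
    let ?t = "\<lambda>p. calc p (\<lambda>z. z) (d p)"
    have t: "approx ?t (T k)" by (rule approx_calc_ident[OF k d])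
    \<comment> \<open>The factor 4 comes from passing from \<open>cnorm\<close> to
      \<open>gnorm\<close> and back, a factor 2 each way; in between, \<open>calc cnj\<close> does
      not increase \<open>gnorm\<close>.\<close>
    let ?f = "\<lambda>p. L2_norm \<omega> (\<lambda>x. k x - comb p (d p) x)
      + 4 * (L2_norm \<omega> (\<lambda>x. h x - comb p (c p) x) + L2_norm \<omega> (\<lambda>x. T k x - comb p (?t p) x))"
    show ?thesis
    proof (rule approxI)
      show "\<forall>\<^sub>F p in iterated. calc p cnj (c p) \<in> carrier_vec (fst p)"
        by (rule calc_carrier_eventually[OF approx_carrier[OF c]])
      show "\<forall>\<^sub>F p in iterated. L2_norm \<omega> (\<lambda>x. k x - comb p (calc p cnj (c p)) x) \<le> ?f p"
        using approx_carrier[OF c] approx_carrier[OF t] norms_equivalent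
      proof eventually_elim
        case (elim p)
        interpret m: mpedmd "fst p" "G p" "A p" "R p" "Q p" "U1 p" "S p" "U2 p" "H p" "lam p"
          using elim(3) by blast
        let ?u = "m.calc cnj (c p)"
        have u: "?u \<in> carrier_vec (fst p)" by (rule m.calc_carrier[OF elim(1)])
        have circle: "cnj (lam p j) * lam p j = 1" if "j < fst p" for j
          using m.eigenvalue_in_circle[OF that]
          by (simp add: mult.commute[of "cnj (lam p j)"] flip: complex_norm_square)
        have "m.calc cnj (?t p) = m.calc (\<lambda>z. 1) (d p)"
          unfolding m.calc_mult[OF dc] by (rule m.calc_cong) (rule circle)
        also have "\<dots> = d p" using m.calc_const[OF dc, of 1] by simp
        finally have diff: "?u - d p = m.calc cnj (c p - ?t p)"
          using m.calc_minus[OF elim(1,2), of cnj] by simp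
        have "cnorm p (d p - ?u) = cnorm p (?u - d p)"
          unfolding dict_comb_minus[OF u dc] dict_comb_minus[OF dc u] by (rule L2_norm_minus_commute)
        also have "\<dots> \<le> 2 * m.gnorm (?u - d p)"
          using elim(3) u dc by auto
        also have "m.gnorm (?u - d p) \<le> 1 * m.gnorm (c p - ?t p)"
          unfolding diff using m.eigenvalue_in_circle elim by (intro m.gnorm_calc_le) auto
        also have "m.gnorm (c p - ?t p) \<le> 2 * cnorm p (c p - ?t p)"
          using elim by auto
        also have "cnorm p (c p - ?t p) \<le> L2_norm \<omega> (\<lambda>x. h x - comb p (c p) x) + L2_norm \<omega> (\<lambda>x. T k x - comb p (?t p) x)"
          using L2_norm_diff_triangle[OF comb_L2[OF elim(1)] h comb_L2[OF elim(2)]]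
          by (simp add: dict_comb_minus[OF elim(1,2)] L2_norm_minus_commute[of \<omega> "comb p (c p)" h] cong[OF comb_L2[OF elim(2)]])
        finally have "cnorm p (d p - ?u) \<le> 4 * (L2_norm \<omega> (\<lambda>x. h x - comb p (c p) x)
            + L2_norm \<omega> (\<lambda>x. T k x - comb p (?t p) x))" by simp
        moreover have "L2_norm \<omega> (\<lambda>x. k x - comb p ?u x) \<le> L2_norm \<omega> (\<lambda>x. k x - comb p (d p) x) + cnorm p (d p - ?u)"
          using L2_norm_diff_triangle[OF k comb_L2[OF dc] comb_L2[OF u]] by (simp add: dict_comb_minus[OF dc u])
        ultimately show ?case by linarith
      qed
      have "(?f \<longlongrightarrow> 0 + 4 * (0 + 0)) iterated"
        by (intro tendsto_add tendsto_mult tendsto_const approx_tendsto c d t)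
      then show "(?f \<longlongrightarrow> 0) iterated" by simp
    qed
  qed
  with J show "\<exists>k. has_pvm_integral \<omega> E cnj h k \<and> (\<forall>c. approx c h \<longrightarrow> approx (\<lambda>p. calc p cnj (c p)) k)"
    by blast
qed


text \<open>Polynomials in \<open>z\<close> alone are not dense in the continuous functions on the
  circle. Real polynomials in the two coordinates are, and their generators, the real linear
  functionals, are combinations of \<open>z\<close> and \<open>cnj z\<close>.\<close>

lemma approximable_real_polynomial:
  "real_polynomial_function q \<Longrightarrow> approximable (\<lambda>z. complex_of_real (q z))"
proof (induction rule: real_polynomial_function.induct)
  case (linear f)
  interpret bounded_linear f by (rule linear)
  \<comment> \<open>From \<open>f z = Re z * f 1 + Im z * f \<i>\<close> with
    \<open>Re z = (z + cnj z) / 2\<close> and \<open>Im z = (z - cnj z) / (2 \<i>)\<close>.\<close>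
  let ?a = "(complex_of_real (f 1) - \<i> * complex_of_real (f \<i>)) / 2"
    and ?b = "(complex_of_real (f 1) + \<i> * complex_of_real (f \<i>)) / 2"
  have "complex_of_real (f z) = ?a * z + ?b * cnj z" for z
  proof -
    have "f z = f (Re z *\<^sub>R 1 + Im z *\<^sub>R \<i>)"
      by (rule arg_cong[where f = f]) (simp add: complex_eq_iff)
    then have "f z = Re z * f 1 + Im z * f \<i>" by (simp add: add scaleR)
    then show ?thesis by (simp add: complex_eq_iff field_simps)
  qed
  then have "(\<lambda>z. complex_of_real (f z)) = (\<lambda>z. ?a * z + ?b * cnj z)" by (rule ext)
  then show ?case
    by (simp only:) (intro approximable_add approximable_mult approximable_const approximable_ident approximable_cnj)
qed (simp_all add: approximable_const approximable_add approximable_mult)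

text \<open>Three distances add up: between the integrals of \<open>\<phi>\<close> and
  \<open>q n\<close>, between the integral of \<open>q n\<close> and its mpEDMD counterpart, and
  between the mpEDMD counterparts of \<open>q n\<close> and \<open>\<phi>\<close>. The first and
  last are controlled by the supremum distance uniformly in the pair, so \<open>n\<close> is fixed
  first and only the middle one is sent to 0.\<close>

lemma approximable_uniform:
  assumes "\<And>e. e > 0 \<Longrightarrow> \<exists>q. approximable q \<and> (\<forall>z\<in>unit_circle. cmod (\<phi> z - q z) \<le> e)"
  shows "approximable \<phi>"
  unfolding approximable_def
proof
  fix h assume h: "h \<in> L2 \<omega>"
  have "\<exists>q. approximable q \<and> (\<forall>z\<in>unit_circle. cmod (\<phi> z - q z) \<le> inverse (Suc n))" for n
    by (rule assms) simp
  then obtain q where q: "\<And>n. approximable (q n)"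
    and q_le: "\<And>n z. z \<in> unit_circle \<Longrightarrow> cmod (\<phi> z - q n z) \<le> inverse (Suc n)" by metis
  define P where "P n k \<longleftrightarrow> has_pvm_integral \<omega> E (q n) h k \<and>
    (\<forall>c. approx c h \<longrightarrow> approx (\<lambda>p. calc p (q n) (c p)) k)" for n k
  have "\<exists>k. P n k" for n
    using q h unfolding approximable_def P_def by blast
  then obtain k where "\<And>n. P n (k n)" by metis
  then have k: "\<And>n. has_pvm_integral \<omega> E (q n) h (k n)"
    and ka: "\<And>n c. approx c h \<Longrightarrow> approx (\<lambda>p. calc p (q n) (c p)) (k n)"
    unfolding P_def by blast+
  have "uniform_limit unit_circle q \<phi> sequentially"
  proof (rule uniform_limitI)
    fix e :: real assume "e > 0"
    then have "\<forall>\<^sub>F n in sequentially. inverse (real (Suc n)) < e"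
      by (rule order_tendstoD(2)[OF LIMSEQ_inverse_real_of_nat])
    then show "\<forall>\<^sub>F n in sequentially. \<forall>z\<in>unit_circle. dist (q n z) (\<phi> z) < e"
    proof eventually_elim
      case (elim n)
      show ?case
      proof
        fix z :: complex assume "z \<in> unit_circle"
        from q_le[OF this, of n] elim show "dist (q n z) (\<phi> z) < e"
          by (simp add: dist_norm norm_minus_commute)
      qed
    qed
  qed
  then obtain l where l: "has_pvm_integral \<omega> E \<phi> h l"
    using has_integral_uniform_limit[where p = q and h = k, OF k h] by blast
  note lL = has_integral_L2[OF l] and kL = has_integral_L2[OF k]
  have lk: "L2_norm \<omega> (\<lambda>x. l x - k n x) \<le> inverse (Suc n) * L2_norm \<omega> h" for n
  proof -
    have "L2_norm \<omega> (\<lambda>x. 1 * l x + (-1) * k n x) \<le> inverse (real (Suc n)) * L2_norm \<omega> h"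
      by (rule has_integral_norm_le[OF has_integral_comb[OF l k h] h]) (use q_le[of _ n] in simp)
    then show ?thesis by simp
  qed
  have "approx (\<lambda>p. calc p \<phi> (c p)) l" if c: "approx c h" for c
    unfolding approx_def
  proof
    note cc = approx_carrier[OF c]
    show "\<forall>\<^sub>F p in iterated. calc p \<phi> (c p) \<in> carrier_vec (fst p)"
      by (rule calc_carrier_eventually[OF cc])
    show "((\<lambda>p. L2_norm \<omega> (\<lambda>x. l x - comb p (calc p \<phi> (c p)) x)) \<longlongrightarrow> 0) iterated"
    proof (rule tendstoI)
      fix e :: real assume e: "e > 0"
      \<comment> \<open>One of the five parts pays for \<open>l - k n\<close>. The other four pay
        for \<open>calc (q n)\<close> against \<open>calc \<phi>\<close>: two conversions between
        the norms at a factor 2 each, with \<open>c p\<close> eventually of norm below that of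
        \<open>h\<close> plus 1.\<close>
      let ?K = "5 * (L2_norm \<omega> h + 1)"
      have n1: "L2_norm \<omega> h + 1 > 0" using L2_norm_nonneg[of \<omega> h] by linarith
      then have "e / (2 * ?K) > 0" using e by simp
      from eventually_happens'[OF sequentially_bot order_tendstoD(2)[OF LIMSEQ_inverse_real_of_nat this]]
      obtain n where n: "inverse (real (Suc n)) < e / (2 * ?K)" by blast
      let ?e = "inverse (real (Suc n))"
      have e0: "?e \<ge> 0" by simp
      have K: "?e * ?K < e / 2" using n n1 by (simp add: field_simps)
      have "\<forall>\<^sub>F p in iterated. L2_norm \<omega> (\<lambda>x. k n x - comb p (calc p (q n) (c p)) x) < e / 2"
        using order_tendstoD(2)[OF approx_tendsto[OF ka[OF c]], of "e / 2"] e by simp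
      moreover have "\<forall>\<^sub>F p in iterated. cnorm p (c p) < L2_norm \<omega> h + 1"
        using order_tendstoD(2)[OF approx_norm[OF c h], of "L2_norm \<omega> h + 1"] by simp
      ultimately show "\<forall>\<^sub>F p in iterated. dist (L2_norm \<omega> (\<lambda>x. l x - comb p (calc p \<phi> (c p)) x)) 0 < e"
        using cc norms_equivalent
      proof eventually_elim
        case (elim p)
        interpret m: mpedmd "fst p" "G p" "A p" "R p" "Q p" "U1 p" "S p" "U2 p" "H p" "lam p"
          using elim(4) by blast
        let ?u = "m.calc (q n) (c p)" and ?v = "m.calc \<phi> (c p)"
        have u: "?u \<in> carrier_vec (fst p)" and v: "?v \<in> carrier_vec (fst p)"
          using m.calc_carrier[OF elim(3)] by auto
        have w: "m.calc (\<lambda>z. q n z - \<phi> z) (c p) \<in> carrier_vec (fst p)"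
          by (rule m.calc_carrier[OF elim(3)])
        have "?v + m.calc (\<lambda>z. q n z - \<phi> z) (c p) = ?u"
          unfolding m.calc_add[OF elim(3)] by simp
        then have "comb p ?u x = comb p ?v x + comb p (m.calc (\<lambda>z. q n z - \<phi> z) (c p)) x" for x
          by (simp flip: dict_comb_add[OF v w])
        then have "L2_norm \<omega> (\<lambda>x. comb p ?u x - comb p ?v x) = cnorm p (m.calc (\<lambda>z. q n z - \<phi> z) (c p))"
          by simp
        also have "\<dots> \<le> 2 * m.gnorm (m.calc (\<lambda>z. q n z - \<phi> z) (c p))"
          using elim(4) w by blast
        also have "m.gnorm (m.calc (\<lambda>z. q n z - \<phi> z) (c p)) \<le> ?e * m.gnorm (c p)"
          using q_le m.eigenvalue_in_circle
          by (intro m.gnorm_calc_le elim(3) e0) (simp add: norm_minus_commute)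
        also have "\<dots> \<le> ?e * (2 * (L2_norm \<omega> h + 1))"
          using elim(2,3,4) by (intro mult_left_mono e0) fastforce
        finally have uv: "L2_norm \<omega> (\<lambda>x. comb p ?u x - comb p ?v x) \<le> ?e * (4 * (L2_norm \<omega> h + 1))"
          by (simp add: algebra_simps del: of_nat_Suc)
        have "L2_norm \<omega> (\<lambda>x. l x - comb p ?v x) \<le> L2_norm \<omega> (\<lambda>x. l x - k n x)
            + (L2_norm \<omega> (\<lambda>x. k n x - comb p ?u x) + L2_norm \<omega> (\<lambda>x. comb p ?u x - comb p ?v x))"
          by (intro order_trans[OF L2_norm_diff_triangle[of l _ "k n"]] add_left_mono L2_norm_diff_triangle
              lL kL comb_L2 u v)
        also have "\<dots> < ?e * L2_norm \<omega> h + (e / 2 + ?e * (4 * (L2_norm \<omega> h + 1)))"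
          using lk[of n] elim(1) uv by linarith
        also have "\<dots> \<le> e / 2 + ?e * ?K" using e0 by (simp add: algebra_simps)
        also have "\<dots> < e" using K by linarith
        finally show ?case by simp
      qed
    qed
  qed
  with l show "\<exists>k. has_pvm_integral \<omega> E \<phi> h k \<and> (\<forall>c. approx c h \<longrightarrow> approx (\<lambda>p. calc p \<phi> (c p)) k)"
    by blast
qed

section \<open>Continuous functions and the limit theorem\<close>

lemma approximable_continuous:
  assumes "continuous_on unit_circle (\<phi> :: complex \<Rightarrow> real)"
  shows "approximable (\<lambda>z. complex_of_real (\<phi> z))"
proof (rule approximable_uniform)
  fix e :: real assume e: "e > 0"
  obtain q where q: "real_polynomial_function q" "\<And>z. z \<in> unit_circle \<Longrightarrow> \<bar>\<phi> z - q z\<bar> < e"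
    using Stone_Weierstrass_real_polynomial_function[OF compact_sphere assms e] by blast
  have "cmod (complex_of_real (\<phi> z) - complex_of_real (q z)) \<le> e" if "z \<in> unit_circle" for z
    using q(2)[OF that] by (simp flip: of_real_diff)
  with approximable_real_polynomial[OF q(1)]
  show "\<exists>q. approximable q \<and> (\<forall>z\<in>unit_circle. cmod (complex_of_real (\<phi> z) - q z) \<le> e)"
    by (intro exI[of _ "\<lambda>z. complex_of_real (q z)"]) simp
qed

theorem functional_calculus_limit:
  assumes \<phi>: "continuous_on unit_circle \<phi>" and g: "g \<in> L2 \<omega>"
    and gN: "\<And>N. gN N \<in> carrier_vec N"
    and gN_lim: "(\<lambda>N. L2_norm \<omega> (\<lambda>y. g y - dict_comb (\<psi> N) (gN N) y)) \<longlonglongrightarrow> 0"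
  shows "(\<lambda>N. limsup (\<lambda>M. ereal (L2_norm \<omega> (\<lambda>y.
            pvm_integral \<omega> E (\<lambda>z. complex_of_real (\<phi> z)) g y
            - dict_comb (\<psi> N)
                (mpedmd_integral N (G (N, M)) (mpedmd_V (Q (N, M)) (H (N, M))) (lam (N, M))
                   (\<lambda>z. complex_of_real (\<phi> z)) *\<^sub>v gN N) y)))) \<longlonglongrightarrow> 0"
proof -
  let ?\<phi> = "\<lambda>z. complex_of_real (\<phi> z)"
  let ?I = "pvm_integral \<omega> E ?\<phi> g"
  let ?d = "\<lambda>p. mpedmd_integral (fst p) (G p) (mpedmd_V (Q p) (H p)) (lam p) ?\<phi> *\<^sub>v gN (fst p)"
  obtain k where k: "has_pvm_integral \<omega> E ?\<phi> g k" "\<And>c. approx c g \<Longrightarrow> approx (\<lambda>p. calc p ?\<phi> (c p)) k"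
    using approximable_continuous[OF \<phi>] g unfolding approximable_def by blast
  have I: "has_pvm_integral \<omega> E ?\<phi> g ?I"
    unfolding pvm_integral_def using k(1) by (rule someI[where P = "has_pvm_integral \<omega> E ?\<phi> g"])
  note IL = has_integral_L2[OF I] and kL = has_integral_L2[OF k(1)]
  \<comment> \<open>\<open>pvm_integral\<close> selects an arbitrary representative; its distance to
    \<open>k\<close> is 0, so convergence to \<open>k\<close> passes to it.\<close>
  have Ik: "L2_norm \<omega> (\<lambda>x. ?I x - k x) = 0" by (rule has_integral_unique[OF I k(1) g])
  have meas: "?\<phi> \<in> borel_measurable circle_borel"
    using \<phi> by (intro borel_measurable_continuous_on_restrict continuous_on_of_real)
  have "approx (\<lambda>p. gN (fst p)) g"
    unfolding approx_def using gN tendsto_iterated_outer[OF gN_lim] by simp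
  from k(2)[OF this] have a: "approx (\<lambda>p. calc p ?\<phi> (gN (fst p))) k" .
  have "approx ?d ?I"
  proof (rule approx_cong)
    show "\<forall>\<^sub>F p in iterated. calc p ?\<phi> (gN (fst p)) = ?d p"
      using eventually_good by eventually_elim (simp add: mpedmd.mpedmd_integral_calc[OF _ gN meas])
    show "approx (\<lambda>p. calc p ?\<phi> (gN (fst p))) ?I"
    proof (rule approxI[OF approx_carrier[OF a] _ approx_tendsto[OF a]])
      show "\<forall>\<^sub>F p in iterated. L2_norm \<omega> (\<lambda>x. ?I x - comb p (calc p ?\<phi> (gN (fst p))) x)
          \<le> L2_norm \<omega> (\<lambda>x. k x - comb p (calc p ?\<phi> (gN (fst p))) x)"
        using approx_carrier[OF a]
      proof eventually_elim
        case (elim p)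
        show ?case using L2_norm_diff_triangle[OF IL kL comb_L2[OF elim]] Ik by simp
      qed
    qed
  qed
  from limsup_tendsto_zero[OF approx_tendsto[OF this]] show ?thesis by simp
qed

end

section \<open>Specialisation to the Koopman operator and its data\<close>

theorem theorem5p4:
  fixes \<Omega> :: "(real ^ 'd) set" and \<omega> :: "(real ^ 'd) measure"
    and F :: "real ^ 'd \<Rightarrow> real ^ 'd"
    and \<psi> :: "nat \<Rightarrow> nat \<Rightarrow> real ^ 'd \<Rightarrow> complex"
    and x :: "nat \<Rightarrow> nat \<Rightarrow> real ^ 'd" and w :: "nat \<Rightarrow> nat \<Rightarrow> real"
    and G A R Q U1 S U2 H :: "nat \<Rightarrow> nat \<Rightarrow> complex Matrix.mat"
    and lam :: "nat \<Rightarrow> nat \<Rightarrow> nat \<Rightarrow> complex"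
    and E :: "complex set \<Rightarrow> (real ^ 'd \<Rightarrow> complex) \<Rightarrow> (real ^ 'd \<Rightarrow> complex)"
    and \<phi> :: "complex \<Rightarrow> real"
    and g :: "real ^ 'd \<Rightarrow> complex" and gN :: "nat \<Rightarrow> complex Matrix.vec"
  assumes space: "space \<omega> = \<Omega>"
    and F_measurable: "F \<in> measurable \<omega> \<omega>"
    and F_preserving: "distr \<omega> \<omega> F = \<omega>"
    and dict_L2: "\<And>N j. j < N \<Longrightarrow> \<psi> N j \<in> L2 \<omega>"
    and dict_indep: "\<And>N. dict_independent \<omega> N (\<psi> N)"
    and points: "\<And>M m. m < M \<Longrightarrow> x M m \<in> \<Omega>"
    and weights: "\<And>M m. m < M \<Longrightarrow> 0 \<le> w M m"
    and G_def: "\<And>N M. G N M = mpedmd_G N M (\<psi> N) (x M) (w M)"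
    and A_def: "\<And>N M. A N M = mpedmd_A N M (\<psi> N) F (x M) (w M)"
    and G_invertible: "\<And>N. \<forall>\<^sub>F M in sequentially. invertible_mat (G N M)"
    and factors: "\<And>N M. invertible_mat (G N M) \<Longrightarrow>
        mpedmd_factors N (G N M) (A N M) (R N M) (Q N M) (U1 N M) (S N M) (U2 N M) (H N M) (lam N M)"
    and dense: "\<And>h. h \<in> L2 \<omega> \<Longrightarrow> (\<lambda>N. L2_dist \<omega> h (dict_span N (\<psi> N))) \<longlonglongrightarrow> 0"
    and quadrature_G: "\<And>N j k. j < N \<Longrightarrow> k < N \<Longrightarrow>
        (\<lambda>M. G N M $$ (j, k)) \<longlonglongrightarrow> L2_inner \<omega> (\<psi> N k) (\<psi> N j)"
    and quadrature_A: "\<And>N j k. j < N \<Longrightarrow> k < N \<Longrightarrow>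
        (\<lambda>M. A N M $$ (j, k)) \<longlonglongrightarrow> L2_inner \<omega> (koopman F (\<psi> N k)) (\<psi> N j)"
    and unitary: "L2_unitary \<omega> (koopman F)"
    and spectral: "spectral_measure_of \<omega> (koopman F) E"
    and lipschitz: "\<exists>C. C-lipschitz_on unit_circle \<phi>"
    and g: "g \<in> L2 \<omega>"
    and gN: "\<And>N. gN N \<in> carrier_vec N"
    and gN_lim: "(\<lambda>N. L2_norm \<omega> (\<lambda>y. g y - dict_comb (\<psi> N) (gN N) y)) \<longlonglongrightarrow> 0"
  shows "(\<lambda>N. limsup (\<lambda>M. ereal (L2_norm \<omega> (\<lambda>y.
            pvm_integral \<omega> E (\<lambda>z. complex_of_real (\<phi> z)) g y
            - dict_comb (\<psi> N)
                (mpedmd_integral N (G N M) (mpedmd_V (Q N M) (H N M)) (lam N M)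
                   (\<lambda>z. complex_of_real (\<phi> z)) *\<^sub>v gN N) y)))) \<longlonglongrightarrow> 0"
proof -
  have E: "projection_valued_measure \<omega> E"
    and T: "\<And>g. g \<in> L2 \<omega> \<Longrightarrow> has_pvm_integral \<omega> E (\<lambda>z. z) g (koopman F g)"
    using spectral by (auto simp: spectral_measure_of_def)
  have carrier: "mat_adjoint (data_matrix N M (\<psi> N) (x M)) \<in> carrier_mat N M" for N M
    by (rule mat_adjoint_carrier) (simp add: data_matrix_def)
  \<comment> \<open>The families are uncurried; the factorisations, given wherever \<open>G\<close>
    is invertible, become available at each \<open>N\<close> for all large \<open>M\<close>.\<close>
  interpret mpedmd_limit \<omega> E "koopman F" \<psi> "\<lambda>(N, M). G N M" "\<lambda>(N, M). A N M" "\<lambda>(N, M). R N M"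
    "\<lambda>(N, M). Q N M" "\<lambda>(N, M). U1 N M" "\<lambda>(N, M). S N M" "\<lambda>(N, M). U2 N M" "\<lambda>(N, M). H N M"
    "\<lambda>(N, M). lam N M"
  proof (unfold_locales, goal_cases)
    case (4 N M)
    show ?case unfolding G_def mpedmd_G_def split
      by (intro mult_carrier_mat[of _ _ M] carrier mat_diag_carrier) (simp add: data_matrix_def)
  next
    case (5 N M)
    show ?case unfolding A_def mpedmd_A_def split
      by (intro mult_carrier_mat[of _ _ M] carrier mat_diag_carrier) (simp add: data_matrix_def)
  next
    case (6 N)
    show ?case unfolding split
      using G_invertible[of N] by eventually_elim (rule factors)
  qed (use E dict_L2 dict_indep dense quadrature_G quadrature_A unitary T in auto)
  obtain C where "C-lipschitz_on unit_circle \<phi>" using lipschitz by blast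
  then have "continuous_on unit_circle \<phi>" by (rule lipschitz_on_continuous_on)
  from functional_calculus_limit[OF this g gN gN_lim] show ?thesis by simp
qed

end
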